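(* Let $m_1\ge m_2\ge\dots\ge m_l\ge 0$ be integers, and let the irreducible representation of $G_\infty$ with signature $(m_1,\dots,m_l,0,0,\dots)$ be the inductive limit of the representations $$(m_1,\dots,m_l)\preceq(m_1,\dots,m_l,0)\preceq(m_1,\dots,m_l,0,0)\preceq\cdots$$ of $G_l,G_{l+1},G_{l+2},\dots$. Then the inductive limit of the contragredient representations $$(m_1,\dots,m_l)^*\preceq(m_1,\dots,m_l,0)^*\preceq(m_1,\dots,m_l,0,0)^*\preceq\cdots$$ is also an irreducible representation of $G_\infty$, with signature $(-m_1,-m_2,\dots,-m_l,0,0,\dots)$.
   Context: $G_k$ denotes $U(k)$ (or $GL(k,\mathbb C)$), embedded in $G_{k+1}$ by $g\mapsto\begin{pmatrix}g&0\\0&1\end{pmatrix}$, and $G_\infty=\bigcup_k G_k$. For $g\in G_k$ write $g^\vee=(g^{-1})^T$. Realization of $(m)$. Take $n=l$. Let $\mathcal F_k$ be the Hilbert space completion of the polynomial functions on $\mathbb C^{n\times k}$ for the inner product $\langle f_1,f_2\rangle=f_1(D)\overline{f_2(\bar Z)}|_{Z=0}$, where $f_1(D)$ is obtained by replacing each $Z_{ij}$ by $\partial/\partial Z_{ij}$. Functions on $\mathbb C^{n\times k}$ are regarded as functions on $\mathbb C^{n\times(k+1)}$ not depending on the last column; this is an isometric embedding $\mathcal F_k\subset\mathcal F_{k+1}$. $G_k$ acts by $[R_k(g)f](Z)=f(Zg)$. For $k\ge l$ the irreducible representation $(m_1,\dots,m_l,0,\dots,0)$ of $G_k$ is realized by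 $R_k$ on the space $V_k^{(m)}$ of polynomials with $f(bZ)=b_{11}^{m_1}\cdots b_{nn}^{m_n}f(Z)$ for all lower triangular invertible $b\in GL(n,\mathbb C)$; its highest weight vector is denoted $f_{max}$, and is the same function for all $k\ge l$. Realization of the contragredient. On polynomial functions of $w=(w_{ij})\in\mathbb C^{n\times k}$, with the same inner product and the same embeddings (functions not depending on the last column of $w$), let $G_k$ act by $[R_k^\vee(g)f](w)=f(wg^\vee)$. The contragredient (dual) representation $(m_1,\dots,m_l,0,\dots,0)^*$ of $G_k$ is realized by $R_k^\vee$ on the span $V_k^{(m^\vee)}$ of the $G_k$-orbit of the vector $f_{min}^\vee(w):=f_{max}(w)$. For a sequence of representations $(R_k,V_k)$ of $G_k$ with $G_k$-equivariant isometric embeddings $V_k\subset V_{k+1}$ (written $V_k\preceq V_{k+1}$), the inductive limit is the representation of $G_\infty$ on the Hilbert space completion of $\bigcup_kV_k$ given by the action of $R_k(g)$ on $V_k$ for $g\in G_k$. Irreducible means having no proper nonzero closed invariant subspace. Signatures. $(m_1,\dots,m_l,0,0,\dots)$ refers to the highest weight. For the contragredient representations, the signature is the lowest weight: an inductive limit has signature $(-m_1,\dots,-m_l,0,0,\dots)$ if it is generated by a nonzero vector $f$ in $\bigcup_k V_k$ such that, for all sufficiently large $k$, every diagonal $d\in G_k$ acts on $f$ by the scalar $d_{11}^{-m_1}\cdots d_{ll}^{-m_l}$ and every lower triangular unipotent matrix in $GL(k,\mathbb C)$ fixes $f$ (for $G_k=U(k)$ the action on $V_k$ is extended holomorphically to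 $GL(k,\mathbb C)$). *)

theory Defs
  imports "HOL-Analysis.Analysis" "HOL-Library.Poly_Mapping"
begin

text \<open>
  All matrices are doubly infinite arrays, with indices starting at \<open>0\<close>.  A \<open>k \<times> k\<close> matrix \<open>g\<close> is
  represented by the block matrix \<open>diag(g, 1, 1, \<dots>)\<close>, so that the embeddings of \<open>GL(k)\<close> into
  \<open>GL(k+1)\<close> are inclusions of sets.  A function on \<open>n \<times> k\<close> matrices is represented by a function of
  infinite arrays that depends on the entries in the first \<open>n\<close> rows and \<open>k\<close> columns only, so that
  the embedding of functions of \<open>k\<close> columns into functions of \<open>k+1\<close> columns is an inclusion as well.
\<close>

type_synonym arr = "nat \<Rightarrow> nat \<Rightarrow> complex"
type_synonym cfun = "arr \<Rightarrow> complex"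

text \<open>
  The sums below are finite whenever \<open>A\<close> has finite rows or \<open>B\<close> has finite columns; in every use one
  factor is of the form \<open>diag(g, 1, 1, \<dots>)\<close>.
\<close>

definition arr_mult :: "arr \<Rightarrow> arr \<Rightarrow> arr" (infixl "\<bullet>\<bullet>" 70) where
  "A \<bullet>\<bullet> B = (\<lambda>i j. Sum_any (\<lambda>p. A i p * B p j))"

definition arr_one :: arr where
  "arr_one = (\<lambda>i j. if i = j then 1 else 0)"

definition arr_transpose :: "arr \<Rightarrow> arr" where
  "arr_transpose A = (\<lambda>i j. A j i)"

definition arr_adjoint :: "arr \<Rightarrow> arr" where
  "arr_adjoint A = (\<lambda>i j. cnj (A j i))"

definition block :: "nat \<Rightarrow> arr set" where
  "block k = {g. \<forall>i j. k \<le> i \<or> k \<le> j \<longrightarrow> g i j = arr_one i j}"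

definition GL :: "nat \<Rightarrow> arr set" where
  "GL k = {g \<in> block k. \<exists>h \<in> block k. g \<bullet>\<bullet> h = arr_one \<and> h \<bullet>\<bullet> g = arr_one}"

definition unitary :: "nat \<Rightarrow> arr set" where
  "unitary k = {g \<in> block k. g \<bullet>\<bullet> arr_adjoint g = arr_one \<and> arr_adjoint g \<bullet>\<bullet> g = arr_one}"

definition limit_group :: "(nat \<Rightarrow> arr set) \<Rightarrow> arr set" where
  "limit_group G = (\<Union>k. G k)"

definition arr_inverse :: "arr \<Rightarrow> arr" where
  "arr_inverse g = (THE h. h \<in> limit_group GL \<and> g \<bullet>\<bullet> h = arr_one \<and> h \<bullet>\<bullet> g = arr_one)"

text \<open>\<open>check g\<close> is \<open>(g\<inverse>)\<^sup>T\<close>.\<close>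

definition check :: "arr \<Rightarrow> arr" where
  "check g = arr_transpose (arr_inverse g)"

definition diagonal :: "arr \<Rightarrow> bool" where
  "diagonal A \<longleftrightarrow> (\<forall>i j. i \<noteq> j \<longrightarrow> A i j = 0)"

definition lower_triangular :: "arr \<Rightarrow> bool" where
  "lower_triangular A \<longleftrightarrow> (\<forall>i j. i < j \<longrightarrow> A i j = 0)"

definition upper_triangular :: "arr \<Rightarrow> bool" where
  "upper_triangular A \<longleftrightarrow> (\<forall>i j. j < i \<longrightarrow> A i j = 0)"

definition unit_diagonal :: "arr \<Rightarrow> bool" where
  "unit_diagonal A \<longleftrightarrow> (\<forall>i. A i i = 1)"

type_synonym monom = "(nat \<times> nat) \<Rightarrow>\<^sub>0 nat"
type_synonym mpoly = "monom \<Rightarrow>\<^sub>0 complex"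

definition poly_eval :: "mpoly \<Rightarrow> cfun" where
  "poly_eval p = (\<lambda>Z. \<Sum>a\<in>Poly_Mapping.keys p. Poly_Mapping.lookup p a *
     (\<Prod>v\<in>Poly_Mapping.keys a. Z (fst v) (snd v) ^ Poly_Mapping.lookup a v))"

definition poly_funs :: "nat \<Rightarrow> nat \<Rightarrow> cfun set" where
  "poly_funs n k =
     {poly_eval p |p. \<forall>a\<in>Poly_Mapping.keys p. Poly_Mapping.keys a \<subseteq> {..<n} \<times> {..<k}}"

definition poly_of :: "cfun \<Rightarrow> mpoly" where
  "poly_of f = (THE p. poly_eval p = f)"

definition partial :: "nat \<times> nat \<Rightarrow> cfun \<Rightarrow> cfun" where
  "partial v h = (\<lambda>Z. deriv (\<lambda>t. h (Z(fst v := (Z (fst v))(snd v := t)))) (Z (fst v) (snd v)))"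

text \<open>
  The order in which the partial derivatives are applied does not matter, since they are applied to
  polynomial functions.
\<close>

definition monom_diff :: "monom \<Rightarrow> cfun \<Rightarrow> cfun" where
  "monom_diff a h = foldr (\<lambda>v. partial v ^^ Poly_Mapping.lookup a v)
     (SOME vs. distinct vs \<and> set vs = Poly_Mapping.keys a) h"

definition poly_diff :: "mpoly \<Rightarrow> cfun \<Rightarrow> cfun" where
  "poly_diff p h =
     (\<lambda>Z. \<Sum>a\<in>Poly_Mapping.keys p. Poly_Mapping.lookup p a * monom_diff a h Z)"

text \<open>\<open>\<langle>f1, f2\<rangle> = f1(D) (cnj (f2 (cnj Z)))\<close> evaluated at \<open>Z = 0\<close>; linear in the first argument.\<close>

definition inner_poly :: "cfun \<Rightarrow> cfun \<Rightarrow> complex" where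
  "inner_poly f1 f2 =
     poly_diff (poly_of f1) (\<lambda>Z. cnj (f2 (\<lambda>i j. cnj (Z i j)))) (\<lambda>i j. 0)"

definition dist_poly :: "cfun \<Rightarrow> cfun \<Rightarrow> real" where
  "dist_poly f g = sqrt (Re (inner_poly (\<lambda>Z. f Z - g Z) (\<lambda>Z. f Z - g Z)))"

definition subspace_poly :: "cfun set \<Rightarrow> bool" where
  "subspace_poly V \<longleftrightarrow> (\<lambda>Z. 0) \<in> V \<and>
     (\<forall>f\<in>V. \<forall>g\<in>V. (\<lambda>Z. f Z + g Z) \<in> V) \<and> (\<forall>c. \<forall>f\<in>V. (\<lambda>Z. c * f Z) \<in> V)"

text \<open>
  The completion of a space \<open>U\<close> of polynomial functions: equivalence classes of Cauchy sequences in
  \<open>U\<close> modulo null sequences.  The operations are computed on representatives.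
\<close>

definition cauchy_in :: "cfun set \<Rightarrow> (nat \<Rightarrow> cfun) \<Rightarrow> bool" where
  "cauchy_in U X \<longleftrightarrow> (\<forall>i. X i \<in> U) \<and>
     (\<forall>e>0. \<exists>N. \<forall>i\<ge>N. \<forall>j\<ge>N. dist_poly (X i) (X j) < e)"

definition cauchy_rel :: "cfun set \<Rightarrow> ((nat \<Rightarrow> cfun) \<times> (nat \<Rightarrow> cfun)) set" where
  "cauchy_rel U = {(X, Y). cauchy_in U X \<and> cauchy_in U Y \<and>
     (\<lambda>i. dist_poly (X i) (Y i)) \<longlonglongrightarrow> 0}"

type_synonym cpoint = "(nat \<Rightarrow> cfun) set"

definition completion :: "cfun set \<Rightarrow> cpoint set" where
  "completion U = {X. cauchy_in U X} // cauchy_rel U"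

definition cls :: "cfun set \<Rightarrow> (nat \<Rightarrow> cfun) \<Rightarrow> cpoint" where
  "cls U X = cauchy_rel U `` {X}"

definition repr :: "cpoint \<Rightarrow> nat \<Rightarrow> cfun" where
  "repr x = (SOME X. X \<in> x)"

definition embed :: "cfun set \<Rightarrow> cfun \<Rightarrow> cpoint" where
  "embed U f = cls U (\<lambda>i. f)"

definition czero :: "cfun set \<Rightarrow> cpoint" where
  "czero U = embed U (\<lambda>Z. 0)"

definition cadd :: "cfun set \<Rightarrow> cpoint \<Rightarrow> cpoint \<Rightarrow> cpoint" where
  "cadd U x y = cls U (\<lambda>i Z. repr x i Z + repr y i Z)"

definition cscale :: "cfun set \<Rightarrow> complex \<Rightarrow> cpoint \<Rightarrow> cpoint" where
  "cscale U c x = cls U (\<lambda>i Z. c * repr x i Z)"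

definition cinner :: "cpoint \<Rightarrow> cpoint \<Rightarrow> complex" where
  "cinner x y = lim (\<lambda>i. inner_poly (repr x i) (repr y i))"

definition cnorm :: "cpoint \<Rightarrow> real" where
  "cnorm x = sqrt (Re (cinner x x))"

definition cdist :: "cfun set \<Rightarrow> cpoint \<Rightarrow> cpoint \<Rightarrow> real" where
  "cdist U x y = cnorm (cadd U x (cscale U (-1) y))"

definition closed_subspace :: "cfun set \<Rightarrow> cpoint set \<Rightarrow> bool" where
  "closed_subspace U W \<longleftrightarrow> W \<subseteq> completion U \<and> czero U \<in> W \<and>
     (\<forall>x\<in>W. \<forall>y\<in>W. cadd U x y \<in> W) \<and> (\<forall>c. \<forall>x\<in>W. cscale U c x \<in> W) \<and>
     (\<forall>s x. (\<forall>i. s i \<in> W) \<and> x \<in> completion U \<and> (\<lambda>i. cdist U (s i) x) \<longlonglongrightarrow> 0 \<longrightarrow> x \<in> W)"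

definition bounded_operator :: "cfun set \<Rightarrow> (cpoint \<Rightarrow> cpoint) \<Rightarrow> bool" where
  "bounded_operator U T \<longleftrightarrow> (\<forall>x\<in>completion U. T x \<in> completion U) \<and>
     (\<forall>x\<in>completion U. \<forall>y\<in>completion U. T (cadd U x y) = cadd U (T x) (T y)) \<and>
     (\<forall>c. \<forall>x\<in>completion U. T (cscale U c x) = cscale U c (T x)) \<and>
     (\<exists>C. \<forall>x\<in>completion U. cnorm (T x) \<le> C * cnorm x)"

text \<open>
  A sequence of representations is given by a family \<open>V\<close> of spaces of polynomial functions, indexed
  by \<open>k \<ge> l\<close>, and one action \<open>R\<close> by operators on functions; the representation of \<open>G k\<close> on \<open>V k\<close> is
  the restriction of \<open>R\<close>.  Since \<open>V k \<subseteq> V (Suc k)\<close> as sets of functions, with the same inner product,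
  and \<open>G k \<subseteq> G (Suc k)\<close>, these inclusions are isometric and \<open>G k\<close>-equivariant.
\<close>

definition inductive_system ::
    "(nat \<Rightarrow> arr set) \<Rightarrow> nat \<Rightarrow> (nat \<Rightarrow> cfun set) \<Rightarrow> (arr \<Rightarrow> cfun \<Rightarrow> cfun) \<Rightarrow> bool" where
  "inductive_system G l V R \<longleftrightarrow> (\<forall>k\<ge>l.
     subspace_poly (V k) \<and> V k \<subseteq> poly_funs l k \<and> V k \<subseteq> V (Suc k) \<and>
     (\<forall>g\<in>G k. \<forall>f\<in>V k. R g f \<in> V k) \<and>
     (\<forall>g\<in>G k. \<forall>f\<in>V k. \<forall>h\<in>V k. R g (\<lambda>Z. f Z + h Z) = (\<lambda>Z. R g f Z + R g h Z)) \<and>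
     (\<forall>g\<in>G k. \<forall>f\<in>V k. \<forall>c. R g (\<lambda>Z. c * f Z) = (\<lambda>Z. c * R g f Z)) \<and>
     (\<forall>f\<in>V k. R arr_one f = f) \<and>
     (\<forall>g\<in>G k. \<forall>h\<in>G k. \<forall>f\<in>V k. R (g \<bullet>\<bullet> h) f = R g (R h f)))"

definition union_space :: "nat \<Rightarrow> (nat \<Rightarrow> cfun set) \<Rightarrow> cfun set" where
  "union_space l V = (\<Union>k\<in>{l..}. V k)"

definition limit_space :: "nat \<Rightarrow> (nat \<Rightarrow> cfun set) \<Rightarrow> cpoint set" where
  "limit_space l V = completion (union_space l V)"

definition limit_action ::
    "nat \<Rightarrow> (nat \<Rightarrow> cfun set) \<Rightarrow> (arr \<Rightarrow> cfun \<Rightarrow> cfun) \<Rightarrow> arr \<Rightarrow> cpoint \<Rightarrow> cpoint" where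
  "limit_action l V R g x = cls (union_space l V) (\<lambda>i. R g (repr x i))"

definition is_limit_representation ::
    "(nat \<Rightarrow> arr set) \<Rightarrow> nat \<Rightarrow> (nat \<Rightarrow> cfun set) \<Rightarrow> (arr \<Rightarrow> cfun \<Rightarrow> cfun) \<Rightarrow> bool" where
  "is_limit_representation G l V R \<longleftrightarrow>
     (\<forall>g\<in>limit_group G. bounded_operator (union_space l V) (limit_action l V R g)) \<and>
     (\<forall>x\<in>limit_space l V. limit_action l V R arr_one x = x) \<and>
     (\<forall>g\<in>limit_group G. \<forall>h\<in>limit_group G. \<forall>x\<in>limit_space l V.
        limit_action l V R (g \<bullet>\<bullet> h) x = limit_action l V R g (limit_action l V R h x)) \<and>
     (\<forall>k\<ge>l. \<forall>g\<in>G k. \<forall>f\<in>V k.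
        limit_action l V R g (embed (union_space l V) f) = embed (union_space l V) (R g f))"

definition closed_invariant_subspace ::
    "(nat \<Rightarrow> arr set) \<Rightarrow> nat \<Rightarrow> (nat \<Rightarrow> cfun set) \<Rightarrow> (arr \<Rightarrow> cfun \<Rightarrow> cfun) \<Rightarrow> cpoint set \<Rightarrow> bool" where
  "closed_invariant_subspace G l V R W \<longleftrightarrow> closed_subspace (union_space l V) W \<and>
     (\<forall>g\<in>limit_group G. \<forall>x\<in>W. limit_action l V R g x \<in> W)"

definition limit_irreducible ::
    "(nat \<Rightarrow> arr set) \<Rightarrow> nat \<Rightarrow> (nat \<Rightarrow> cfun set) \<Rightarrow> (arr \<Rightarrow> cfun \<Rightarrow> cfun) \<Rightarrow> bool" where
  "limit_irreducible G l V R \<longleftrightarrow>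
     (\<forall>W. closed_invariant_subspace G l V R W \<longrightarrow>
        W = {czero (union_space l V)} \<or> W = limit_space l V)"

text \<open>
  The lowest weight signature \<open>(s 0, \<dots>, s (l-1), 0, 0, \<dots>)\<close>.  The action \<open>R\<close> is assumed to be given on
  all of \<open>GL(k)\<close>; for the unitary groups this has to be the holomorphic extension of the action,
  which for the actions \<open>f \<mapsto> f(Z g)\<close> and \<open>f \<mapsto> f(Z (g\<inverse>)\<^sup>T)\<close> is given by the same formula.
\<close>

definition has_lowest_signature ::
    "(nat \<Rightarrow> arr set) \<Rightarrow> nat \<Rightarrow> (nat \<Rightarrow> cfun set) \<Rightarrow> (arr \<Rightarrow> cfun \<Rightarrow> cfun) \<Rightarrow> (nat \<Rightarrow> int) \<Rightarrow> bool" where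
  "has_lowest_signature G l V R s \<longleftrightarrow>
     (\<exists>f\<in>union_space l V. f \<noteq> (\<lambda>Z. 0) \<and>
        (\<forall>W. closed_invariant_subspace G l V R W \<and> embed (union_space l V) f \<in> W
           \<longrightarrow> W = limit_space l V) \<and>
        (\<exists>K. \<forall>k\<ge>K.
           (\<forall>d\<in>G k. diagonal d \<longrightarrow> R d f = (\<lambda>Z. (\<Prod>j<l. d j j powi s j) * f Z)) \<and>
           (\<forall>u\<in>GL k. lower_triangular u \<and> unit_diagonal u \<longrightarrow> R u f = f)))"

definition R_act :: "arr \<Rightarrow> cfun \<Rightarrow> cfun" where
  "R_act g f = (\<lambda>Z. f (Z \<bullet>\<bullet> g))"

definition R_check :: "arr \<Rightarrow> cfun \<Rightarrow> cfun" where
  "R_check g f = (\<lambda>w. f (w \<bullet>\<bullet> check g))"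

definition V_space :: "nat \<Rightarrow> (nat \<Rightarrow> nat) \<Rightarrow> nat \<Rightarrow> cfun set" where
  "V_space l m k = {f \<in> poly_funs l k. \<forall>b\<in>GL l. lower_triangular b \<longrightarrow>
     (\<forall>Z. f (b \<bullet>\<bullet> Z) = (\<Prod>i<l. b i i ^ m i) * f Z)}"

text \<open>
  \<open>f\<close> is a highest weight vector of \<open>V_space l m k\<close>, the same function for all \<open>k \<ge> l\<close>; it is determined
  up to a nonzero scalar.
\<close>

definition is_f_max :: "nat \<Rightarrow> (nat \<Rightarrow> nat) \<Rightarrow> cfun \<Rightarrow> bool" where
  "is_f_max l m f \<longleftrightarrow> f \<noteq> (\<lambda>Z. 0) \<and> (\<forall>k\<ge>l. f \<in> V_space l m k \<and>
     (\<forall>d\<in>GL k. diagonal d \<longrightarrow> R_act d f = (\<lambda>Z. (\<Prod>j<l. d j j ^ m j) * f Z)) \<and>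
     (\<forall>u\<in>GL k. upper_triangular u \<and> unit_diagonal u \<longrightarrow> R_act u f = f))"

text \<open>
  The function \<open>f_min\<^sup>\<or>(w)\<close> is \<open>f_max(w)\<close>, so the contragredient is the linear span of the orbit of
  \<open>f = f_max\<close> under \<open>R_check\<close>.
\<close>

definition V_check :: "(nat \<Rightarrow> arr set) \<Rightarrow> cfun \<Rightarrow> nat \<Rightarrow> cfun set" where
  "V_check G f k = {(\<lambda>w. \<Sum>g\<in>A. c g * R_check g f w) |A c. finite A \<and> A \<subseteq> G k}"

end

(*
  The union of the spaces V_k consists of homogeneous polynomials of one degree, so every g acts by a
  bounded operator, and g and its adjoint act by adjoint operators.  Let f = f_max.  Its column
  degrees are (m_1, ..., m_l, 0, 0, ...), and a polynomial with these column degrees and the left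
  equivariance that defines the representation is a multiple of f: by Gaussian elimination it is
  determined by its value at the identity matrix.

  Let W be a closed invariant subspace with a nonzero vector x.  As f is cyclic, x is not orthogonal
  to some g f; hence y = g^* x in W is not orthogonal to f.  Averaging y over finite subgroups of the
  diagonal torus in the first n columns gives vectors of W which converge, as n grows, to the
  component <y, f> / <f, f> f of y.  Hence f is in W, and W is everything.
*)

theory Submission
  imports Defs
begin

section \<open>Coefficients of polynomial functions\<close>

text \<open>The obstacle is the completion. A point of it is a Cauchy sequence whose terms may
  involve more and more columns, while a term with k columns is known to be projected to a multiple
  of f only once k columns have been averaged. Two uniform estimates overcome this. The projections
  are contractions, so one late term of the sequence controls the projections of all later ones. And
  the action of g is bounded by a constant depending only on the entries of the transposed inverse
  and on the degree, not on the number of columns; so g extends to the completion even in the full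
  linear groups, where it is not unitary.

  Adjointness and boundedness both follow by induction on the degree: the polarised Euler identity
  expresses the inner product of two functions through those of their partial derivatives, and the
  chain rule moves the matrix out as coefficients. The degree also bounds every column degree, so
  finitely many roots of unity separate the weights of a column. Highest weight turns into lowest
  weight because the transposed inverse inverts diagonal matrices and exchanges the two unipotent
  triangular groups.\<close>

abbreviation lookup where "lookup \<equiv> Poly_Mapping.lookup"
abbreviation keys where "keys \<equiv> Poly_Mapping.keys"
abbreviation single where "single \<equiv> Poly_Mapping.single"

definition mon :: "monom \<Rightarrow> cfun" where
  "mon a Z = (\<Prod>v\<in>keys a. Z (fst v) (snd v) ^ lookup a v)"

lemma mon_superset:
  assumes "finite S" "keys a \<subseteq> S"
  shows "mon a Z = (\<Prod>v\<in>S. Z (fst v) (snd v) ^ lookup a v)"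
  unfolding mon_def using assms by (intro prod.mono_neutral_left) (auto simp: in_keys_iff)

lemma mon_0 [simp]: "mon 0 Z = 1"
  by (simp add: mon_def)

lemma mon_add: "mon (a + b) Z = mon a Z * mon b Z"
proof -
  let ?S = "keys a \<union> keys b"
  have "keys (a + b) \<subseteq> ?S" by (rule Poly_Mapping.keys_add)
  then show ?thesis
    by (simp add: mon_superset[of ?S] lookup_add power_add prod.distrib)
qed

lemma mon_single [simp]: "mon (single v n) Z = Z (fst v) (snd v) ^ n"
  by (cases "n = 0") (auto simp: mon_def)

lemma mon_at_0: "mon a (\<lambda>i j. 0) = (if a = 0 then 1 else 0)"
proof (cases "a = 0")
  case False
  then obtain v where v: "v \<in> keys a" by (metis keys_eq_empty ex_in_conv)
  have "(\<Prod>v\<in>keys a. (0::complex) ^ lookup a v) = 0"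
    using v by (subst prod_zero_iff) (auto simp del: split_paired_Ex intro!: bexI[of _ v] simp: in_keys_iff)
  then show ?thesis using False by (simp add: mon_def)
qed simp

lemma poly_eval_eq_mon: "poly_eval p = (\<lambda>Z. \<Sum>a\<in>keys p. lookup p a * mon a Z)"
  by (simp add: poly_eval_def mon_def)

lemma poly_eval_superset:
  assumes "finite S" "keys p \<subseteq> S"
  shows "poly_eval p = (\<lambda>Z. \<Sum>a\<in>S. lookup p a * mon a Z)"
  unfolding poly_eval_eq_mon using assms
  by (intro ext sum.mono_neutral_left) (auto simp: in_keys_iff)

section \<open>Partial derivatives of sums of monomials\<close>

definition upd :: "arr \<Rightarrow> nat \<times> nat \<Rightarrow> complex \<Rightarrow> arr" where
  "upd Z v t = Z(fst v := (Z (fst v))(snd v := t))"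

lemma upd_apply: "upd Z v t i j = (if (i, j) = v then t else Z i j)"
  by (cases v) (auto simp: upd_def)

lemma upd_same [simp]: "upd Z v (Z (fst v) (snd v)) = Z"
  by (simp add: upd_def)

lemma partial_def': "partial v h Z = deriv (\<lambda>t. h (upd Z v t)) (Z (fst v) (snd v))"
  by (simp add: partial_def upd_def)

text \<open>Subtraction of exponents is truncated: if \<open>v\<close> does not occur in
  \<open>a\<close>, the monomial on the right is that of \<open>a\<close> itself, and the factor 0
  removes it.\<close>

lemma mon_has_derivative:
  "((\<lambda>t. mon a (upd Z v t)) has_field_derivative
     of_nat (lookup a v) * mon (a - single v 1) Z) (at (Z (fst v) (snd v)))"
proof -
  let ?S = "insert v (keys a)"
  let ?P = "\<Prod>w\<in>keys a - {v}. Z (fst w) (snd w) ^ lookup a w"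
  have fin: "finite ?S" by simp
  have eq: "mon a (upd Z v t) = t ^ lookup a v * ?P" for t
  proof -
    have "mon a (upd Z v t) = (\<Prod>w\<in>?S. upd Z v t (fst w) (snd w) ^ lookup a w)"
      by (rule mon_superset) auto
    also have "\<dots> = t ^ lookup a v * (\<Prod>w\<in>?S - {v}. upd Z v t (fst w) (snd w) ^ lookup a w)"
      by (subst prod.remove[of _ v]) (auto simp: upd_apply)
    also have "(\<Prod>w\<in>?S - {v}. upd Z v t (fst w) (snd w) ^ lookup a w) = ?P"
      by (rule prod.cong) (auto simp: upd_apply)
    finally show ?thesis .
  qed
  have "keys (a - single v 1) \<subseteq> ?S"
    by (auto simp: in_keys_iff lookup_minus)
  then have "mon (a - single v 1) Z
      = (\<Prod>w\<in>?S. Z (fst w) (snd w) ^ lookup (a - single v 1) w)"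
    by (intro mon_superset) auto
  also have "\<dots> = Z (fst v) (snd v) ^ (lookup a v - 1) *
      (\<Prod>w\<in>?S - {v}. Z (fst w) (snd w) ^ lookup (a - single v 1) w)"
    by (subst prod.remove[of _ v]) (auto simp: lookup_minus)
  also have "(\<Prod>w\<in>?S - {v}. Z (fst w) (snd w) ^ lookup (a - single v 1) w) = ?P"
    by (rule prod.cong) (auto simp: lookup_minus lookup_single when_def)
  finally have m: "mon (a - single v 1) Z = Z (fst v) (snd v) ^ (lookup a v - 1) * ?P" .
  show ?thesis unfolding eq m
    by (auto intro!: derivative_eq_intros)
qed

text \<open>The map \<open>\<phi>\<close> need not be injective: differentiation can merge different
  monomials, and keeping the original index set lets derivatives be iterated without
  regrouping.\<close>

lemma mon_sum_has_derivative:
  assumes "finite A"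
  shows "((\<lambda>t. \<Sum>a\<in>A. c a * mon (\<phi> a) (upd Z v t)) has_field_derivative
     (\<Sum>a\<in>A. c a * of_nat (lookup (\<phi> a) v) * mon (\<phi> a - single v 1) Z)) (at (Z (fst v) (snd v)))"
  unfolding mult.assoc by (intro DERIV_sum DERIV_cmult mon_has_derivative)

lemma partial_mon_sum:
  assumes "finite A"
  shows "partial v (\<lambda>Z. \<Sum>a\<in>A. c a * mon (\<phi> a) Z) =
     (\<lambda>Z. \<Sum>a\<in>A. c a * of_nat (lookup (\<phi> a) v) * mon (\<phi> a - single v 1) Z)"
  unfolding partial_def' using assms by (intro ext DERIV_imp_deriv mon_sum_has_derivative)

text \<open>The falling factorial x(x-1)...(x-n+1), the factor produced by n derivatives of a
  power.\<close>

definition falling :: "nat \<Rightarrow> nat \<Rightarrow> complex" where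
  "falling x n = (\<Prod>i<n. of_nat (x - i))"

lemma falling_eq_0: "x < n \<Longrightarrow> falling x n = 0"
  by (auto simp: falling_def prod_zero_iff intro!: bexI[of _ x])

lemma falling_self: "falling n n = fact n"
  unfolding falling_def fact_prod_rev by (simp add: atLeast0LessThan)

lemma partial_funpow_mon_sum:
  assumes "finite A"
  shows "(partial v ^^ n) (\<lambda>Z. \<Sum>a\<in>A. c a * mon (\<phi> a) Z) =
     (\<lambda>Z. \<Sum>a\<in>A. c a * falling (lookup (\<phi> a) v) n * mon (\<phi> a - single v n) Z)"
proof (induction n)
  case (Suc n)
  have "(partial v ^^ Suc n) (\<lambda>Z. \<Sum>a\<in>A. c a * mon (\<phi> a) Z) =
     partial v (\<lambda>Z. \<Sum>a\<in>A. (c a * falling (lookup (\<phi> a) v) n) * mon (\<phi> a - single v n) Z)"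
    using Suc by simp
  also have "\<dots> = (\<lambda>Z. \<Sum>a\<in>A. c a * falling (lookup (\<phi> a) v) (Suc n) * mon (\<phi> a - single v (Suc n)) Z)"
    unfolding partial_mon_sum[OF assms]
    by (simp add: falling_def lookup_minus diff_diff_add mult.assoc single_add[symmetric] lookup_single)
  finally show ?case .
qed (simp add: falling_def)

lemma foldr_partial_mon_sum:
  assumes "finite A" "distinct vs"
  shows "foldr (\<lambda>v. partial v ^^ lookup b v) vs (\<lambda>Z. \<Sum>a\<in>A. c a * mon a Z) =
     (\<lambda>Z. \<Sum>a\<in>A. c a * (\<Prod>v\<in>set vs. falling (lookup a v) (lookup b v)) *
        mon (a - (\<Sum>v\<in>set vs. single v (lookup b v))) Z)"
  using assms(2)
proof (induction vs)
  case (Cons v vs)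
  let ?s = "\<lambda>vs. \<Sum>v\<in>set vs. single v (lookup b v)"
  \<comment> \<open>As the list is distinct, the derivatives already taken have not changed the
    exponent of \<open>v\<close>.\<close>
  have z: "lookup (?s vs) v = 0"
    using Cons.prems by (auto simp: lookup_sum lookup_single when_def intro!: sum.neutral)
  have "foldr (\<lambda>v. partial v ^^ lookup b v) (v # vs) (\<lambda>Z. \<Sum>a\<in>A. c a * mon a Z) =
     (partial v ^^ lookup b v) (\<lambda>Z. \<Sum>a\<in>A. (c a * (\<Prod>v\<in>set vs. falling (lookup a v) (lookup b v))) *
        mon (a - ?s vs) Z)"
    using Cons by simp
  also have "\<dots> = (\<lambda>Z. \<Sum>a\<in>A. c a * (\<Prod>v\<in>set (v # vs). falling (lookup a v) (lookup b v)) *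
        mon (a - ?s (v # vs)) Z)"
    unfolding partial_funpow_mon_sum[OF assms(1)] using Cons.prems
    by (simp add: lookup_minus z diff_diff_add ac_simps)
  finally show ?case .
qed simp

lemma sum_single_lookup: "(\<Sum>v\<in>keys b. single v (lookup b v)) = b"
  by (rule poly_mapping_eqI) (auto simp: lookup_sum lookup_single when_def in_keys_iff sum.delta')

text \<open>The multi-index factorial, which turns out to be the squared norm of the
  monomial.\<close>

definition mfact :: "monom \<Rightarrow> real" where
  "mfact a = (\<Prod>v\<in>keys a. fact (lookup a v))"

lemma mfact_pos: "mfact a > 0"
  by (auto simp: mfact_def intro!: prod_pos)

text \<open>A monomial \<open>a\<close> different from \<open>b\<close> does not survive: either
  some exponent of \<open>a\<close> is smaller than that of \<open>b\<close> and a falling factorial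
  vanishes, or a nonconstant monomial is left and vanishes at 0.\<close>

lemma monom_diff_at_0:
  assumes "finite A"
  shows "monom_diff b (\<lambda>Z. \<Sum>a\<in>A. c a * mon a Z) (\<lambda>i j. 0) =
    (if b \<in> A then c b * of_real (mfact b) else 0)"
proof -
  define vs where "vs = (SOME vs. distinct vs \<and> set vs = keys b)"
  have "\<exists>vs. distinct vs \<and> set vs = keys b"
    using finite_distinct_list[OF finite_keys[of b]] by blast
  then have vs: "distinct vs" "set vs = keys b"
    using someI_ex[of "\<lambda>vs. distinct vs \<and> set vs = keys b"] by (auto simp: vs_def)
  have t: "(\<Prod>v\<in>keys b. falling (lookup a v) (lookup b v)) * mon (a - b) (\<lambda>i j. 0) =
     (if a = b then of_real (mfact b) else 0)" for a
  proof (cases "a = b")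
    case True
    then show ?thesis by (simp add: falling_self mfact_def)
  next
    case False
    show ?thesis
    proof (cases "a - b = 0")
      case True
      from False obtain v where v: "lookup a v \<noteq> lookup b v"
        by (meson poly_mapping_eqI)
      moreover have "lookup a v - lookup b v = 0" using True by (metis lookup_minus lookup_zero)
      ultimately have "lookup a v < lookup b v" by simp
      then have "v \<in> keys b" "falling (lookup a v) (lookup b v) = 0"
        by (auto simp: in_keys_iff falling_eq_0)
      then have "(\<Prod>v\<in>keys b. falling (lookup a v) (lookup b v)) = 0"
        by (auto simp: prod_zero_iff)
      then show ?thesis using False by simp
    qed (simp add: mon_at_0 False)
  qed
  have "monom_diff b (\<lambda>Z. \<Sum>a\<in>A. c a * mon a Z) (\<lambda>i j. 0) =
    (\<Sum>a\<in>A. c a * ((\<Prod>v\<in>keys b. falling (lookup a v) (lookup b v)) * mon (a - b) (\<lambda>i j. 0)))"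
    unfolding monom_diff_def vs_def[symmetric] foldr_partial_mon_sum[OF assms vs(1)]
    by (simp add: vs(2) sum_single_lookup mult.assoc)
  also have "\<dots> = (\<Sum>a\<in>A. if a = b then c a * of_real (mfact b) else 0)"
    unfolding t by (intro sum.cong) auto
  finally show ?thesis using assms by (simp add: sum.delta)
qed

lemma monom_diff_poly_eval:
  "monom_diff b (poly_eval p) (\<lambda>i j. 0) = lookup p b * of_real (mfact b)"
  unfolding poly_eval_eq_mon by (simp add: monom_diff_at_0 in_keys_iff)

text \<open>Derivatives at 0 recover every coefficient. Hence the definite description in
  \<open>poly_of\<close> is meaningful.\<close>

lemma inj_poly_eval: "inj poly_eval"
proof (rule injI, rule poly_mapping_eqI)
  fix p q b
  assume "poly_eval p = poly_eval q"
  then have "lookup p b * of_real (mfact b) = lookup q b * of_real (mfact b)"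
    by (metis monom_diff_poly_eval)
  then show "lookup p b = lookup q b" using mfact_pos[of b] by auto
qed

lemma poly_of_eval [simp]: "poly_of (poly_eval p) = p"
  unfolding poly_of_def using inj_poly_eval by (auto dest: injD)

section \<open>Coefficients and linear operations\<close>

definition polys :: "cfun set" where
  "polys = range poly_eval"

definition pcoeff :: "cfun \<Rightarrow> monom \<Rightarrow> complex" where
  "pcoeff f = lookup (poly_of f)"

definition msupp :: "cfun \<Rightarrow> monom set" where
  "msupp f = {a. pcoeff f a \<noteq> 0}"

lemma finite_msupp [simp]: "finite (msupp f)"
  by (simp add: msupp_def pcoeff_def)

lemma poly_eval_poly_of: "f \<in> polys \<Longrightarrow> poly_eval (poly_of f) = f"
  by (auto simp: polys_def)

lemma polys_expand:
  assumes "f \<in> polys" "finite A" "msupp f \<subseteq> A"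
  shows "f = (\<lambda>Z. \<Sum>a\<in>A. pcoeff f a * mon a Z)"
proof -
  have "keys (poly_of f) = msupp f"
    by (auto simp: msupp_def pcoeff_def in_keys_iff)
  then show ?thesis
    using poly_eval_superset[OF assms(2), of "poly_of f"] assms poly_eval_poly_of[OF assms(1)]
    by (simp add: pcoeff_def)
qed

lemma polys_eqI:
  assumes "f \<in> polys" "h \<in> polys" "\<And>a. pcoeff f a = pcoeff h a"
  shows "f = h"
proof -
  have "poly_of f = poly_of h" using assms(3) by (intro poly_mapping_eqI) (simp add: pcoeff_def)
  then show ?thesis using assms poly_eval_poly_of by metis
qed

text \<open>Expansions are unique, so any expansion over a finite set of monomials shows the
  coefficients. The formulas for sums, multiples and torus translates are obtained by exhibiting
  one.\<close>

lemma mon_sum_polys: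
  assumes "finite A"
  shows "(\<lambda>Z. \<Sum>a\<in>A. c a * mon a Z) \<in> polys"
    and "pcoeff (\<lambda>Z. \<Sum>a\<in>A. c a * mon a Z) b = (if b \<in> A then c b else 0)"
proof -
  define p where "p = (\<Sum>a\<in>A. single a (c a))"
  have l: "lookup p b = (if b \<in> A then c b else 0)" for b
    using assms by (auto simp: p_def lookup_sum lookup_single when_def sum.delta')
  have "keys p \<subseteq> A" by (auto simp: in_keys_iff l split: if_splits)
  then have e: "poly_eval p = (\<lambda>Z. \<Sum>a\<in>A. c a * mon a Z)"
    unfolding poly_eval_superset[OF assms \<open>keys p \<subseteq> A\<close>] by (auto simp: l)
  show "(\<lambda>Z. \<Sum>a\<in>A. c a * mon a Z) \<in> polys" unfolding e[symmetric] polys_def by (rule rangeI)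
  show "pcoeff (\<lambda>Z. \<Sum>a\<in>A. c a * mon a Z) b = (if b \<in> A then c b else 0)"
    unfolding e[symmetric] by (simp add: pcoeff_def l)
qed

lemma mon_polys [simp]: "mon a \<in> polys"
  and pcoeff_mon: "pcoeff (mon a) b = (if b = a then 1 else 0)"
  using mon_sum_polys[of "{a}" "\<lambda>_. 1"] by (simp_all cong: if_cong)

lemma zero_polys [simp]: "(\<lambda>Z. 0) \<in> polys"
  and pcoeff_zero [simp]: "pcoeff (\<lambda>Z. 0) a = 0"
  using mon_sum_polys[of "{}" "\<lambda>_. 1"] by simp_all

lemma polys_add [simp]: "f \<in> polys \<Longrightarrow> h \<in> polys \<Longrightarrow> (\<lambda>Z. f Z + h Z) \<in> polys"
  and pcoeff_add: "f \<in> polys \<Longrightarrow> h \<in> polys \<Longrightarrow> pcoeff (\<lambda>Z. f Z + h Z) a = pcoeff f a + pcoeff h a"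
proof -
  assume f: "f \<in> polys" and h: "h \<in> polys"
  let ?A = "msupp f \<union> msupp h"
  have "(\<lambda>Z. f Z + h Z) = (\<lambda>Z. \<Sum>a\<in>?A. (pcoeff f a + pcoeff h a) * mon a Z)"
    by (subst polys_expand[OF f, of ?A], simp, simp, subst (2) polys_expand[OF h, of ?A], simp, simp)
      (simp add: sum.distrib distrib_right)
  then show "(\<lambda>Z. f Z + h Z) \<in> polys" "pcoeff (\<lambda>Z. f Z + h Z) a = pcoeff f a + pcoeff h a"
    using mon_sum_polys[OF finite_UnI[OF finite_msupp finite_msupp],
        of "\<lambda>a. pcoeff f a + pcoeff h a" f h]
    by (auto simp add: msupp_def)
qed

lemma polys_scale [simp]: "f \<in> polys \<Longrightarrow> (\<lambda>Z. c * f Z) \<in> polys"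
  and pcoeff_scale: "f \<in> polys \<Longrightarrow> pcoeff (\<lambda>Z. c * f Z) a = c * pcoeff f a"
proof -
  assume f: "f \<in> polys"
  let ?A = "msupp f"
  have "(\<lambda>Z. c * f Z) = (\<lambda>Z. \<Sum>a\<in>?A. (c * pcoeff f a) * mon a Z)"
    by (subst polys_expand[OF f, of ?A], simp, simp) (simp add: sum_distrib_left mult.assoc)
  then show "(\<lambda>Z. c * f Z) \<in> polys" "pcoeff (\<lambda>Z. c * f Z) a = c * pcoeff f a"
    using mon_sum_polys[OF finite_msupp, of "\<lambda>a. c * pcoeff f a" f] by (simp_all add: msupp_def)
qed

lemma polys_diff [simp]: "f \<in> polys \<Longrightarrow> h \<in> polys \<Longrightarrow> (\<lambda>Z. f Z - h Z) \<in> polys"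
  using polys_add[of f "\<lambda>Z. -1 * h Z"] polys_scale[of h "-1"] by simp

lemma polys_sum [simp]: "(\<And>i. i \<in> I \<Longrightarrow> f i \<in> polys) \<Longrightarrow> (\<lambda>Z. \<Sum>i\<in>I. f i Z) \<in> polys"
  by (induction I rule: infinite_finite_induct) auto

lemma pcoeff_sum: "(\<And>i. i \<in> I \<Longrightarrow> f i \<in> polys) \<Longrightarrow> pcoeff (\<lambda>Z. \<Sum>i\<in>I. f i Z) a = (\<Sum>i\<in>I. pcoeff (f i) a)"
  by (induction I rule: infinite_finite_induct) (auto simp: pcoeff_add)

section \<open>Polynomial functions in a given set of variables\<close>

definition polys_on :: "(nat \<times> nat) set \<Rightarrow> cfun set" where
  "polys_on S = {f \<in> polys. \<forall>a. pcoeff f a \<noteq> 0 \<longrightarrow> keys a \<subseteq> S}"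

lemma poly_funs_eq: "poly_funs n k = polys_on ({..<n} \<times> {..<k})"
proof (intro equalityI subsetI)
  fix f assume "f \<in> poly_funs n k"
  then show "f \<in> polys_on ({..<n} \<times> {..<k})"
    unfolding poly_funs_def polys_on_def polys_def pcoeff_def by (auto simp: in_keys_iff)
next
  fix f assume f: "f \<in> polys_on ({..<n} \<times> {..<k})"
  then have "f = poly_eval (poly_of f)" by (simp add: polys_on_def poly_eval_poly_of)
  then show "f \<in> poly_funs n k" using f
    unfolding poly_funs_def polys_on_def pcoeff_def
    by (intro CollectI exI[of _ "poly_of f"]) (auto simp: in_keys_iff)
qed

lemma polys_on_polys: "f \<in> polys_on S \<Longrightarrow> f \<in> polys"
  by (simp add: polys_on_def)

lemma polys_on_mono: "S \<subseteq> T \<Longrightarrow> polys_on S \<subseteq> polys_on T"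
  by (auto simp: polys_on_def)

lemma polys_on_mon: "keys a \<subseteq> S \<Longrightarrow> mon a \<in> polys_on S"
  by (auto simp: polys_on_def pcoeff_mon split: if_splits)

lemma polys_on_zero [simp]: "(\<lambda>Z. 0) \<in> polys_on S"
  by (simp add: polys_on_def)

lemma polys_on_add: "f \<in> polys_on S \<Longrightarrow> h \<in> polys_on S \<Longrightarrow> (\<lambda>Z. f Z + h Z) \<in> polys_on S"
proof -
  assume f: "f \<in> polys_on S" and h: "h \<in> polys_on S"
  have "keys a \<subseteq> S" if "pcoeff (\<lambda>Z. f Z + h Z) a \<noteq> 0" for a
  proof -
    have "pcoeff f a \<noteq> 0 \<or> pcoeff h a \<noteq> 0" using that f h by (auto simp: polys_on_def pcoeff_add)
    then show ?thesis using f h unfolding polys_on_def by blast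
  qed
  then show ?thesis using f h by (simp add: polys_on_def)
qed

lemma polys_on_scale: "f \<in> polys_on S \<Longrightarrow> (\<lambda>Z. c * f Z) \<in> polys_on S"
  by (auto simp: polys_on_def pcoeff_scale)

lemma polys_on_sum: "(\<And>i. i \<in> I \<Longrightarrow> f i \<in> polys_on S) \<Longrightarrow> (\<lambda>Z. \<Sum>i\<in>I. f i Z) \<in> polys_on S"
  by (induction I rule: infinite_finite_induct) (auto intro: polys_on_add)

lemma polys_on_expand:
  assumes "f \<in> polys_on S"
  shows "f = (\<lambda>Z. \<Sum>a\<in>msupp f. pcoeff f a * mon a Z)" "\<And>a. a \<in> msupp f \<Longrightarrow> keys a \<subseteq> S"
proof -
  show "f = (\<lambda>Z. \<Sum>a\<in>msupp f. pcoeff f a * mon a Z)"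
    using assms by (intro polys_expand) (auto simp: polys_on_def)
qed (use assms in \<open>auto simp: polys_on_def msupp_def\<close>)

lemma polys_on_mult:
  assumes f: "f \<in> polys_on S" and h: "h \<in> polys_on S" shows "(\<lambda>Z. f Z * h Z) \<in> polys_on S"
proof -
  have "f Z * h Z = (\<Sum>a\<in>msupp f. pcoeff f a * mon a Z) * (\<Sum>b\<in>msupp h. pcoeff h b * mon b Z)" for Z
    using fun_cong[OF polys_on_expand(1)[OF f]] fun_cong[OF polys_on_expand(1)[OF h]] by simp
  then have "(\<lambda>Z. f Z * h Z) = (\<lambda>Z. \<Sum>a\<in>msupp f. \<Sum>b\<in>msupp h. (pcoeff f a * pcoeff h b) * mon (a + b) Z)"
    by (simp add: sum_product mon_add mult_ac)
  also have "\<dots> \<in> polys_on S"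
  proof (intro polys_on_sum polys_on_scale polys_on_mon)
    fix a b assume "a \<in> msupp f" "b \<in> msupp h"
    then show "keys (a + b) \<subseteq> S"
      using polys_on_expand(2)[OF f] polys_on_expand(2)[OF h] Poly_Mapping.keys_add[of a b] by blast
  qed
  finally show ?thesis .
qed

lemma polys_on_const: "(\<lambda>Z. c) \<in> polys_on S"
  using polys_on_scale[OF polys_on_mon[of 0 S], of c] by simp

lemma polys_on_var: "(i, j) \<in> S \<Longrightarrow> (\<lambda>Z. Z i j) \<in> polys_on S"
proof -
  assume "(i, j) \<in> S"
  moreover have "mon (single (i, j) 1) = (\<lambda>Z. Z i j)" by (rule ext) simp
  ultimately show ?thesis using polys_on_mon[of "single (i, j) 1" S] by simp
qed

text \<open>Structural induction on polynomials. It settles substitution, continuity and the chain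
  rule without any computation with exponents.\<close>

lemma polys_on_induct [consumes 1, case_names const var add mult]:
  assumes "f \<in> polys_on S"
    and const: "\<And>c. Q (\<lambda>Z. c)"
    and var: "\<And>i j. (i, j) \<in> S \<Longrightarrow> Q (\<lambda>Z. Z i j)"
    and add: "\<And>f h. f \<in> polys_on S \<Longrightarrow> h \<in> polys_on S \<Longrightarrow> Q f \<Longrightarrow> Q h \<Longrightarrow> Q (\<lambda>Z. f Z + h Z)"
    and mult: "\<And>f h. f \<in> polys_on S \<Longrightarrow> h \<in> polys_on S \<Longrightarrow> Q f \<Longrightarrow> Q h \<Longrightarrow> Q (\<lambda>Z. f Z * h Z)"
  shows "Q f"
proof -
  let ?Q = "\<lambda>f. f \<in> polys_on S \<and> Q f"
  have pow: "?Q f \<Longrightarrow> ?Q (\<lambda>Z. f Z ^ n)" for f n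
    by (induction n) (auto intro: polys_on_const polys_on_mult const mult)
  have prod: "(\<And>i. i \<in> I \<Longrightarrow> ?Q (f i)) \<Longrightarrow> ?Q (\<lambda>Z. \<Prod>i\<in>I. f i Z)"
    for I :: "(nat \<times> nat) set" and f
    by (induction I rule: infinite_finite_induct) (auto intro: polys_on_mult polys_on_const mult const)
  have sum: "(\<And>i. i \<in> I \<Longrightarrow> ?Q (f i)) \<Longrightarrow> ?Q (\<lambda>Z. \<Sum>i\<in>I. f i Z)" for I :: "monom set" and f
    by (induction I rule: infinite_finite_induct) (auto intro: polys_on_add const add)
  have mon: "?Q (mon a)" if "keys a \<subseteq> S" for a
  proof -
    have "?Q (\<lambda>Z. \<Prod>v\<in>keys a. Z (fst v) (snd v) ^ lookup a v)"
      using that by (intro prod pow) (force intro: polys_on_var var simp: subset_iff)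
    then show ?thesis by (simp add: mon_def[abs_def])
  qed
  have "?Q (\<lambda>Z. \<Sum>a\<in>msupp f. pcoeff f a * mon a Z)"
    using mon polys_on_expand(2)[OF assms(1)]
    by (intro sum) (auto intro!: mult const polys_on_const polys_on_mult)
  then show ?thesis using polys_on_expand(1)[OF assms(1)] by simp
qed

lemma partial_polys_on:
  assumes f: "f \<in> polys_on S"
  shows "partial v f \<in> polys_on S"
    and "((\<lambda>t. f (upd Z v t)) has_field_derivative partial v f Z) (at (Z (fst v) (snd v)))"
proof -
  have e: "partial v f = (\<lambda>Z. \<Sum>a\<in>msupp f. pcoeff f a * of_nat (lookup a v) * mon (a - single v 1) Z)"
    by (subst polys_on_expand(1)[OF f], subst partial_mon_sum) simp_all
  have "keys (a - single v 1) \<subseteq> keys a" for a :: monom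
    by (auto simp: in_keys_iff lookup_minus)
  then show "partial v f \<in> polys_on S" unfolding e
    using polys_on_expand(2)[OF f] by (intro polys_on_sum polys_on_scale polys_on_mon) blast
  show "((\<lambda>t. f (upd Z v t)) has_field_derivative partial v f Z) (at (Z (fst v) (snd v)))"
    unfolding e by (subst polys_on_expand(1)[OF f], rule mon_sum_has_derivative) simp
qed

section \<open>The inner product\<close>

definition nrm :: "cfun \<Rightarrow> real" where
  "nrm f = sqrt (Re (inner_poly f f))"

lemma dist_poly_eq: "dist_poly f h = nrm (\<lambda>Z. f Z - h Z)"
  by (simp add: dist_poly_def nrm_def)

text \<open>The two conjugations in the definition cancel on the monomials and remain on the
  coefficients of \<open>h\<close>; each derivative at 0 then picks one coefficient. The free choice
  of \<open>A\<close> provides a common index set for several functions.\<close>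

lemma inner_poly_superset:
  assumes f: "f \<in> polys" and h: "h \<in> polys" and A: "finite A" "msupp f \<subseteq> A"
  shows "inner_poly f h = (\<Sum>a\<in>A. pcoeff f a * cnj (pcoeff h a) * of_real (mfact a))"
proof -
  have m: "cnj (mon a (\<lambda>i j. cnj (Z i j))) = mon a Z" for a Z
    by (simp add: mon_def)
  have h': "(\<lambda>Z. cnj (h (\<lambda>i j. cnj (Z i j)))) = (\<lambda>Z. \<Sum>a\<in>msupp h. cnj (pcoeff h a) * mon a Z)"
    by (rule ext, subst polys_expand[OF h finite_msupp order.refl]) (simp add: m)
  have "keys (poly_of f) = msupp f" by (auto simp: msupp_def pcoeff_def in_keys_iff)
  then have "inner_poly f h = (\<Sum>a\<in>msupp f. pcoeff f a *
      (if a \<in> msupp h then cnj (pcoeff h a) * of_real (mfact a) else 0))"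
    unfolding inner_poly_def poly_diff_def h' by (simp add: monom_diff_at_0 pcoeff_def[of f])
  also have "\<dots> = (\<Sum>a\<in>msupp f. pcoeff f a * cnj (pcoeff h a) * of_real (mfact a))"
    by (intro sum.cong) (auto simp: msupp_def)
  also have "\<dots> = (\<Sum>a\<in>A. pcoeff f a * cnj (pcoeff h a) * of_real (mfact a))"
    using A by (intro sum.mono_neutral_left) (auto simp: msupp_def)
  finally show ?thesis .
qed

lemma inner_poly_add_left:
  assumes "f \<in> polys" "g \<in> polys" "h \<in> polys"
  shows "inner_poly (\<lambda>Z. f Z + g Z) h = inner_poly f h + inner_poly g h"
proof -
  let ?A = "msupp f \<union> msupp g"
  have "msupp (\<lambda>Z. f Z + g Z) \<subseteq> ?A" using assms by (auto simp: msupp_def pcoeff_add)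
  then show ?thesis using assms
    by (simp add: inner_poly_superset[of _ _ ?A] pcoeff_add sum.distrib algebra_simps)
qed

lemma inner_poly_scale_left:
  assumes "f \<in> polys" "h \<in> polys"
  shows "inner_poly (\<lambda>Z. c * f Z) h = c * inner_poly f h"
proof -
  let ?A = "msupp f"
  have "msupp (\<lambda>Z. c * f Z) \<subseteq> ?A" using assms by (auto simp: msupp_def pcoeff_scale)
  then show ?thesis using assms
    by (simp add: inner_poly_superset[of _ _ ?A] pcoeff_scale sum_distrib_left algebra_simps)
qed

lemma inner_poly_commute:
  assumes "f \<in> polys" "h \<in> polys"
  shows "inner_poly h f = cnj (inner_poly f h)"
proof -
  let ?A = "msupp f \<union> msupp h"
  show ?thesis using assms
    by (simp add: inner_poly_superset[of _ _ ?A] algebra_simps)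
qed

lemma inner_poly_scale_right:
  assumes "f \<in> polys" "h \<in> polys"
  shows "inner_poly h (\<lambda>Z. c * f Z) = cnj c * inner_poly h f"
  using assms inner_poly_commute[of _ h] by (simp add: inner_poly_scale_left)

lemma inner_poly_zero [simp]: "inner_poly (\<lambda>Z. 0) h = 0"
  using poly_of_eval[of 0] by (simp add: inner_poly_def poly_diff_def poly_eval_def[of 0, simplified])

lemma inner_poly_diff_left:
  assumes "f \<in> polys" "g \<in> polys" "h \<in> polys"
  shows "inner_poly (\<lambda>Z. f Z - g Z) h = inner_poly f h - inner_poly g h"
  using inner_poly_add_left[of f "\<lambda>Z. -1 * g Z" h] inner_poly_scale_left[of g h "-1"]
    polys_scale[of g "-1"] assms by simp

lemma inner_poly_sum_left:
  assumes "\<And>i. i \<in> I \<Longrightarrow> f i \<in> polys" "h \<in> polys"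
  shows "inner_poly (\<lambda>Z. \<Sum>i\<in>I. f i Z) h = (\<Sum>i\<in>I. inner_poly (f i) h)"
  using assms(1)
  by (induction I rule: infinite_finite_induct) (simp_all add: inner_poly_add_left assms(2))

lemma inner_poly_sum_right:
  assumes "\<And>i. i \<in> I \<Longrightarrow> f i \<in> polys" "h \<in> polys"
  shows "inner_poly h (\<lambda>Z. \<Sum>i\<in>I. f i Z) = (\<Sum>i\<in>I. inner_poly h (f i))"
  using assms by (subst inner_poly_commute)
    (auto simp: inner_poly_sum_left inner_poly_commute[of _ h] intro!: sum.cong)

lemma inner_poly_mon: "inner_poly (mon a) (mon b) = (if a = b then of_real (mfact a) else 0)"
  using inner_poly_superset[of "mon a" "mon b" "{a}"] by (auto simp: msupp_def pcoeff_mon)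

lemma inner_poly_self_nonneg:
  assumes "f \<in> polys"
  shows "inner_poly f f = of_real (\<Sum>a\<in>msupp f. mfact a * (cmod (pcoeff f a))\<^sup>2)"
  using assms by (subst inner_poly_superset[OF assms assms finite_msupp order.refl])
    (simp add: complex_norm_square algebra_simps del: of_real_power)

text \<open>Through this formula the triangle inequality and the Cauchy-Schwarz inequality are
  inherited from \<open>L2_set\<close>.\<close>

lemma nrm_L2:
  assumes f: "f \<in> polys" and A: "finite A" "msupp f \<subseteq> A"
  shows "nrm f = L2_set (\<lambda>a. sqrt (mfact a) * cmod (pcoeff f a)) A"
proof -
  have "inner_poly f f = of_real (\<Sum>a\<in>A. mfact a * (cmod (pcoeff f a))\<^sup>2)"
    using f A by (subst inner_poly_superset[OF f f A])
    (simp add: complex_norm_square algebra_simps del: of_real_power)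
  then show ?thesis
    using mfact_pos by (simp add: nrm_def L2_set_def power_mult_distrib less_imp_le)
qed

lemma nrm_nonneg [simp]: "f \<in> polys \<Longrightarrow> 0 \<le> nrm f"
  by (simp add: nrm_L2[OF _ finite_msupp order.refl])

lemma inner_poly_self: "f \<in> polys \<Longrightarrow> inner_poly f f = of_real ((nrm f)\<^sup>2)"
  using mfact_pos
  by (auto simp: nrm_def inner_poly_self_nonneg sum_nonneg less_imp_le)

lemma nrm_zero [simp]: "nrm (\<lambda>Z. 0) = 0"
  by (simp add: nrm_def)

lemma nrm_eq_0: "f \<in> polys \<Longrightarrow> nrm f = 0 \<Longrightarrow> f = (\<lambda>Z. 0)"
proof (rule polys_eqI)
  fix a assume f: "f \<in> polys" "nrm f = 0"
  then have "\<forall>a\<in>msupp f. sqrt (mfact a) * cmod (pcoeff f a) = 0"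
    by (simp add: nrm_L2[OF _ finite_msupp order.refl] L2_set_eq_0_iff)
  then show "pcoeff f a = pcoeff (\<lambda>Z. 0) a"
    using mfact_pos[of a] by (auto simp: msupp_def)
qed auto

lemma nrm_scale: "f \<in> polys \<Longrightarrow> nrm (\<lambda>Z. c * f Z) = cmod c * nrm f"
proof -
  assume f: "f \<in> polys"
  have s: "msupp (\<lambda>Z. c * f Z) \<subseteq> msupp f" using f by (auto simp: msupp_def pcoeff_scale)
  show ?thesis using f
    by (simp add: nrm_L2[OF _ finite_msupp order.refl, of f] nrm_L2[OF _ finite_msupp s] pcoeff_scale
        norm_mult L2_set_right_distrib mult.left_commute)
qed

lemma nrm_triangle:
  assumes f: "f \<in> polys" and h: "h \<in> polys"
  shows "nrm (\<lambda>Z. f Z + h Z) \<le> nrm f + nrm h"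
proof -
  let ?A = "msupp f \<union> msupp h" and ?n = "\<lambda>f a. sqrt (mfact a) * cmod (pcoeff f a)"
  have s: "msupp (\<lambda>Z. f Z + h Z) \<subseteq> ?A" using f h by (auto simp: msupp_def pcoeff_add)
  have "nrm (\<lambda>Z. f Z + h Z) = L2_set (?n (\<lambda>Z. f Z + h Z)) ?A"
    using f h s by (intro nrm_L2) auto
  also have "\<dots> \<le> L2_set (\<lambda>a. ?n f a + ?n h a) ?A"
    using f h mfact_pos
    by (intro L2_set_mono)
      (auto simp: pcoeff_add distrib_left[symmetric] less_imp_le intro!: mult_left_mono norm_triangle_ineq)
  also have "\<dots> \<le> L2_set (?n f) ?A + L2_set (?n h) ?A" by (rule L2_set_triangle_ineq)
  also have "\<dots> = nrm f + nrm h" using f h by (simp add: nrm_L2[of _ ?A])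
  finally show ?thesis .
qed

lemma nrm_minus_commute:
  assumes "f \<in> polys" "h \<in> polys"
  shows "nrm (\<lambda>Z. f Z - h Z) = nrm (\<lambda>Z. h Z - f Z)"
  using nrm_scale[of "\<lambda>Z. f Z - h Z" "-1"] assms by simp

lemma nrm_triangle_diff:
  assumes "f \<in> polys" "g \<in> polys" "h \<in> polys"
  shows "nrm (\<lambda>Z. f Z - h Z) \<le> nrm (\<lambda>Z. f Z - g Z) + nrm (\<lambda>Z. g Z - h Z)"
  using nrm_triangle[of "\<lambda>Z. f Z - g Z" "\<lambda>Z. g Z - h Z"] assms by simp

lemma abs_nrm_diff_le:
  assumes f: "f \<in> polys" and h: "h \<in> polys"
  shows "\<bar>nrm f - nrm h\<bar> \<le> nrm (\<lambda>Z. f Z - h Z)"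
  using nrm_triangle[of h "\<lambda>Z. f Z - h Z"] nrm_triangle[of f "\<lambda>Z. h Z - f Z"]
    nrm_minus_commute[OF f h] f h by (simp add: abs_le_iff)

lemma nrm_sum_le: "(\<And>i. i \<in> I \<Longrightarrow> f i \<in> polys) \<Longrightarrow> nrm (\<lambda>Z. \<Sum>i\<in>I. f i Z) \<le> (\<Sum>i\<in>I. nrm (f i))"
proof (induction I rule: infinite_finite_induct)
  case (insert i I)
  then show ?case using nrm_triangle[of "f i" "\<lambda>Z. \<Sum>i\<in>I. f i Z"] by fastforce
qed auto

lemma inner_poly_Cauchy_Schwarz:
  assumes f: "f \<in> polys" and h: "h \<in> polys"
  shows "cmod (inner_poly f h) \<le> nrm f * nrm h"
proof -
  let ?A = "msupp f \<union> msupp h" and ?n = "\<lambda>f a. sqrt (mfact a) * cmod (pcoeff f a)"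
  have "cmod (inner_poly f h) \<le> (\<Sum>a\<in>?A. cmod (pcoeff f a * cnj (pcoeff h a) * of_real (mfact a)))"
    using f h by (simp add: inner_poly_superset[of _ _ ?A] norm_sum)
  also have "\<dots> = (\<Sum>a\<in>?A. \<bar>?n f a\<bar> * \<bar>?n h a\<bar>)"
  proof (intro sum.cong refl)
    fix a
    have "sqrt (mfact a) * sqrt (mfact a) = mfact a" using mfact_pos[of a] by simp
    then show "cmod (pcoeff f a * cnj (pcoeff h a) * of_real (mfact a)) = \<bar>?n f a\<bar> * \<bar>?n h a\<bar>"
      using mfact_pos[of a] by (simp add: norm_mult abs_mult)
  qed
  also have "\<dots> \<le> L2_set (?n f) ?A * L2_set (?n h) ?A" by (rule L2_set_mult_ineq)
  also have "\<dots> = nrm f * nrm h" using f h by (simp add: nrm_L2[of _ ?A])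
  finally show ?thesis .
qed

section \<open>Homogeneous polynomial functions\<close>

definition mdeg :: "monom \<Rightarrow> nat" where
  "mdeg a = (\<Sum>v\<in>keys a. lookup a v)"

definition homog :: "nat \<Rightarrow> (nat \<times> nat) set \<Rightarrow> cfun set" where
  "homog d S = {f \<in> polys_on S. \<forall>a. pcoeff f a \<noteq> 0 \<longrightarrow> mdeg a = d}"

lemma mdeg_superset: "finite S \<Longrightarrow> keys a \<subseteq> S \<Longrightarrow> mdeg a = (\<Sum>v\<in>S. lookup a v)"
  unfolding mdeg_def by (intro sum.mono_neutral_left) (auto simp: in_keys_iff)

lemma mdeg_eq_0: "mdeg a = 0 \<Longrightarrow> a = 0"
  by (rule poly_mapping_eqI) (auto simp: mdeg_def in_keys_iff)

lemma homog_polys_on: "f \<in> homog d S \<Longrightarrow> f \<in> polys_on S"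
  and homog_polys: "f \<in> homog d S \<Longrightarrow> f \<in> polys"
  by (auto simp: homog_def polys_on_def)

lemma mon_scale: "mon a (\<lambda>i j. t * Z i j) = t ^ mdeg a * mon a Z"
  by (simp add: mon_def mdeg_def power_mult_distrib prod.distrib power_sum)

lemma homog_scale_arg:
  assumes "f \<in> homog d S" shows "f (\<lambda>i j. t * Z i j) = t ^ d * f Z"
proof -
  have f: "f = (\<lambda>Z. \<Sum>a\<in>msupp f. pcoeff f a * mon a Z)"
    by (intro polys_expand homog_polys[OF assms]) auto
  have "f (\<lambda>i j. t * Z i j) = (\<Sum>a\<in>msupp f. pcoeff f a * mon a (\<lambda>i j. t * Z i j))"
    using fun_cong[OF f] .
  also have "\<dots> = (\<Sum>a\<in>msupp f. t ^ d * (pcoeff f a * mon a Z))"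
    using assms by (intro sum.cong) (auto simp: mon_scale homog_def msupp_def)
  also have "\<dots> = t ^ d * f Z" using fun_cong[OF f, of Z] by (simp add: sum_distrib_left)
  finally show ?thesis .
qed

text \<open>Powers of 2 are distinct, so comparing coefficients after scaling by this single number
  determines the degree of every monomial.\<close>

lemma homogI:
  assumes f: "f \<in> polys_on S" and t: "\<And>Z. f (\<lambda>i j. 2 * Z i j) = 2 ^ d * f Z"
  shows "f \<in> homog d S"
proof -
  have fp: "f \<in> polys" using f by (rule polys_on_polys)
  have e: "f Z = (\<Sum>a\<in>msupp f. pcoeff f a * mon a Z)" for Z
    using fun_cong[OF polys_expand[OF fp finite_msupp order.refl]] .
  have "(\<lambda>Z. 2 ^ d * f Z) = (\<lambda>Z. \<Sum>a\<in>msupp f. (pcoeff f a * 2 ^ mdeg a) * mon a Z)"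
    unfolding t[symmetric] by (subst e) (simp add: mon_scale mult.assoc)
  then have eq: "2 ^ d * pcoeff f a = (if a \<in> msupp f then pcoeff f a * 2 ^ mdeg a else 0)" for a
    using mon_sum_polys(2)[OF finite_msupp[of f], of "\<lambda>a. pcoeff f a * 2 ^ mdeg a" a]
      pcoeff_scale[OF fp, of "2 ^ d" a] by simp
  have "(2::complex) ^ d = 2 ^ mdeg a" if "pcoeff f a \<noteq> 0" for a
    using that eq[of a] by (simp add: msupp_def)
  then have "of_nat (2 ^ d) = (of_nat (2 ^ mdeg a) :: complex)" if "pcoeff f a \<noteq> 0" for a
    using that by simp
  then have "mdeg a = d" if "pcoeff f a \<noteq> 0" for a
    using that unfolding of_nat_eq_iff by (simp add: power_inject_exp)
  then show ?thesis using f by (simp add: homog_def)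
qed

lemma homog_mon: "keys a \<subseteq> S \<Longrightarrow> mdeg a = d \<Longrightarrow> mon a \<in> homog d S"
  by (auto simp: homog_def polys_on_mon pcoeff_mon split: if_splits)

lemma homog_zero: "(\<lambda>Z. 0) \<in> homog d S"
  by (simp add: homog_def)

lemma homog_add: "f \<in> homog d S \<Longrightarrow> h \<in> homog d S \<Longrightarrow> (\<lambda>Z. f Z + h Z) \<in> homog d S"
  by (rule homogI) (auto intro: polys_on_add homog_polys_on simp: homog_scale_arg distrib_left)

lemma homog_scale: "f \<in> homog d S \<Longrightarrow> (\<lambda>Z. c * f Z) \<in> homog d S"
  by (rule homogI) (auto intro: polys_on_scale homog_polys_on simp: homog_scale_arg)

lemma homog_sum: "(\<And>i. i \<in> I \<Longrightarrow> f i \<in> homog d S) \<Longrightarrow> (\<lambda>Z. \<Sum>i\<in>I. f i Z) \<in> homog d S"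
  by (induction I rule: infinite_finite_induct) (auto intro: homog_add homog_zero)

lemma homog_0:
  assumes "f \<in> homog 0 S" shows "f = (\<lambda>Z. pcoeff f 0)"
proof (rule polys_eqI)
  have e: "(\<lambda>Z. pcoeff f 0) = (\<lambda>Z. pcoeff f 0 * mon 0 Z)" by simp
  show "(\<lambda>Z. pcoeff f 0) \<in> polys" using polys_on_const polys_on_polys by blast
  fix a show "pcoeff f a = pcoeff (\<lambda>Z. pcoeff f 0) a"
    unfolding e using assms mdeg_eq_0[of a]
    by (subst pcoeff_scale) (auto simp: pcoeff_mon homog_def mdeg_def)
qed (use homog_polys[OF assms] in auto)

lemma partial_expand:
  assumes "f \<in> polys"
  shows "partial v f = (\<lambda>Z. \<Sum>a\<in>msupp f. (pcoeff f a * of_nat (lookup a v)) * mon (a - single v 1) Z)"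
  by (subst polys_expand[OF assms finite_msupp order.refl], subst partial_mon_sum) simp_all

lemma mdeg_minus_single:
  assumes "lookup a v > 0" shows "Suc (mdeg (a - single v 1)) = mdeg a"
proof -
  have v: "v \<in> keys a" using assms by (simp add: in_keys_iff)
  have "keys (a - single v 1) \<subseteq> keys a" by (auto simp: in_keys_iff lookup_minus)
  then have "mdeg (a - single v 1) = (\<Sum>w\<in>keys a. lookup (a - single v 1) w)"
    by (intro mdeg_superset) auto
  also have "\<dots> = (lookup a v - 1) + (\<Sum>w\<in>keys a - {v}. lookup a w)"
    using v by (subst sum.remove[of _ v])
      (simp_all add: lookup_minus, intro sum.cong refl, metis DiffE insertI1 lookup_single_not_eq diff_zero)
  finally show ?thesis using assms v by (simp add: mdeg_def sum.remove[of "keys a" v])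
qed

lemma mfact_minus_single:
  assumes "lookup a v > 0" shows "mfact a = of_nat (lookup a v) * mfact (a - single v 1)"
proof -
  have v: "v \<in> keys a" using assms by (simp add: in_keys_iff)
  have k: "keys (a - single v 1) \<subseteq> keys a" by (auto simp: in_keys_iff lookup_minus)
  have "mfact (a - single v 1) = (\<Prod>w\<in>keys a. fact (lookup (a - single v 1) w))"
    unfolding mfact_def using k by (intro prod.mono_neutral_left) (auto simp: in_keys_iff)
  also have "\<dots> = fact (lookup a v - 1) * (\<Prod>w\<in>keys a - {v}. fact (lookup a w))"
    using v by (subst prod.remove[of _ v])
      (simp_all add: lookup_minus, intro prod.cong refl, metis DiffE insertI1 lookup_single_not_eq diff_zero)
  finally show ?thesis using assms v
    by (simp add: mfact_def prod.remove[of "keys a" v] fact_reduce)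
qed

lemma partial_homog:
  assumes f: "f \<in> homog (Suc d) S" shows "partial v f \<in> homog d S"
proof -
  have "(\<lambda>Z. (pcoeff f a * of_nat (lookup a v)) * mon (a - single v 1) Z) \<in> homog d S"
    if a: "a \<in> msupp f" for a
  proof (cases "lookup a v > 0")
    case True
    have "keys (a - single v 1) \<subseteq> keys a" by (auto simp: in_keys_iff lookup_minus)
    then show ?thesis using a f mdeg_minus_single[OF True]
      by (intro homog_scale homog_mon) (auto simp: homog_def polys_on_def msupp_def)
  qed (simp add: homog_zero)
  then show ?thesis unfolding partial_expand[OF homog_polys[OF f]] by (rule homog_sum)
qed

lemma inner_poly_expand:
  assumes "finite A" "finite B"
  shows "inner_poly (\<lambda>Z. \<Sum>a\<in>A. c a * mon (\<phi> a) Z) (\<lambda>Z. \<Sum>b\<in>B. e b * mon (\<psi> b) Z) =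
    (\<Sum>a\<in>A. \<Sum>b\<in>B. c a * cnj (e b) * inner_poly (mon (\<phi> a)) (mon (\<psi> b)))"
  by (simp add: inner_poly_sum_left inner_poly_sum_right inner_poly_scale_left inner_poly_scale_right
      sum_distrib_left mult_ac)

text \<open>The polarised Euler identity. For a monomial \<open>a\<close> the derivative by
  \<open>v\<close> contributes \<open>lookup a v\<close> times its squared norm, and these exponents
  add up to the degree. It is the source of all inductions on the degree below.\<close>

lemma inner_poly_partial:
  assumes S: "finite S" and f: "f \<in> homog d S" and h: "h \<in> homog d S"
  shows "of_nat d * inner_poly f h = (\<Sum>v\<in>S. inner_poly (partial v f) (partial v h))"
proof -
  have key: "of_nat (lookup a v) * of_nat (lookup b v) *
      inner_poly (mon (a - single v 1)) (mon (b - single v 1)) =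
      (if a = b then of_nat (lookup a v) * of_real (mfact a) else 0 :: complex)" for a b v
  proof (cases "lookup a v > 0 \<and> lookup b v > 0")
    case True
    \<comment> \<open>Truncated subtraction can be cancelled here because both exponents of
      \<open>v\<close> are positive.\<close>
    have "a = b" if "a - single v 1 = b - single v 1"
    proof (rule poly_mapping_eqI)
      fix w
      have "lookup (a - single v 1) w = lookup (b - single v 1) w" using that by simp
      then show "lookup a w = lookup b w" using True
        by (auto simp: lookup_minus lookup_single when_def split: if_splits)
    qed
    then show ?thesis using True mfact_minus_single[of a v] by (auto simp: inner_poly_mon)
  qed auto
  have "(\<Sum>v\<in>S. inner_poly (partial v f) (partial v h)) =
    (\<Sum>v\<in>S. \<Sum>a\<in>msupp f. \<Sum>b\<in>msupp h. pcoeff f a * cnj (pcoeff h b) *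
       (of_nat (lookup a v) * of_nat (lookup b v) *
      inner_poly (mon (a - single v 1)) (mon (b - single v 1))))"
    unfolding partial_expand[OF homog_polys[OF f]] partial_expand[OF homog_polys[OF h]]
    by (subst inner_poly_expand) (simp_all add: mult_ac)
  also have "\<dots> = (\<Sum>a\<in>msupp f. \<Sum>b\<in>msupp h. \<Sum>v\<in>S. pcoeff f a * cnj (pcoeff h b) *
       (if a = b then of_nat (lookup a v) * of_real (mfact a) else 0))"
    unfolding key by (subst sum.swap, intro sum.cong refl, rule sum.swap)
  also have "\<dots> = (\<Sum>a\<in>msupp f. \<Sum>b\<in>msupp h. of_nat d * (pcoeff f a * cnj (pcoeff h b) *
       inner_poly (mon a) (mon b)))"
  proof (intro sum.cong refl)
    fix a b assume a: "a \<in> msupp f"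
    have "mdeg a = (\<Sum>v\<in>S. lookup a v)"
      using a f S by (intro mdeg_superset) (auto simp: homog_def polys_on_def msupp_def)
    then have "(\<Sum>v\<in>S. of_nat (lookup a v)) = (of_nat d :: complex)"
      using a f by (auto simp: homog_def msupp_def)
    then show "(\<Sum>v\<in>S. pcoeff f a * cnj (pcoeff h b) *
       (if a = b then of_nat (lookup a v) * of_real (mfact a) else 0)) =
       of_nat d * (pcoeff f a * cnj (pcoeff h b) * inner_poly (mon a) (mon b))"
      by (auto simp: inner_poly_mon sum_distrib_left[symmetric] sum_distrib_right[symmetric])
  qed
  also have "\<dots> = of_nat d * (\<Sum>a\<in>msupp f. \<Sum>b\<in>msupp h. (pcoeff f a * cnj (pcoeff h b) *
       inner_poly (mon a) (mon b)))"
    by (simp add: sum_distrib_left)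
  also have "(\<Sum>a\<in>msupp f. \<Sum>b\<in>msupp h. (pcoeff f a * cnj (pcoeff h b) * inner_poly (mon a) (mon b))) =
     inner_poly f h"
    unfolding inner_poly_expand[OF finite_msupp finite_msupp, symmetric]
    using polys_expand[OF homog_polys[OF f] finite_msupp order.refl]
      polys_expand[OF homog_polys[OF h] finite_msupp order.refl] by simp
  finally show ?thesis by simp
qed

section \<open>Right multiplication\<close>

lemma block_mono: "k \<le> K \<Longrightarrow> block k \<subseteq> block K"
  unfolding block_def by fastforce

lemma mult_block:
  assumes "M \<in> block k"
  shows "(Z \<bullet>\<bullet> M) i j = (if j < k then \<Sum>p<k. Z i p * M p j else Z i j)"
proof (cases "j < k")
  case True
  have "{p. Z i p * M p j \<noteq> 0} \<subseteq> {..<k}"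
    using assms True by (auto simp: block_def arr_one_def not_less[symmetric] split: if_splits)
  then show ?thesis using True unfolding arr_mult_def
    by (subst Sum_any.expand_superset[of "{..<k}"]) auto
next
  case False
  then have "(\<lambda>p. Z i p * M p j) = (\<lambda>p. if p = j then Z i j else 0)"
    using assms by (auto simp: block_def arr_one_def)
  then show ?thesis using False unfolding arr_mult_def
    by (simp only:) (subst Sum_any.expand_superset[of "{j}"], auto)
qed

lemma block_mult:
  assumes "M \<in> block k"
  shows "(M \<bullet>\<bullet> Z) i j = (if i < k then \<Sum>p<k. M i p * Z p j else Z i j)"
proof (cases "i < k")
  case True
  have "{p. M i p * Z p j \<noteq> 0} \<subseteq> {..<k}"
    using assms True by (auto simp: block_def arr_one_def not_less[symmetric] split: if_splits)
  then show ?thesis using True unfolding arr_mult_def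
    by (subst Sum_any.expand_superset[of "{..<k}"]) auto
next
  case False
  then have "(\<lambda>p. M i p * Z p j) = (\<lambda>p. if p = i then Z i j else 0)"
    using assms by (auto simp: block_def arr_one_def)
  then show ?thesis using False unfolding arr_mult_def
    by (simp only:) (subst Sum_any.expand_superset[of "{i}"], auto)
qed

lemma R_act_polys_on:
  assumes M: "M \<in> block K" and f: "f \<in> polys_on (R \<times> {..<K})"
  shows "R_act M f \<in> polys_on (R \<times> {..<K})"
  using f
proof (induction f rule: polys_on_induct)
  case (var i j)
  then show ?case unfolding R_act_def mult_block[OF M]
    by (auto intro!: polys_on_sum polys_on_mult[OF polys_on_var polys_on_const])
qed (auto simp: R_act_def intro: polys_on_const polys_on_add polys_on_mult)

lemma R_act_homog:
  assumes M: "M \<in> block K" and f: "f \<in> homog d (R \<times> {..<K})"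
  shows "R_act M f \<in> homog d (R \<times> {..<K})"
proof (rule homogI)
  show "R_act M f \<in> polys_on (R \<times> {..<K})" by (rule R_act_polys_on[OF M homog_polys_on[OF f]])
  have "(\<lambda>i j. 2 * Z i j) \<bullet>\<bullet> M = (\<lambda>i j. 2 * (Z \<bullet>\<bullet> M) i j)" for Z
    by (auto simp: fun_eq_iff mult_block[OF M] sum_distrib_left mult.assoc)
  then show "R_act M f (\<lambda>i j. 2 * Z i j) = 2 ^ d * R_act M f Z" for Z
    using homog_scale_arg[OF f, of 2] by (simp add: R_act_def)
qed

text \<open>The chain rule for the linear substitution of Z by ZM: the entry in row \<open>i\<close>
  and column \<open>j\<close> enters only row \<open>i\<close> of the product, with the coefficients
  in row \<open>j\<close> of \<open>M\<close>.\<close>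

lemma R_act_has_derivative:
  assumes M: "M \<in> block K" and f: "f \<in> polys_on (R \<times> {..<K})" and j: "j < K"
  shows "((\<lambda>t. f (upd Z (i, j) t \<bullet>\<bullet> M)) has_field_derivative
     (\<Sum>q<K. M j q * partial (i, q) f (Z \<bullet>\<bullet> M))) (at (Z i j))"
  using f
proof (induction f rule: polys_on_induct)
  case (const c)
  have "partial v (\<lambda>Z. c) = (\<lambda>Z. 0)" for v by (simp add: partial_def' fun_eq_iff)
  then show ?case by simp
next
  case (var i' q)
  have p: "partial (i, q') (\<lambda>Z. Z i' q) Z = (if (i, q') = (i', q) then 1 else 0)" for q' Z
    unfolding partial_def' by (auto simp: upd_apply)
  have e: "(upd Z (i, j) t \<bullet>\<bullet> M) i' q = (\<Sum>p<K. (if i = i' \<and> p = j then t else Z i' p) * M p q)" for t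
    using var by (auto simp: mult_block[OF M] upd_apply intro!: sum.cong)
  have "((\<lambda>t. (if i = i' \<and> p = j then t else Z i' p) * M p q) has_field_derivative
     (if i = i' \<and> p = j then M p q else 0)) (at (Z i j))" for p
    by (auto intro!: derivative_eq_intros)
  then have "((\<lambda>t. \<Sum>p<K. (if i = i' \<and> p = j then t else Z i' p) * M p q) has_field_derivative
     (\<Sum>p<K. if i = i' \<and> p = j then M p q else 0)) (at (Z i j))"
    by (intro DERIV_sum)
  moreover have "(\<Sum>p<K. if i = i' \<and> p = j then M p q else 0) =
      (\<Sum>q'<K. M j q' * partial (i, q') (\<lambda>Z. Z i' q) (Z \<bullet>\<bullet> M))"
  proof (cases "i = i'")
    case True
    have "M j q' * partial (i, q') (\<lambda>Z. Z i' q) (Z \<bullet>\<bullet> M) = (if q' = q then M j q else 0)" for q'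
      unfolding p using True by simp
    then show ?thesis using var j True by simp
  next
    case False
    then show ?thesis unfolding p by simp
  qed
  ultimately show ?case unfolding e by simp
next
  case (add f h)
  have "partial v (\<lambda>Z. f Z + h Z) Z = partial v f Z + partial v h Z" for v Z
    unfolding partial_def'[of v "\<lambda>Z. f Z + h Z"]
    by (intro DERIV_imp_deriv DERIV_add partial_polys_on(2)[OF add(1)] partial_polys_on(2)[OF add(2)])
  then show ?case using DERIV_add[OF add(3,4)] by (simp add: sum.distrib distrib_left)
next
  case (mult f h)
  have "partial v (\<lambda>Z. f Z * h Z) Z = partial v f Z * h Z + partial v h Z * f Z" for v Z
    unfolding partial_def'[of v "\<lambda>Z. f Z * h Z"]
    by (rule DERIV_imp_deriv, rule DERIV_cong[OF DERIV_mult[OF partial_polys_on(2)[OF mult(1)]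
        partial_polys_on(2)[OF mult(2)]]]) simp
  then show ?case
    using upd_same[of Z "(i, j)"]
    by (intro DERIV_cong[OF DERIV_mult[OF mult(3,4)]])
      (simp add: sum.distrib distrib_left sum_distrib_right mult.assoc)
qed

lemma partial_R_act:
  assumes M: "M \<in> block K" and f: "f \<in> polys_on (R \<times> {..<K})" and j: "j < K"
  shows "partial (i, j) (R_act M f) = (\<lambda>Z. \<Sum>q<K. M j q * R_act M (partial (i, q) f) Z)"
  unfolding partial_def'[of _ "R_act M f"] unfolding R_act_def
  using R_act_has_derivative[OF M f j] by (intro ext DERIV_imp_deriv) simp

lemma adjoint_block: "M \<in> block k \<Longrightarrow> arr_adjoint M \<in> block k"
  by (auto simp: block_def arr_adjoint_def arr_one_def)

text \<open>Induction on the degree: by the Euler identity it suffices to pair derivatives, and the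
  chain rule turns \<open>M\<close> into coefficients there. Exchanging the two column indices
  transposes these coefficients, and moving them into the conjugate linear argument conjugates
  them.\<close>

lemma inner_poly_R_act:
  assumes M: "M \<in> block K" and R: "finite R"
    and "f \<in> homog d (R \<times> {..<K})" "h \<in> homog d (R \<times> {..<K})"
  shows "inner_poly (R_act M f) h = inner_poly f (R_act (arr_adjoint M) h)"
  using assms(3,4)
proof (induction d arbitrary: f h)
  case 0
  have "R_act N g = g" if g: "g \<in> homog 0 (R \<times> {..<K})" for N g
  proof -
    obtain c where "g = (\<lambda>Z. c)" using homog_0[OF g] by blast
    then show ?thesis by (simp add: R_act_def)
  qed
  then show ?case using 0 by simp
next
  case (Suc d)
  let ?S = "R \<times> {..<K}" and ?N = "arr_adjoint M"
  have N: "?N \<in> block K" using M by (rule adjoint_block)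
  note hp = homog_polys
  note f = Suc.prems(1) and h = Suc.prems(2)
  have S: "finite ?S" using R by simp
  have df: "partial v f \<in> homog d ?S" and dh: "partial v h \<in> homog d ?S" for v
    using f h by (auto intro: partial_homog)
  have Rdf: "R_act M (partial v f) \<in> homog d ?S" and Rdh: "R_act ?N (partial v h) \<in> homog d ?S" for v
    using R_act_homog[OF M df] R_act_homog[OF N dh] .
  have "of_nat (Suc d) * inner_poly (R_act M f) h =
     (\<Sum>(i,j)\<in>?S. inner_poly (partial (i,j) (R_act M f)) (partial (i,j) h))"
    using inner_poly_partial[OF S R_act_homog[OF M f] h] by (simp add: case_prod_unfold)
  also have "\<dots> = (\<Sum>(i,j)\<in>?S. \<Sum>q<K. M j q * inner_poly (R_act M (partial (i, q) f)) (partial (i,j) h))"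
  proof (intro sum.cong refl, clarsimp)
    fix i j assume "j < K"
    show "inner_poly (partial (i, j) (R_act M f)) (partial (i, j) h) =
       (\<Sum>q<K. M j q * inner_poly (R_act M (partial (i, q) f)) (partial (i, j) h))"
      unfolding partial_R_act[OF M homog_polys_on[OF f] \<open>j < K\<close>]
      using hp[OF Rdf] hp[OF dh] by (simp add: inner_poly_sum_left inner_poly_scale_left)
  qed
  also have "\<dots> = (\<Sum>(i,j)\<in>?S. \<Sum>q<K. M j q * inner_poly (partial (i, q) f) (R_act ?N (partial (i,j) h)))"
    using Suc.IH[OF df dh] by simp
  also have "\<dots> = (\<Sum>i\<in>R. \<Sum>q<K. \<Sum>j<K. M j q * inner_poly (partial (i, q) f) (R_act ?N (partial (i,j) h)))"
    unfolding sum.cartesian_product[symmetric] by (intro sum.cong refl sum.swap)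
  also have "\<dots> = (\<Sum>(i,q)\<in>?S. inner_poly (partial (i, q) f) (partial (i, q) (R_act ?N h)))"
    unfolding sum.cartesian_product[symmetric]
  proof (intro sum.cong refl)
    fix i q assume "q \<in> {..<K}"
    then have "q < K" by simp
    show "(\<Sum>j<K. M j q * inner_poly (partial (i, q) f) (R_act ?N (partial (i,j) h))) =
      inner_poly (partial (i, q) f) (partial (i, q) (R_act ?N h))"
      unfolding partial_R_act[OF N homog_polys_on[OF h] \<open>q < K\<close>]
      using hp[OF Rdh] hp[OF df]
      by (simp add: inner_poly_sum_right inner_poly_scale_right arr_adjoint_def)
  qed
  also have "\<dots> = of_nat (Suc d) * inner_poly f (R_act ?N h)"
    using inner_poly_partial[OF S f R_act_homog[OF N h]] by (simp add: case_prod_unfold)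
  finally show ?case by (simp del: of_nat_Suc)
qed

text \<open>The first \<open>k\<close> rows of \<open>M\<close> live in the first \<open>k\<close>
  columns and are estimated by Cauchy-Schwarz, which gives the sum of squares. The other rows are
  those of the identity and account for the summand 1, however large \<open>K\<close> is.\<close>

lemma nrm_mult_le:
  assumes M: "M \<in> block k" and "k \<le> K" and x: "\<And>q. x q \<in> polys"
  shows "(\<Sum>j<K. (nrm (\<lambda>Z. \<Sum>q<K. M j q * x q Z))\<^sup>2)
    \<le> (1 + (\<Sum>j<k. \<Sum>q<k. (cmod (M j q))\<^sup>2)) * (\<Sum>q<K. (nrm (x q))\<^sup>2)"
proof -
  let ?X = "\<Sum>q<K. (nrm (x q))\<^sup>2"
  have small: "(nrm (\<lambda>Z. \<Sum>q<K. M j q * x q Z))\<^sup>2 \<le> (\<Sum>q<k. (cmod (M j q))\<^sup>2) * ?X" if "j < k" for j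
  proof -
    have "(\<lambda>Z. \<Sum>q<K. M j q * x q Z) = (\<lambda>Z. \<Sum>q<k. M j q * x q Z)"
      using \<open>k \<le> K\<close> M that
      by (intro ext sum.mono_neutral_right) (auto simp: block_def arr_one_def)
    moreover have "nrm (\<lambda>Z. \<Sum>q<k. M j q * x q Z) \<le> (\<Sum>q<k. nrm (\<lambda>Z. M j q * x q Z))"
      using x by (intro nrm_sum_le) auto
    ultimately have "nrm (\<lambda>Z. \<Sum>q<K. M j q * x q Z) \<le> (\<Sum>q<k. cmod (M j q) * nrm (x q))"
      using x by (simp add: nrm_scale)
    then have "(nrm (\<lambda>Z. \<Sum>q<K. M j q * x q Z))\<^sup>2 \<le> (\<Sum>q<k. cmod (M j q) * nrm (x q))\<^sup>2"
      using x by (intro power_mono) (auto intro!: nrm_nonneg)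
    also have "\<dots> \<le> (\<Sum>q<k. (cmod (M j q))\<^sup>2) * (\<Sum>q<k. (nrm (x q))\<^sup>2)"
      by (rule Cauchy_Schwarz_ineq_sum)
    also have "\<dots> \<le> (\<Sum>q<k. (cmod (M j q))\<^sup>2) * ?X"
      using \<open>k \<le> K\<close> by (intro mult_left_mono sum_mono2 sum_nonneg) auto
    finally show ?thesis .
  qed
  have large: "(\<lambda>Z. \<Sum>q<K. M j q * x q Z) = x j" if "k \<le> j" "j < K" for j
    using M that by (auto simp: block_def arr_one_def if_distrib[of "\<lambda>y. y * _"] cong: if_cong)
  have "(\<Sum>j<K. (nrm (\<lambda>Z. \<Sum>q<K. M j q * x q Z))\<^sup>2) =
     (\<Sum>j<k. (nrm (\<lambda>Z. \<Sum>q<K. M j q * x q Z))\<^sup>2) + (\<Sum>j=k..<K. (nrm (\<lambda>Z. \<Sum>q<K. M j q * x q Z))\<^sup>2)"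
    unfolding lessThan_atLeast0 by (rule sum.atLeastLessThan_concat[symmetric]) (use \<open>k \<le> K\<close> in auto)
  also have "(\<Sum>j=k..<K. (nrm (\<lambda>Z. \<Sum>q<K. M j q * x q Z))\<^sup>2) = (\<Sum>j=k..<K. (nrm (x j))\<^sup>2)"
    using large by (intro sum.cong) auto
  also have "\<dots> \<le> ?X" by (intro sum_mono2) auto
  also have "(\<Sum>j<k. (nrm (\<lambda>Z. \<Sum>q<K. M j q * x q Z))\<^sup>2) \<le> (\<Sum>j<k. (\<Sum>q<k. (cmod (M j q))\<^sup>2) * ?X)"
    using small by (intro sum_mono) auto
  finally show ?thesis by (simp add: sum_distrib_right[symmetric] distrib_right)
qed

text \<open>
  Since the bound does not depend on \<open>K\<close>, the action is bounded on the union over all numbers of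
  columns.
\<close>

lemma nrm_R_act_le:
  assumes M: "M \<in> block k" and kK: "k \<le> K" and R: "finite R"
    and "f \<in> homog d (R \<times> {..<K})"
  shows "(nrm (R_act M f))\<^sup>2 \<le> (1 + (\<Sum>j<k. \<Sum>q<k. (cmod (M j q))\<^sup>2)) ^ d * (nrm f)\<^sup>2"
  using assms(4)
proof (induction d arbitrary: f)
  case 0
  obtain c where "f = (\<lambda>Z. c)" using homog_0[OF 0] by blast
  then show ?case by (simp add: R_act_def)
next
  case (Suc d)
  let ?S = "R \<times> {..<K}" and ?C = "1 + (\<Sum>j<k. \<Sum>q<k. (cmod (M j q))\<^sup>2)"
  have MK: "M \<in> block K" using M block_mono[OF kK] by blast
  have C: "?C \<ge> 0" by (intro add_nonneg_nonneg sum_nonneg) auto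
  note f = Suc.prems
  have S: "finite ?S" using R by simp
  have nn: "of_nat (Suc d) * (nrm g)\<^sup>2 = (\<Sum>i\<in>R. \<Sum>j<K. (nrm (partial (i,j) g))\<^sup>2)"
    if g: "g \<in> homog (Suc d) ?S" for g
  proof -
    have "complex_of_real (of_nat (Suc d) * (nrm g)\<^sup>2) = of_nat (Suc d) * inner_poly g g"
      using inner_poly_self[OF homog_polys[OF g]] by simp
    also have "\<dots> = of_real (\<Sum>v\<in>?S. (nrm (partial v g))\<^sup>2)"
      unfolding inner_poly_partial[OF S g g] of_real_sum
      by (intro sum.cong refl inner_poly_self homog_polys[OF partial_homog[OF g]])
    finally show ?thesis unfolding of_real_eq_iff by (simp add: sum.cartesian_product case_prod_unfold)
  qed
  have df: "partial v f \<in> homog d ?S" for v using f by (rule partial_homog)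
  have "of_nat (Suc d) * (nrm (R_act M f))\<^sup>2 = (\<Sum>i\<in>R. \<Sum>j<K. (nrm (partial (i,j) (R_act M f)))\<^sup>2)"
    by (rule nn[OF R_act_homog[OF MK f]])
  \<comment> \<open>By linearity the combination may be formed before \<open>M\<close> acts, so the
    induction hypothesis applies to the combination as one function of degree
    \<open>d\<close>.\<close>
  also have "\<dots> = (\<Sum>i\<in>R. \<Sum>j<K. (nrm (R_act M (\<lambda>Z. \<Sum>q<K. M j q * partial (i, q) f Z)))\<^sup>2)"
    by (intro sum.cong refl)
      (simp add: partial_R_act[OF MK homog_polys_on[OF f]], simp add: R_act_def)
  also have "\<dots> \<le> (\<Sum>i\<in>R. \<Sum>j<K. ?C ^ d * (nrm (\<lambda>Z. \<Sum>q<K. M j q * partial (i, q) f Z))\<^sup>2)"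
    by (intro sum_mono Suc.IH homog_sum homog_scale df)
  also have "\<dots> = ?C ^ d * (\<Sum>i\<in>R. \<Sum>j<K. (nrm (\<lambda>Z. \<Sum>q<K. M j q * partial (i, q) f Z))\<^sup>2)"
    by (simp add: sum_distrib_left)
  also have "\<dots> \<le> ?C ^ d * (\<Sum>i\<in>R. ?C * (\<Sum>q<K. (nrm (partial (i, q) f))\<^sup>2))"
    using C by (intro mult_left_mono sum_mono nrm_mult_le M kK homog_polys[OF df]) auto
  also have "\<dots> = ?C ^ Suc d * (of_nat (Suc d) * (nrm f)\<^sup>2)"
    unfolding nn[OF f] by (subst sum_distrib_left[symmetric]) (simp only: power_Suc mult_ac)
  finally have "of_nat (Suc d) * (nrm (R_act M f))\<^sup>2 \<le> of_nat (Suc d) * (?C ^ Suc d * (nrm f)\<^sup>2)"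
    by (simp add: mult_ac)
  then show ?case by (subst (asm) mult_le_cancel_left_pos) (simp_all del: of_nat_Suc)
qed

section \<open>The groups\<close>

lemma tendsto_polys_on:
  assumes "f \<in> polys_on S" "\<And>i j. (i, j) \<in> S \<Longrightarrow> ((\<lambda>t. Z t i j) \<longlongrightarrow> L i j) F"
  shows "((\<lambda>t. f (Z t)) \<longlongrightarrow> f L) F"
  using assms(1) by (induction f rule: polys_on_induct) (auto intro!: tendsto_intros assms(2))

lemma tendsto_if_zero: "(P \<Longrightarrow> c = 0) \<Longrightarrow> ((\<lambda>t. if P then t else c) \<longlongrightarrow> (c::complex)) (at 0)"
  by (cases P) (auto intro: tendsto_ident_at)

lemma polys_on_cong:
  assumes "f \<in> polys_on S" "\<And>i j. (i, j) \<in> S \<Longrightarrow> Z i j = Z' i j"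
  shows "f Z = f Z'"
  using assms(1) by (induction f rule: polys_on_induct) (auto simp: assms(2))

section \<open>Products, inverses and adjoints of block matrices\<close>

lemma arr_one_block [simp]: "arr_one \<in> block k"
  by (simp add: block_def)

lemma mult_arr_one [simp]: "Z \<bullet>\<bullet> arr_one = Z" "arr_one \<bullet>\<bullet> Z = Z"
  using mult_block[OF arr_one_block[of 0], of Z] block_mult[OF arr_one_block[of 0], of Z]
  by (simp_all add: fun_eq_iff)

lemma mult_in_block:
  assumes "M \<in> block k" "N \<in> block k" shows "M \<bullet>\<bullet> N \<in> block k"
  using assms(1) unfolding block_def
  by (auto simp: mult_block[OF assms(2)] block_mult[OF assms(1)] arr_one_def
      if_distrib[of "\<lambda>y. y * _"] cong: if_cong split: if_splits intro!: sum.neutral)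

text \<open>Products of arbitrary infinite arrays need not be associative; with block factors in
  these positions all the sums that occur are finite.\<close>

lemma mult_assoc_block_right:
  assumes M: "M \<in> block k" and N: "N \<in> block k"
  shows "(Z \<bullet>\<bullet> M) \<bullet>\<bullet> N = Z \<bullet>\<bullet> (M \<bullet>\<bullet> N)"
proof (intro ext)
  fix i j
  show "((Z \<bullet>\<bullet> M) \<bullet>\<bullet> N) i j = (Z \<bullet>\<bullet> (M \<bullet>\<bullet> N)) i j"
    unfolding mult_block[OF N, of "Z \<bullet>\<bullet> M"] mult_block[OF mult_in_block[OF M N]]
      mult_block[OF M] mult_block[OF N, of M]
    by (auto simp: sum_distrib_left sum_distrib_right mult.assoc intro: sum.swap)
qed

lemma mult_assoc_block_mid:
  assumes b: "b \<in> block l" and M: "M \<in> block k"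
  shows "(b \<bullet>\<bullet> Z) \<bullet>\<bullet> M = b \<bullet>\<bullet> (Z \<bullet>\<bullet> M)"
proof (intro ext)
  fix i j
  show "((b \<bullet>\<bullet> Z) \<bullet>\<bullet> M) i j = (b \<bullet>\<bullet> (Z \<bullet>\<bullet> M)) i j"
    unfolding mult_block[OF M] block_mult[OF b]
    by (auto simp: sum_distrib_left sum_distrib_right mult.assoc intro: sum.swap)
qed

lemma transpose_mult: "arr_transpose (A \<bullet>\<bullet> B) = arr_transpose B \<bullet>\<bullet> arr_transpose A"
  by (simp add: arr_transpose_def arr_mult_def mult.commute)

lemma transpose_block: "M \<in> block k \<Longrightarrow> arr_transpose M \<in> block k"
  by (auto simp: block_def arr_transpose_def arr_one_def)

lemma transpose_one [simp]: "arr_transpose arr_one = arr_one"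
  and adjoint_one [simp]: "arr_adjoint arr_one = arr_one"
  by (auto simp: arr_transpose_def arr_adjoint_def arr_one_def fun_eq_iff)

lemma adjoint_mult:
  assumes A: "A \<in> block k" and B: "B \<in> block k"
  shows "arr_adjoint (A \<bullet>\<bullet> B) = arr_adjoint B \<bullet>\<bullet> arr_adjoint A"
  unfolding arr_adjoint_def[of "A \<bullet>\<bullet> B"]
  by (auto simp: fun_eq_iff mult_block[OF B] block_mult[OF adjoint_block[OF B]])
    (auto simp: arr_adjoint_def mult.commute)

lemma adjoint_adjoint [simp]: "arr_adjoint (arr_adjoint A) = A"
  by (simp add: arr_adjoint_def)

lemma GL_block: "g \<in> GL k \<Longrightarrow> g \<in> block k"
  by (simp add: GL_def)

lemma GL_mono: "k \<le> K \<Longrightarrow> GL k \<subseteq> GL K"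
  using block_mono[of k K] by (auto simp: GL_def)

lemma unitary_subset_GL: "unitary k \<subseteq> GL k"
  by (auto simp: unitary_def GL_def intro: adjoint_block)

lemma unitary_mono: "k \<le> K \<Longrightarrow> unitary k \<subseteq> unitary K"
  using block_mono[of k K] by (auto simp: unitary_def)

text \<open>The description defining the inverse ranges over matrices of all sizes, so a competing
  inverse is compared with \<open>h\<close> inside a common larger block.\<close>

lemma arr_inverse_eqI:
  assumes g: "g \<in> block k" and h: "h \<in> block k" "g \<bullet>\<bullet> h = arr_one" "h \<bullet>\<bullet> g = arr_one"
  shows "arr_inverse g = h"
  unfolding arr_inverse_def
proof (rule the_equality)
  show "h \<in> limit_group GL \<and> g \<bullet>\<bullet> h = arr_one \<and> h \<bullet>\<bullet> g = arr_one"
    using assms by (auto simp: limit_group_def GL_def)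
next
  fix h' assume h': "h' \<in> limit_group GL \<and> g \<bullet>\<bullet> h' = arr_one \<and> h' \<bullet>\<bullet> g = arr_one"
  then obtain K where "h' \<in> block K" by (auto simp: limit_group_def GL_def)
  then have b: "h' \<in> block (max k K)" "g \<in> block (max k K)" "h \<in> block (max k K)"
    using g h block_mono[of k "max k K"] block_mono[of K "max k K"] by auto
  have "h' = (h \<bullet>\<bullet> g) \<bullet>\<bullet> h'" using h by simp
  also have "\<dots> = h" using mult_assoc_block_right[OF b(2,1)] h' by simp
  finally show "h' = h" .
qed

lemma arr_inverse:
  assumes "g \<in> GL k"
  shows "arr_inverse g \<in> block k" "g \<bullet>\<bullet> arr_inverse g = arr_one" "arr_inverse g \<bullet>\<bullet> g = arr_one"
proof -
  obtain h where h: "h \<in> block k" "g \<bullet>\<bullet> h = arr_one" "h \<bullet>\<bullet> g = arr_one"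
    using assms by (auto simp: GL_def)
  then have "arr_inverse g = h" using assms by (intro arr_inverse_eqI) (auto simp: GL_def)
  then show "arr_inverse g \<in> block k" "g \<bullet>\<bullet> arr_inverse g = arr_one" "arr_inverse g \<bullet>\<bullet> g = arr_one"
    using h by auto
qed

lemma arr_one_GL [simp]: "arr_one \<in> GL k" and arr_one_unitary [simp]: "arr_one \<in> unitary k"
  by (auto simp: GL_def unitary_def)

lemma mult_GL:
  assumes g: "g \<in> GL k" and h: "h \<in> GL k"
  shows "g \<bullet>\<bullet> h \<in> GL k" "arr_inverse (g \<bullet>\<bullet> h) = arr_inverse h \<bullet>\<bullet> arr_inverse g"
proof -
  note g' = GL_block[OF g] arr_inverse[OF g] and h' = GL_block[OF h] arr_inverse[OF h]
  have 1: "(g \<bullet>\<bullet> h) \<bullet>\<bullet> (arr_inverse h \<bullet>\<bullet> arr_inverse g) = arr_one"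
    using mult_assoc_block_right[OF h'(2) g'(2), of "g \<bullet>\<bullet> h"]
      mult_assoc_block_right[OF h'(1,2), of g] g' h' by simp
  have 2: "(arr_inverse h \<bullet>\<bullet> arr_inverse g) \<bullet>\<bullet> (g \<bullet>\<bullet> h) = arr_one"
    using mult_assoc_block_right[OF g'(1) h'(1), of "arr_inverse h \<bullet>\<bullet> arr_inverse g"]
      mult_assoc_block_right[OF g'(2,1), of "arr_inverse h"] g' h' by simp
  have b: "g \<bullet>\<bullet> h \<in> block k" "arr_inverse h \<bullet>\<bullet> arr_inverse g \<in> block k"
    using g' h' by (auto intro: mult_in_block)
  then show "g \<bullet>\<bullet> h \<in> GL k" using 1 2 by (auto simp: GL_def)
  show "arr_inverse (g \<bullet>\<bullet> h) = arr_inverse h \<bullet>\<bullet> arr_inverse g"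
    using arr_inverse_eqI[OF b 1 2] .
qed

lemma mult_unitary:
  assumes g: "g \<in> unitary k" and h: "h \<in> unitary k"
  shows "g \<bullet>\<bullet> h \<in> unitary k"
proof -
  have "arr_inverse g' = arr_adjoint g'" if "g' \<in> unitary k" for g'
    using that by (intro arr_inverse_eqI[of _ k]) (auto simp: unitary_def intro: adjoint_block)
  moreover have gb: "g \<in> block k" "h \<in> block k" using g h by (auto simp: unitary_def)
  moreover have gl: "g \<in> GL k" "h \<in> GL k" using g h unitary_subset_GL by auto
  ultimately have "arr_adjoint (g \<bullet>\<bullet> h) = arr_inverse (g \<bullet>\<bullet> h)"
    using g h mult_GL(2)[OF gl] by (simp add: adjoint_mult)
  then show ?thesis using arr_inverse[OF mult_GL(1)[OF gl]] GL_block[OF mult_GL(1)[OF gl]]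
    by (simp add: unitary_def)
qed

lemma adjoint_GL:
  assumes g: "g \<in> GL k"
  shows "arr_adjoint g \<in> GL k" "arr_inverse (arr_adjoint g) = arr_adjoint (arr_inverse g)"
proof -
  note g' = GL_block[OF g] arr_inverse[OF g]
  have 1: "arr_adjoint g \<bullet>\<bullet> arr_adjoint (arr_inverse g) = arr_one"
    using adjoint_mult[OF g'(2,1)] g' by simp
  have 2: "arr_adjoint (arr_inverse g) \<bullet>\<bullet> arr_adjoint g = arr_one"
    using adjoint_mult[OF g'(1,2)] g' by simp
  have b: "arr_adjoint g \<in> block k" "arr_adjoint (arr_inverse g) \<in> block k"
    using g' by (auto intro: adjoint_block)
  show "arr_adjoint g \<in> GL k" using b 1 2 by (auto simp: GL_def)
  show "arr_inverse (arr_adjoint g) = arr_adjoint (arr_inverse g)"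
    using arr_inverse_eqI[OF b 1 2] .
qed

lemma adjoint_unitary: "g \<in> unitary k \<Longrightarrow> arr_adjoint g \<in> unitary k"
  by (auto simp: unitary_def intro: adjoint_block)

lemma check_GL:
  assumes g: "g \<in> GL k" shows "check g \<in> GL k"
proof -
  note g' = GL_block[OF g] arr_inverse[OF g]
  have "check g \<bullet>\<bullet> arr_transpose g = arr_one" "arr_transpose g \<bullet>\<bullet> check g = arr_one"
    unfolding check_def transpose_mult[symmetric] g' by simp_all
  then show ?thesis using g' unfolding GL_def
    by (auto simp: check_def intro: transpose_block)
qed

lemma check_block: "g \<in> GL k \<Longrightarrow> check g \<in> block k"
  by (intro GL_block check_GL)

lemma check_mult: "g \<in> GL k \<Longrightarrow> h \<in> GL k \<Longrightarrow> check (g \<bullet>\<bullet> h) = check g \<bullet>\<bullet> check h"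
  by (simp add: check_def mult_GL transpose_mult)

lemma check_one [simp]: "check arr_one = arr_one"
  using arr_inverse_eqI[of arr_one 0 arr_one] by (simp add: check_def)

text \<open>The transposed inverse commutes with the adjoint; this makes
  \<open>R_check (arr_adjoint g)\<close> the adjoint operator of \<open>R_check g\<close>.\<close>

lemma adjoint_check_adjoint: "g \<in> GL k \<Longrightarrow> arr_adjoint (check (arr_adjoint g)) = check g"
  by (simp add: check_def adjoint_GL) (simp add: arr_adjoint_def arr_transpose_def)

lemma R_check_eq: "R_check g = R_act (check g)"
  by (simp add: R_check_def R_act_def fun_eq_iff)

lemma R_check_mult:
  assumes "g \<in> GL k" "h \<in> GL k"
  shows "R_check (g \<bullet>\<bullet> h) f = R_check g (R_check h f)"
  using mult_assoc_block_right[OF check_block[OF assms(1)] check_block[OF assms(2)]]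
  by (simp add: R_check_def check_mult[OF assms])

section \<open>Diagonal and unipotent matrices\<close>

lemma diagonal_mult: "diagonal d \<Longrightarrow> (d \<bullet>\<bullet> Z) i j = d i i * Z i j"
proof -
  assume d: "diagonal d"
  have "(\<lambda>p. d i p * Z p j) = (\<lambda>p. if p = i then d i i * Z i j else 0)"
    using d by (auto simp: diagonal_def)
  then show ?thesis unfolding arr_mult_def
    by (simp only:) (subst Sum_any.expand_superset[of "{i}"], auto)
qed

lemma mult_diagonal: "diagonal d \<Longrightarrow> (Z \<bullet>\<bullet> d) i j = Z i j * d j j"
proof -
  assume d: "diagonal d"
  have "(\<lambda>p. Z i p * d p j) = (\<lambda>p. if p = j then Z i j * d j j else 0)"
    using d by (auto simp: diagonal_def)
  then show ?thesis unfolding arr_mult_def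
    by (simp only:) (subst Sum_any.expand_superset[of "{j}"], auto)
qed

definition diag :: "(nat \<Rightarrow> complex) \<Rightarrow> arr" where
  "diag z = (\<lambda>i j. if i = j then z i else 0)"

lemma diagonal_diag [simp]: "diagonal (diag z)" and diag_same [simp]: "diag z i i = z i"
  by (auto simp: diagonal_def diag_def)

lemma diag_mult: "(diag z \<bullet>\<bullet> Z) i j = z i * Z i j" "(Z \<bullet>\<bullet> diag z) i j = Z i j * z j"
  by (simp_all add: diagonal_mult mult_diagonal)

lemma diag_GL:
  assumes "\<And>i. z i \<noteq> 0" "\<And>i. k \<le> i \<Longrightarrow> z i = 1"
  shows "diag z \<in> GL k" "check (diag z) = diag (\<lambda>i. inverse (z i))"
proof -
  let ?h = "diag (\<lambda>i. inverse (z i))"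
  have b: "diag z \<in> block k" "?h \<in> block k"
    using assms(2) by (auto simp: block_def diag_def arr_one_def)
  have e: "diag z \<bullet>\<bullet> ?h = arr_one" "?h \<bullet>\<bullet> diag z = arr_one"
    using assms(1) by (auto simp: fun_eq_iff diag_mult) (auto simp: diag_def arr_one_def)
  then show "diag z \<in> GL k" using b by (auto simp: GL_def)
  have "arr_inverse (diag z) = ?h" by (rule arr_inverse_eqI[OF b e])
  then show "check (diag z) = ?h" by (auto simp: check_def arr_transpose_def diag_def fun_eq_iff)
qed

lemma diag_unitary:
  assumes "\<And>i. cmod (z i) = 1" "\<And>i. k \<le> i \<Longrightarrow> z i = 1"
  shows "diag z \<in> unitary k"
proof -
  have c: "z i * cnj (z i) = 1" for i using assms(1)[of i] by (simp add: complex_norm_square[symmetric])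
  have a: "arr_adjoint (diag z) = diag (\<lambda>i. cnj (z i))"
    by (auto simp: arr_adjoint_def diag_def fun_eq_iff)
  have "diag z \<bullet>\<bullet> diag (\<lambda>i. cnj (z i)) = arr_one" "diag (\<lambda>i. cnj (z i)) \<bullet>\<bullet> diag z = arr_one"
    using c by (auto simp: fun_eq_iff diag_mult) (auto simp: diag_def arr_one_def mult.commute)
  moreover have "diag z \<in> block k" using assms(2) by (auto simp: block_def diag_def arr_one_def)
  ultimately show ?thesis by (simp add: unitary_def a)
qed

lemma check_diagonal:
  assumes d: "d \<in> GL k" "diagonal d"
  shows "diagonal (check d)" "check d j j = inverse (d j j)"
proof -
  have e: "d i i * arr_inverse d i j = arr_one i j" for i j
    using diagonal_mult[OF d(2), of "arr_inverse d" i j] arr_inverse(2)[OF d(1)] by simp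
  have nz: "d i i \<noteq> 0" for i using e[of i i] by (auto simp: arr_one_def)
  show "diagonal (check d)" unfolding diagonal_def
  proof (intro allI impI)
    fix i j :: nat assume "i \<noteq> j"
    then show "check d i j = 0" using e[of j i] nz[of j] by (simp add: check_def arr_transpose_def arr_one_def)
  qed
  show "check d j j = inverse (d j j)"
    using e[of j j] nz[of j] by (simp add: check_def arr_transpose_def arr_one_def field_simps)
qed

text \<open>Forward substitution, row by row, shows that the inverse is again lower unipotent; the
  transpose then makes it upper. So invariance of \<open>f\<close> under upper unipotents becomes
  invariance under lower ones for \<open>R_check\<close>.\<close>

lemma check_lower_unipotent:
  assumes u: "u \<in> GL k" "lower_triangular u" "unit_diagonal u"
  shows "upper_triangular (check u)" "unit_diagonal (check u)"
proof -
  let ?h = "arr_inverse u"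
  have h: "?h \<in> block k" "u \<bullet>\<bullet> ?h = arr_one" using arr_inverse[OF u(1)] by auto
  have main: "i \<le> j \<Longrightarrow> ?h i j = arr_one i j" for i j
  proof (induction i arbitrary: j rule: less_induct)
    case (less i)
    show ?case
    proof (cases "i < k")
      case True
      have "u i p * ?h p j = 0" if "p \<noteq> i" for p
      proof (cases "p < i")
        case True
        then show ?thesis using less.IH[of p j] less.prems by (simp add: arr_one_def)
      next
        case False
        then show ?thesis using that u(2) by (simp add: lower_triangular_def)
      qed
      then have "(\<Sum>p<k. u i p * ?h p j) = (\<Sum>p<k. if p = i then u i i * ?h i j else 0)"
        by (intro sum.cong) auto
      then have "(\<Sum>p<k. u i p * ?h p j) = ?h i j"
        using True u(3) by (simp add: unit_diagonal_def)
      then show ?thesis using block_mult[OF GL_block[OF u(1)], of ?h i j] h(2) True by simp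
    next
      case False
      then show ?thesis using h(1) by (simp add: block_def)
    qed
  qed
  show "upper_triangular (check u)" "unit_diagonal (check u)"
    using main by (auto simp: upper_triangular_def unit_diagonal_def check_def arr_transpose_def arr_one_def)
qed

section \<open>Left equivariant functions\<close>

definition left_equivariant :: "nat \<Rightarrow> (nat \<Rightarrow> nat) \<Rightarrow> cfun \<Rightarrow> bool" where
  "left_equivariant l m f \<longleftrightarrow> (\<forall>b\<in>GL l. lower_triangular b \<longrightarrow>
     (\<forall>Z. f (b \<bullet>\<bullet> Z) = (\<Prod>i<l. b i i ^ m i) * f Z))"

lemma left_equivariant_add:
  "left_equivariant l m f \<Longrightarrow> left_equivariant l m h \<Longrightarrow> left_equivariant l m (\<lambda>Z. f Z + h Z)"
  by (simp add: left_equivariant_def distrib_left)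

lemma left_equivariant_scale:
  "left_equivariant l m f \<Longrightarrow> left_equivariant l m (\<lambda>Z. c * f Z)"
  by (simp add: left_equivariant_def)

lemma left_equivariant_sum:
  "(\<And>i. i \<in> I \<Longrightarrow> left_equivariant l m (f i)) \<Longrightarrow> left_equivariant l m (\<lambda>Z. \<Sum>i\<in>I. f i Z)"
  by (simp add: left_equivariant_def sum_distrib_left)

lemma left_equivariant_R_act:
  "left_equivariant l m f \<Longrightarrow> M \<in> block k \<Longrightarrow> left_equivariant l m (R_act M f)"
  by (simp add: left_equivariant_def R_act_def mult_assoc_block_mid[OF GL_block])

text \<open>The scalar matrix 2 is lower triangular, so left equivariance alone fixes the degree,
  whatever the number of columns. Rows from \<open>l\<close> on are left alone to stay in
  \<open>GL l\<close>; \<open>f\<close> does not see them.\<close>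

lemma left_equivariant_homog:
  assumes f: "f \<in> polys_on ({..<l} \<times> J)" "left_equivariant l m f"
  shows "f \<in> homog (\<Sum>i<l. m i) ({..<l} \<times> J)"
proof (rule homogI[OF f(1)])
  fix Z
  let ?b = "diag (\<lambda>i. if i < l then 2 else 1)"
  have "?b \<in> GL l" by (rule diag_GL) auto
  moreover have "lower_triangular ?b" by (auto simp: lower_triangular_def diag_def)
  ultimately have "f (?b \<bullet>\<bullet> Z) = (\<Prod>i<l. ?b i i ^ m i) * f Z"
    using f(2) by (auto simp: left_equivariant_def)
  also have "(\<Prod>i<l. ?b i i ^ m i) = 2 ^ (\<Sum>i<l. m i)" by (simp add: power_sum)
  also have "f (?b \<bullet>\<bullet> Z) = f (\<lambda>i j. 2 * Z i j)"
    by (rule polys_on_cong[OF f(1)]) (auto simp: diag_mult)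
  finally show "f (\<lambda>i j. 2 * Z i j) = 2 ^ (\<Sum>i<l. m i) * f Z" .
qed

text \<open>The Gauss transformation that clears column \<open>r\<close> below its pivot.\<close>

definition elim :: "nat \<Rightarrow> nat \<Rightarrow> (nat \<Rightarrow> complex) \<Rightarrow> arr" where
  "elim l r c = (\<lambda>i j. if i = j then 1 else if j = r \<and> r < i \<and> i < l then c i else 0)"

lemma elim_mult:
  assumes "r < l"
  shows "(elim l r c \<bullet>\<bullet> Z) i j = Z i j + (if r < i \<and> i < l then c i * Z r j else 0)"
proof -
  have b: "elim l r c \<in> block l" using assms by (auto simp: block_def elim_def arr_one_def)
  have "(\<Sum>p<l. elim l r c i p * Z p j) = Z i j + (if r < i \<and> i < l then c i * Z r j else 0)" if "i < l"
  proof -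
    have "elim l r c i p * Z p j = (if p = i then Z i j else 0) +
      (if p = r then (if r < i then c i * Z r j else 0) else 0)" for p
      using that by (auto simp: elim_def)
    then show ?thesis using that assms by (simp add: sum.distrib)
  qed
  then show ?thesis by (simp add: block_mult[OF b])
qed

lemma elim_GL:
  assumes "r < l" shows "elim l r c \<in> GL l"
proof -
  have e: "elim l r c \<bullet>\<bullet> elim l r (\<lambda>i. - c i) = arr_one" for c
    using assms by (auto simp: fun_eq_iff elim_mult) (auto simp: elim_def arr_one_def)
  have b: "elim l r c \<in> block l" for c using assms by (auto simp: block_def elim_def arr_one_def)
  show ?thesis using b e[of c] e[of "\<lambda>i. - c i"] by (auto simp: GL_def intro!: bexI[of _ "elim l r (\<lambda>i. - c i)"])
qed

text \<open>
  On upper triangular matrices conjugation by \<open>diag(1, t, t\<^sup>2, \<dots>)\<close> leaves \<open>h\<close> invariant, and as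
  \<open>t \<rightarrow> 0\<close> it moves \<open>Z\<close> to its diagonal part.
\<close>

lemma left_equivariant_eq_0_upper:
  assumes h: "h \<in> polys_on ({..<l} \<times> {..<l})" "left_equivariant l m h"
    and w: "\<And>d Z. d \<in> GL l \<Longrightarrow> diagonal d \<Longrightarrow> h (Z \<bullet>\<bullet> d) = (\<Prod>j<l. d j j ^ m j) * h Z"
    and one: "h arr_one = 0"
    and Z: "\<And>i j. j < i \<Longrightarrow> i < l \<Longrightarrow> Z i j = 0"
  shows "h Z = 0"
proof -
  have low: "lower_triangular (diag z)" for z by (auto simp: lower_triangular_def diag_def)
  \<comment> \<open>An invertible diagonal matrix is itself a lower triangular matrix acting on the
    identity. Entries from \<open>l\<close> on are set to 1 to stay in \<open>GL l\<close>;
    \<open>h\<close> does not depend on them.\<close>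
  have "h (diag z) = 0" if "\<And>i. i < l \<Longrightarrow> z i \<noteq> 0" for z
  proof -
    let ?z = "\<lambda>i. if i < l then z i else 1"
    have "diag ?z \<in> GL l" using that by (intro diag_GL) auto
    then have "h (diag ?z \<bullet>\<bullet> arr_one) = (\<Prod>i<l. diag ?z i i ^ m i) * h arr_one"
      using h(2) low unfolding left_equivariant_def by blast
    then have "h (diag ?z) = 0" using one by simp
    moreover have "h (diag ?z) = h (diag z)"
      by (rule polys_on_cong[OF h(1)]) (auto simp: diag_def)
    ultimately show ?thesis by simp
  qed
  \<comment> \<open>Vanishing diagonal entries are replaced by a small \<open>t\<close>; letting it
    tend to 0 extends the result to singular diagonal matrices.\<close>
  then have z0: "h (diag (\<lambda>i. if Z i i = 0 then t else Z i i)) = 0" if "t \<noteq> 0" for t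
    using that by simp
  have "((\<lambda>t. h (diag (\<lambda>i. if Z i i = 0 then t else Z i i))) \<longlongrightarrow> h (diag (\<lambda>i. Z i i))) (at 0)"
    by (rule tendsto_polys_on[OF h(1)]) (auto simp: diag_def intro!: tendsto_if_zero)
  moreover have "((\<lambda>t. h (diag (\<lambda>i. if Z i i = 0 then t else Z i i))) \<longlongrightarrow> 0) (at 0)"
    by (rule tendsto_eventually) (auto simp: eventually_at_filter z0)
  ultimately have d0: "h (diag (\<lambda>i. Z i i)) = 0"
    by (rule tendsto_unique[OF at_neq_bot])
  let ?D = "\<lambda>t. diag (\<lambda>i. if i < l then t ^ i else 1)"
  let ?E = "\<lambda>t. diag (\<lambda>i. if i < l then inverse t ^ i else 1)"
  \<comment> \<open>The left and the right action have the same exponents \<open>m\<close>, so the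
    powers of \<open>t\<close> from the two sides cancel.\<close>
  have inv: "h ((?E t \<bullet>\<bullet> Z) \<bullet>\<bullet> ?D t) = h Z" if "t \<noteq> 0" for t
  proof -
    have D: "?D t \<in> GL l" and E: "?E t \<in> GL l" using that by (auto intro!: diag_GL split: if_splits)
    have "h ((?E t \<bullet>\<bullet> Z) \<bullet>\<bullet> ?D t) = (\<Prod>j<l. (t ^ j) ^ m j) * ((\<Prod>j<l. (inverse t ^ j) ^ m j) * h Z)"
      using w[OF D, of "?E t \<bullet>\<bullet> Z"] h(2) E low by (simp add: left_equivariant_def)
    also have "\<dots> = (\<Prod>j<l. (t ^ j) ^ m j * (inverse t ^ j) ^ m j) * h Z"
      by (simp add: prod.distrib)
    also have "(\<Prod>j<l. (t ^ j) ^ m j * (inverse t ^ j) ^ m j) = 1"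
      using that by (intro prod.neutral) (simp add: power_mult_distrib[symmetric])
    finally show ?thesis by simp
  qed
  have "((\<lambda>t. h ((?E t \<bullet>\<bullet> Z) \<bullet>\<bullet> ?D t)) \<longlongrightarrow> h (diag (\<lambda>i. Z i i))) (at 0)"
  proof (rule tendsto_polys_on[OF h(1)])
    fix i j assume "(i, j) \<in> {..<l} \<times> {..<l}"
    then have ij: "i < l" "j < l" by auto
    \<comment> \<open>Conjugation multiplies the entry by the power j - i of \<open>t\<close>. The
      truncated difference is correct on and above the diagonal; below it the entry is 0.\<close>
    have e: "((?E t \<bullet>\<bullet> Z) \<bullet>\<bullet> ?D t) i j = Z i j * t ^ (j - i)" if "t \<noteq> 0" for t
    proof (cases "j < i")
      case False
      then have "t ^ j = t ^ i * t ^ (j - i)" by (simp add: power_add[symmetric])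
      then show ?thesis using ij that
        by (simp add: diag_mult power_inverse)
    qed (use ij Z in \<open>simp add: diag_mult\<close>)
    have "((\<lambda>t. Z i j * t ^ (j - i)) \<longlongrightarrow> Z i j * 0 ^ (j - i)) (at 0)"
      by (intro tendsto_intros)
    moreover have "Z i j * 0 ^ (j - i) = diag (\<lambda>i. Z i i) i j"
      using Z[of j i] ij by (cases i j rule: linorder_cases) (auto simp: diag_def)
    ultimately have "((\<lambda>t. Z i j * t ^ (j - i)) \<longlongrightarrow> diag (\<lambda>i. Z i i) i j) (at 0)" by simp
    then show "((\<lambda>t. ((?E t \<bullet>\<bullet> Z) \<bullet>\<bullet> ?D t) i j) \<longlongrightarrow> diag (\<lambda>i. Z i i) i j) (at 0)"
      by (rule Lim_transform_eventually) (auto simp: eventually_at_filter e)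
  qed
  moreover have "((\<lambda>t. h ((?E t \<bullet>\<bullet> Z) \<bullet>\<bullet> ?D t)) \<longlongrightarrow> h Z) (at 0)"
    by (rule tendsto_eventually) (auto simp: eventually_at_filter inv)
  ultimately have "h (diag (\<lambda>i. Z i i)) = h Z" by (rule tendsto_unique[OF at_neq_bot])
  then show ?thesis using d0 by simp
qed

text \<open>Gaussian elimination by columns; a vanishing pivot is perturbed.\<close>

lemma left_equivariant_eq_0:
  assumes h: "h \<in> polys_on ({..<l} \<times> {..<l})" "left_equivariant l m h"
    and w: "\<And>d Z. d \<in> GL l \<Longrightarrow> diagonal d \<Longrightarrow> h (Z \<bullet>\<bullet> d) = (\<Prod>j<l. d j j ^ m j) * h Z"
    and one: "h arr_one = 0"
  shows "h = (\<lambda>Z. 0)"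
proof -
  \<comment> \<open>The number \<open>r\<close> counts the columns already cleared. The induction
    runs down from \<open>r = l\<close>, where the matrix is upper triangular, to an arbitrary
    matrix at \<open>r = 0\<close>.\<close>
  have Q: "h Z = 0" if "r \<le> l" "\<And>i j. j < r \<Longrightarrow> j < i \<Longrightarrow> i < l \<Longrightarrow> Z i j = 0" for r Z
    using that
  proof (induction r arbitrary: Z rule: inc_induct)
    case base
    show ?case
      using base(1) by (intro left_equivariant_eq_0_upper[OF h w one]) auto
  next
    case (step r)
    have piv: "h Z = 0" if Z: "\<And>i j. j < r \<Longrightarrow> j < i \<Longrightarrow> i < l \<Longrightarrow> Z i j = 0" and p: "Z r r \<noteq> 0" for Z
    proof -
      let ?b = "elim l r (\<lambda>i. - Z i r / Z r r)"
      have "h (?b \<bullet>\<bullet> Z) = (\<Prod>i<l. ?b i i ^ m i) * h Z"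
        using h(2) elim_GL[OF step(2)]
        by (auto simp: left_equivariant_def lower_triangular_def elim_def)
      \<comment> \<open>The Gauss transformation has unit diagonal, so its character is 1.\<close>
      then have "h (?b \<bullet>\<bullet> Z) = h Z" by (simp add: elim_def)
      moreover have "h (?b \<bullet>\<bullet> Z) = 0"
      proof (rule step.IH)
        fix i j assume "j < Suc r" "j < i" "i < l"
        then show "(?b \<bullet>\<bullet> Z) i j = 0" using Z[of j i] Z[of j r] p step(2)
          by (cases "j = r") (auto simp: elim_mult)
      qed
      ultimately show ?thesis by simp
    qed
    show ?case
    proof (cases "Z r r = 0")
      case True
      have "((\<lambda>t. h (upd Z (r, r) t)) \<longlongrightarrow> h Z) (at 0)"
        by (rule tendsto_polys_on[OF h(1)]) (auto simp: upd_apply True intro!: tendsto_if_zero)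
      moreover have "((\<lambda>t. h (upd Z (r, r) t)) \<longlongrightarrow> 0) (at 0)"
      proof (intro tendsto_eventually)
        have "h (upd Z (r, r) t) = 0" if "t \<noteq> 0" for t
          by (rule piv) (use step.prems that in \<open>auto simp: upd_apply\<close>)
        then show "\<forall>\<^sub>F t in at 0. h (upd Z (r, r) t) = 0" by (simp add: eventually_at_filter)
      qed
      ultimately show ?thesis by (rule tendsto_unique[OF at_neq_bot])
    qed (use piv step.prems in auto)
  qed
  show ?thesis using Q[of 0] by (simp add: fun_eq_iff)
qed

section \<open>The completion\<close>

definition null_seq :: "(nat \<Rightarrow> cfun) \<Rightarrow> bool" where
  "null_seq X \<longleftrightarrow> (\<lambda>i. nrm (X i)) \<longlonglongrightarrow> 0"

text \<open>Nothing is assumed on the number of columns, since the space to be completed is a union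
  over all of them.\<close>

locale poly_space =
  fixes U :: "cfun set"
  assumes subspace: "subspace_poly U" and polys: "U \<subseteq> polys"
begin

lemma in_polys [simp]: "f \<in> U \<Longrightarrow> f \<in> polys"
  using polys by auto

lemma zero_U [simp]: "(\<lambda>Z. 0) \<in> U"
  and add_U [simp]: "f \<in> U \<Longrightarrow> h \<in> U \<Longrightarrow> (\<lambda>Z. f Z + h Z) \<in> U"
  and scale_U [simp]: "f \<in> U \<Longrightarrow> (\<lambda>Z. c * f Z) \<in> U"
  using subspace by (auto simp: subspace_poly_def)

lemma diff_U [simp]: "f \<in> U \<Longrightarrow> h \<in> U \<Longrightarrow> (\<lambda>Z. f Z - h Z) \<in> U"
  using add_U[of f "\<lambda>Z. -1 * h Z"] scale_U[of h "-1"] by simp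

lemma sum_U: "(\<And>i. i \<in> I \<Longrightarrow> f i \<in> U) \<Longrightarrow> (\<lambda>Z. \<Sum>i\<in>I. f i Z) \<in> U"
  by (induction I rule: infinite_finite_induct) auto

section \<open>Cauchy sequences and bounded maps\<close>

lemma cauchy_in_iff:
  "cauchy_in U X \<longleftrightarrow> (\<forall>i. X i \<in> U) \<and> (\<forall>e>0. \<exists>N. \<forall>i\<ge>N. \<forall>j\<ge>N. nrm (\<lambda>Z. X i Z - X j Z) < e)"
  by (simp add: cauchy_in_def dist_poly_eq)

lemma cauchy_U: "cauchy_in U X \<Longrightarrow> X i \<in> U"
  by (simp add: cauchy_in_def)

lemma cauchyD: "cauchy_in U X \<Longrightarrow> e > 0 \<Longrightarrow> \<exists>N. \<forall>i\<ge>N. \<forall>j\<ge>N. nrm (\<lambda>Z. X i Z - X j Z) < e"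
  by (simp add: cauchy_in_iff)

lemma cauchy_const [simp]: "f \<in> U \<Longrightarrow> cauchy_in U (\<lambda>i. f)"
  by (simp add: cauchy_in_iff)

lemma cauchy_add:
  assumes X: "cauchy_in U X" and Y: "cauchy_in U Y"
  shows "cauchy_in U (\<lambda>i Z. X i Z + Y i Z)"
  unfolding cauchy_in_iff
proof (intro conjI allI impI)
  fix e :: real assume "e > 0"
  then obtain M N where MN: "\<forall>i\<ge>M. \<forall>j\<ge>M. nrm (\<lambda>Z. X i Z - X j Z) < e / 2"
    "\<forall>i\<ge>N. \<forall>j\<ge>N. nrm (\<lambda>Z. Y i Z - Y j Z) < e / 2"
    using cauchyD[OF X, of "e / 2"] cauchyD[OF Y, of "e / 2"] by auto
  have "nrm (\<lambda>Z. (X i Z + Y i Z) - (X j Z + Y j Z)) < e" if "i \<ge> max M N" "j \<ge> max M N" for i j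
  proof -
    have "nrm (\<lambda>Z. (X i Z - X j Z) + (Y i Z - Y j Z)) \<le> nrm (\<lambda>Z. X i Z - X j Z) + nrm (\<lambda>Z. Y i Z - Y j Z)"
      using cauchy_U[OF X] cauchy_U[OF Y] by (intro nrm_triangle) auto
    also have "\<dots> < e / 2 + e / 2" using MN that by (intro add_strict_mono) auto
    finally show ?thesis by (simp add: algebra_simps)
  qed
  then show "\<exists>N. \<forall>i\<ge>N. \<forall>j\<ge>N. nrm (\<lambda>Z. (X i Z + Y i Z) - (X j Z + Y j Z)) < e" by blast
qed (use cauchy_U[OF X] cauchy_U[OF Y] in auto)

text \<open>The maps are defined on all functions, so linearity and the bound are demanded on
  \<open>U\<close> only. Such a map acts on Cauchy sequences term by term.\<close>

definition bounded_on :: "(cfun \<Rightarrow> cfun) \<Rightarrow> real \<Rightarrow> bool" where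
  "bounded_on T C \<longleftrightarrow> 0 \<le> C \<and> (\<forall>f\<in>U. T f \<in> U \<and> nrm (T f) \<le> C * nrm f) \<and>
     (\<forall>f\<in>U. \<forall>h\<in>U. T (\<lambda>Z. f Z + h Z) = (\<lambda>Z. T f Z + T h Z)) \<and>
     (\<forall>c. \<forall>f\<in>U. T (\<lambda>Z. c * f Z) = (\<lambda>Z. c * T f Z))"

lemma bounded_on_scale: "bounded_on (\<lambda>f Z. c * f Z) (cmod c)"
  by (simp add: bounded_on_def nrm_scale algebra_simps)

context
  fixes T C assumes T: "bounded_on T C"
begin

lemma bounded_onD:
  shows "0 \<le> C" "f \<in> U \<Longrightarrow> T f \<in> U" "f \<in> U \<Longrightarrow> nrm (T f) \<le> C * nrm f"
    "f \<in> U \<Longrightarrow> h \<in> U \<Longrightarrow> T (\<lambda>Z. f Z + h Z) = (\<lambda>Z. T f Z + T h Z)"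
    "f \<in> U \<Longrightarrow> T (\<lambda>Z. c * f Z) = (\<lambda>Z. c * T f Z)"
  using T by (auto simp: bounded_on_def)

lemma bounded_on_diff:
  assumes "f \<in> U" "h \<in> U" shows "T (\<lambda>Z. f Z - h Z) = (\<lambda>Z. T f Z - T h Z)"
  using bounded_onD(4)[OF assms(1) scale_U[OF assms(2), of "-1"]] bounded_onD(5)[OF assms(2), of "-1"]
  by simp

lemma bounded_on_diff_le:
  assumes "f \<in> U" "h \<in> U" shows "nrm (\<lambda>Z. T f Z - T h Z) \<le> C * nrm (\<lambda>Z. f Z - h Z)"
  using bounded_onD(3)[OF diff_U[OF assms]] bounded_on_diff[OF assms] by simp

lemma cauchy_map:
  assumes X: "cauchy_in U X" shows "cauchy_in U (\<lambda>i. T (X i))"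
  unfolding cauchy_in_iff
proof (intro conjI allI impI)
  fix e :: real assume "e > 0"
  \<comment> \<open>The bound \<open>C\<close> may be 0, hence the denominator
    \<open>C + 1\<close>.\<close>
  then have "e / (C + 1) > 0" using bounded_onD(1) by simp
  then obtain N where N: "\<forall>i\<ge>N. \<forall>j\<ge>N. nrm (\<lambda>Z. X i Z - X j Z) < e / (C + 1)"
    using cauchyD[OF X] by blast
  have "nrm (\<lambda>Z. T (X i) Z - T (X j) Z) < e" if "i \<ge> N" "j \<ge> N" for i j
  proof -
    have n: "0 \<le> nrm (\<lambda>Z. X i Z - X j Z)" using cauchy_U[OF X] by simp
    have "nrm (\<lambda>Z. T (X i) Z - T (X j) Z) \<le> C * nrm (\<lambda>Z. X i Z - X j Z)"
      by (intro bounded_on_diff_le cauchy_U[OF X])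
    also have "\<dots> \<le> (C + 1) * nrm (\<lambda>Z. X i Z - X j Z)" using n by (simp add: distrib_right)
    also have "\<dots> < (C + 1) * (e / (C + 1))"
      using N that bounded_onD(1) by (intro mult_strict_left_mono) auto
    also have "\<dots> = e" using bounded_onD(1) by simp
    finally show ?thesis .
  qed
  then show "\<exists>N. \<forall>i\<ge>N. \<forall>j\<ge>N. nrm (\<lambda>Z. T (X i) Z - T (X j) Z) < e" by blast
qed (use cauchy_U[OF X] bounded_onD in auto)

end

lemma cauchy_scale: "cauchy_in U X \<Longrightarrow> cauchy_in U (\<lambda>i Z. c * X i Z)"
  using cauchy_map[OF bounded_on_scale] by simp

lemma cauchy_diff: "cauchy_in U X \<Longrightarrow> cauchy_in U Y \<Longrightarrow> cauchy_in U (\<lambda>i Z. X i Z - Y i Z)"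
  using cauchy_add[of X "\<lambda>i Z. -1 * Y i Z"] cauchy_scale[of Y "-1"] by simp

lemma cauchy_sum:
  "(\<And>s. s \<in> I \<Longrightarrow> cauchy_in U (X s)) \<Longrightarrow> cauchy_in U (\<lambda>i Z. \<Sum>s\<in>I. X s i Z)"
  by (induction I rule: infinite_finite_induct) (auto intro: cauchy_add)

lemma null_seq_add:
  assumes "\<And>i. X i \<in> U" "\<And>i. Y i \<in> U" "null_seq X" "null_seq Y"
  shows "null_seq (\<lambda>i Z. X i Z + Y i Z)"
  unfolding null_seq_def
proof (rule Lim_null_comparison)
  show "(\<lambda>i. nrm (X i) + nrm (Y i)) \<longlonglongrightarrow> 0"
    using tendsto_add[of _ 0 _ _ 0] assms by (simp add: null_seq_def)
  show "\<forall>\<^sub>F i in sequentially. norm (nrm (\<lambda>Z. X i Z + Y i Z)) \<le> nrm (X i) + nrm (Y i)"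
    using assms by (simp add: nrm_triangle)
qed

lemma null_seq_map:
  assumes T: "bounded_on T C" and X: "\<And>i. X i \<in> U" "null_seq X"
  shows "null_seq (\<lambda>i. T (X i))"
  unfolding null_seq_def
proof (rule Lim_null_comparison)
  show "(\<lambda>i. C * nrm (X i)) \<longlonglongrightarrow> 0"
    using X(2) by (intro tendsto_mult_right_zero) (simp add: null_seq_def)
  show "\<forall>\<^sub>F i in sequentially. norm (nrm (T (X i))) \<le> C * nrm (X i)"
    using X bounded_onD[OF T] by simp
qed

lemma null_seq_minus_commute:
  assumes "\<And>i. X i \<in> U" "\<And>i. Y i \<in> U"
  shows "null_seq (\<lambda>i Z. X i Z - Y i Z) \<longleftrightarrow> null_seq (\<lambda>i Z. Y i Z - X i Z)"
  using assms nrm_minus_commute[of "X _" "Y _"] by (simp add: null_seq_def)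

section \<open>Classes of Cauchy sequences and operators on them\<close>

lemma cauchy_rel_iff: "(X, Y) \<in> cauchy_rel U \<longleftrightarrow> cauchy_in U X \<and> cauchy_in U Y \<and> null_seq (\<lambda>i Z. X i Z - Y i Z)"
  by (simp add: cauchy_rel_def null_seq_def dist_poly_eq)

lemma equiv_cauchy_rel: "equiv {X. cauchy_in U X} (cauchy_rel U)"
proof (rule equivI)
  show "sym (cauchy_rel U)"
    by (rule symI) (use null_seq_minus_commute cauchy_U in \<open>auto simp: cauchy_rel_iff\<close>)
  show "trans (cauchy_rel U)"
  proof (rule transI)
    fix X Y Z assume "(X, Y) \<in> cauchy_rel U" "(Y, Z) \<in> cauchy_rel U"
    then show "(X, Z) \<in> cauchy_rel U"
      using null_seq_add[of "\<lambda>i W. X i W - Y i W" "\<lambda>i W. Y i W - Z i W"] cauchy_U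
      by (simp add: cauchy_rel_iff)
  qed
qed (auto simp: cauchy_rel_iff refl_on_def null_seq_def)

lemma cls_eq_iff:
  "cauchy_in U X \<Longrightarrow> cauchy_in U Y \<Longrightarrow> cls U X = cls U Y \<longleftrightarrow> null_seq (\<lambda>i Z. X i Z - Y i Z)"
  unfolding cls_def using eq_equiv_class_iff[OF equiv_cauchy_rel, of X Y] by (simp add: cauchy_rel_iff)

lemma cls_in_completion [simp]: "cauchy_in U X \<Longrightarrow> cls U X \<in> completion U"
  by (simp add: cls_def completion_def quotientI)

lemma repr_completion:
  assumes "x \<in> completion U"
  shows "cauchy_in U (repr x)" "cls U (repr x) = x"
proof -
  obtain X where X: "cauchy_in U X" "x = cls U X"
    using assms by (auto simp: completion_def cls_def elim!: quotientE)
  have "X \<in> x" using X by (simp add: cls_def cauchy_rel_iff null_seq_def)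
  then have "repr x \<in> x" unfolding repr_def by (rule someI[of "\<lambda>X. X \<in> x"])
  then have r: "(X, repr x) \<in> cauchy_rel U" using X by (simp add: cls_def)
  then show "cauchy_in U (repr x)" by (simp add: cauchy_rel_iff)
  then show "cls U (repr x) = x" using r X cls_eq_iff[of X "repr x"] by (simp add: cauchy_rel_iff)
qed

lemma completionE:
  assumes "x \<in> completion U" obtains X where "cauchy_in U X" "x = cls U X"
  using repr_completion[OF assms] by metis

text \<open>The operations on the completion are computed on chosen representatives; this relates
  the chosen one to a sequence at hand.\<close>

lemma repr_cls:
  assumes "cauchy_in U X"
  shows "cauchy_in U (repr (cls U X))" "null_seq (\<lambda>i Z. repr (cls U X) i Z - X i Z)"
  using repr_completion[OF cls_in_completion[OF assms]] cls_eq_iff[OF _ assms] by auto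

lemma cadd_cls:
  assumes X: "cauchy_in U X" and Y: "cauchy_in U Y"
  shows "cadd U (cls U X) (cls U Y) = cls U (\<lambda>i Z. X i Z + Y i Z)"
proof -
  note rX = repr_cls[OF X] and rY = repr_cls[OF Y]
  show ?thesis unfolding cadd_def
    using null_seq_add[OF _ _ rX(2) rY(2)] cauchy_U[OF rX(1)] cauchy_U[OF rY(1)] cauchy_U[OF X] cauchy_U[OF Y]
    by (subst cls_eq_iff) (auto intro: cauchy_add rX(1) rY(1) X Y simp: algebra_simps)
qed

text \<open>Independence of the representative: a bounded linear map sends the difference of two
  representatives, a null sequence, to a null sequence.\<close>

lemma lift_cls:
  assumes T: "bounded_on T C" and X: "cauchy_in U X"
  shows "cls U (\<lambda>i. T (repr (cls U X) i)) = cls U (\<lambda>i. T (X i))"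
proof -
  note rX = repr_cls[OF X]
  have "null_seq (\<lambda>i. T (\<lambda>Z. repr (cls U X) i Z - X i Z))"
    using null_seq_map[OF T _ rX(2)] cauchy_U[OF rX(1)] cauchy_U[OF X] by simp
  then show ?thesis
    using cauchy_U[OF rX(1)] cauchy_U[OF X]
    by (subst cls_eq_iff) (auto intro!: cauchy_map[OF T] rX(1) X simp: bounded_on_diff[OF T])
qed

lemma cscale_cls: "cauchy_in U X \<Longrightarrow> cscale U c (cls U X) = cls U (\<lambda>i Z. c * X i Z)"
  using lift_cls[OF bounded_on_scale] by (simp add: cscale_def)

text \<open>The inner product is defined by \<open>lim\<close>, which has a meaning only once
  convergence is known. By the reverse triangle inequality the norms of a Cauchy sequence form a
  Cauchy sequence of reals.\<close>

lemma cnorm_cls: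
  assumes X: "cauchy_in U X"
  shows "(\<lambda>i. nrm (X i)) \<longlonglongrightarrow> cnorm (cls U X)"
proof -
  let ?Y = "repr (cls U X)"
  note rX = repr_cls[OF X]
  have Y: "?Y i \<in> U" and X': "X i \<in> U" for i using cauchy_U[OF rX(1)] cauchy_U[OF X] by auto
  have "Cauchy (\<lambda>i. nrm (?Y i))"
  proof (rule metric_CauchyI)
    fix e :: real assume "e > 0"
    then obtain N where "\<forall>i\<ge>N. \<forall>j\<ge>N. nrm (\<lambda>Z. ?Y i Z - ?Y j Z) < e"
      using cauchyD[OF rX(1)] by blast
    then show "\<exists>N. \<forall>i\<ge>N. \<forall>j\<ge>N. dist (nrm (?Y i)) (nrm (?Y j)) < e"
      using abs_nrm_diff_le[of "?Y _" "?Y _"] Y unfolding dist_real_def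
      by (meson in_polys le_less_trans)
  qed
  then obtain L where L: "(\<lambda>i. nrm (?Y i)) \<longlonglongrightarrow> L"
    using convergent_def real_Cauchy_convergent by blast
  then have "(\<lambda>i. complex_of_real ((nrm (?Y i))\<^sup>2)) \<longlonglongrightarrow> of_real (L\<^sup>2)"
    by (intro tendsto_of_real tendsto_power)
  then have "(\<lambda>i. inner_poly (?Y i) (?Y i)) \<longlonglongrightarrow> of_real (L\<^sup>2)"
    using Y by (simp add: inner_poly_self)
  then have "cinner (cls U X) (cls U X) = of_real (L\<^sup>2)"
    unfolding cinner_def by (rule limI)
  moreover have "L \<ge> 0" using L Y by (intro LIMSEQ_le_const[OF L]) auto
  ultimately have c: "cnorm (cls U X) = L" by (simp add: cnorm_def)
  have "(\<lambda>i. nrm (X i) - nrm (?Y i)) \<longlonglongrightarrow> 0"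
  proof (rule Lim_null_comparison)
    show "(\<lambda>i. nrm (\<lambda>Z. ?Y i Z - X i Z)) \<longlonglongrightarrow> 0" using rX(2) by (simp add: null_seq_def)
    show "\<forall>\<^sub>F i in sequentially. norm (nrm (X i) - nrm (?Y i)) \<le> nrm (\<lambda>Z. ?Y i Z - X i Z)"
      using abs_nrm_diff_le[of "?Y _" "X _"] Y X' by (simp add: abs_minus_commute)
  qed
  from tendsto_add[OF this L] show ?thesis unfolding c by simp
qed

lemma cdist_cls:
  assumes X: "cauchy_in U X" and Y: "cauchy_in U Y"
  shows "(\<lambda>i. nrm (\<lambda>Z. X i Z - Y i Z)) \<longlonglongrightarrow> cdist U (cls U X) (cls U Y)"
  using cnorm_cls[OF cauchy_diff[OF X Y]] cauchy_scale[OF Y, of "-1"]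
  by (simp add: cdist_def cscale_cls[OF Y] cadd_cls[OF X])

lemma cdist_cls_le:
  assumes X: "cauchy_in U X" and Y: "cauchy_in U Y" and le: "\<And>i. i \<ge> N \<Longrightarrow> nrm (\<lambda>Z. X i Z - Y i Z) \<le> e"
  shows "cdist U (cls U X) (cls U Y) \<le> e"
  by (rule LIMSEQ_le_const2[OF cdist_cls[OF X Y]]) (use le in auto)

lemma cdist_cls_nonneg:
  assumes X: "cauchy_in U X" and Y: "cauchy_in U Y"
  shows "0 \<le> cdist U (cls U X) (cls U Y)"
  using cauchy_U[OF X] cauchy_U[OF Y] by (intro LIMSEQ_le_const[OF cdist_cls[OF X Y]]) auto

lemma bounded_operator_lift:
  assumes T: "bounded_on T C"
  shows "bounded_operator U (\<lambda>x. cls U (\<lambda>i. T (repr x i)))"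
  unfolding bounded_operator_def
proof (intro conjI ballI allI)
  fix x assume "x \<in> completion U"
  then obtain X where X: "cauchy_in U X" "x = cls U X" by (rule completionE)
  note TX = cauchy_map[OF T X(1)]
  show "cls U (\<lambda>i. T (repr x i)) \<in> completion U"
    unfolding X(2) lift_cls[OF T X(1)] using TX by simp
  {
    fix y assume "y \<in> completion U"
    then obtain Y where Y: "cauchy_in U Y" "y = cls U Y" by (rule completionE)
    show "cls U (\<lambda>i. T (repr (cadd U x y) i)) = cadd U (cls U (\<lambda>i. T (repr x i))) (cls U (\<lambda>i. T (repr y i)))"
      unfolding X(2) Y(2) cadd_cls[OF X(1) Y(1)] lift_cls[OF T X(1)] lift_cls[OF T Y(1)]
        lift_cls[OF T cauchy_add[OF X(1) Y(1)]] cadd_cls[OF TX cauchy_map[OF T Y(1)]]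
      using bounded_onD(4)[OF T] cauchy_U X(1) Y(1) by simp
  }
  fix c
  show "cls U (\<lambda>i. T (repr (cscale U c x) i)) = cscale U c (cls U (\<lambda>i. T (repr x i)))"
    unfolding X(2) cscale_cls[OF X(1)] lift_cls[OF T X(1)] cscale_cls[OF TX]
      lift_cls[OF T cauchy_scale[OF X(1)]]
    using bounded_onD(5)[OF T] cauchy_U X(1) by simp
next
  show "\<exists>C. \<forall>x\<in>completion U. cnorm (cls U (\<lambda>i. T (repr x i))) \<le> C * cnorm x"
  proof (intro exI ballI)
    fix x assume "x \<in> completion U"
    then obtain X where X: "cauchy_in U X" "x = cls U X" by (rule completionE)
    show "cnorm (cls U (\<lambda>i. T (repr x i))) \<le> C * cnorm x"
      unfolding X(2) lift_cls[OF T X(1)]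
      by (rule LIMSEQ_le[OF cnorm_cls[OF cauchy_map[OF T X(1)]] tendsto_mult_left[OF cnorm_cls[OF X(1)]]])
        (use bounded_onD(3)[OF T] cauchy_U[OF X(1)] in auto)
  qed
qed

section \<open>Closed subspaces of the completion\<close>

lemma closed_subspace_closed:
  assumes W: "closed_subspace U W"
    and "\<And>i. s i \<in> W" "x \<in> completion U" "(\<lambda>i. cdist U (s i) x) \<longlonglongrightarrow> 0"
  shows "x \<in> W"
proof -
  have "\<forall>s x. (\<forall>i. s i \<in> W) \<and> x \<in> completion U \<and> (\<lambda>i. cdist U (s i) x) \<longlonglongrightarrow> 0 \<longrightarrow> x \<in> W"
    using W unfolding closed_subspace_def by (elim conjE) assumption
  from this[rule_format, of s x] show ?thesis using assms by simp
qed

text \<open>Constant sequences are dense: the class of a Cauchy sequence is the limit of its own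
  terms.\<close>

lemma closed_subspace_dense:
  assumes W: "closed_subspace U W" and e: "\<And>f. f \<in> U \<Longrightarrow> embed U f \<in> W"
  shows "W = completion U"
proof
  show "W \<subseteq> completion U" using W unfolding closed_subspace_def by (elim conjE)
  show "completion U \<subseteq> W"
  proof
    fix x assume x: "x \<in> completion U"
    then obtain X where X: "cauchy_in U X" "x = cls U X" by (rule completionE)
    have "(\<lambda>i. cdist U (embed U (X i)) x) \<longlonglongrightarrow> 0"
    proof (rule LIMSEQ_I)
      fix r :: real assume "r > 0"
      then obtain N where N: "\<forall>i\<ge>N. \<forall>j\<ge>N. nrm (\<lambda>Z. X i Z - X j Z) < r / 2"
        using cauchyD[OF X(1), of "r / 2"] by auto
      have "norm (cdist U (embed U (X i)) x - 0) < r" if "i \<ge> N" for i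
      proof -
        have c: "cauchy_in U (\<lambda>_. X i)" using cauchy_U[OF X(1)] by simp
        have "cdist U (embed U (X i)) x \<le> r / 2"
          unfolding embed_def X(2) using N that by (intro cdist_cls_le[OF c X(1), of N]) (auto intro: less_imp_le)
        moreover have "0 \<le> cdist U (embed U (X i)) x"
          unfolding embed_def X(2) by (rule cdist_cls_nonneg[OF c X(1)])
        ultimately show ?thesis using \<open>r > 0\<close> by simp
      qed
      then show "\<exists>N. \<forall>i\<ge>N. norm (cdist U (embed U (X i)) x - 0) < r" by blast
    qed
    then show "x \<in> W"
      by (rule closed_subspace_closed[OF W e[OF cauchy_U[OF X(1)]] x])
  qed
qed

context
  fixes W assumes W: "closed_subspace U W"
begin

lemma closed_subspace_add:
  "cauchy_in U X \<Longrightarrow> cauchy_in U Y \<Longrightarrow> cls U X \<in> W \<Longrightarrow> cls U Y \<in> W \<Longrightarrow> cls U (\<lambda>i Z. X i Z + Y i Z) \<in> W"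
proof -
  have "\<forall>x\<in>W. \<forall>y\<in>W. cadd U x y \<in> W"
    using W unfolding closed_subspace_def by (elim conjE) assumption
  then show "cauchy_in U X \<Longrightarrow> cauchy_in U Y \<Longrightarrow> cls U X \<in> W \<Longrightarrow> cls U Y \<in> W \<Longrightarrow>
    cls U (\<lambda>i Z. X i Z + Y i Z) \<in> W"
    using cadd_cls[of X Y] by metis
qed

lemma closed_subspace_scale:
  "cauchy_in U X \<Longrightarrow> cls U X \<in> W \<Longrightarrow> cls U (\<lambda>i Z. c * X i Z) \<in> W"
proof -
  have "\<forall>c. \<forall>x\<in>W. cscale U c x \<in> W"
    using W unfolding closed_subspace_def by (elim conjE) assumption
  then show "cauchy_in U X \<Longrightarrow> cls U X \<in> W \<Longrightarrow> cls U (\<lambda>i Z. c * X i Z) \<in> W"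
    using cscale_cls[of X c] by metis
qed

lemma closed_subspace_sum:
  assumes "\<And>s. s \<in> I \<Longrightarrow> cauchy_in U (X s) \<and> cls U (X s) \<in> W"
  shows "cls U (\<lambda>i Z. \<Sum>s\<in>I. X s i Z) \<in> W"
proof -
  have "czero U \<in> W" using W unfolding closed_subspace_def by (elim conjE) assumption
  then have z: "cls U (\<lambda>i Z. 0) \<in> W" by (simp add: czero_def embed_def)
  show ?thesis using assms
    by (induction I rule: infinite_finite_induct)
      (auto simp: z intro!: closed_subspace_add cauchy_sum)
qed

text \<open>Closedness on representatives: \<open>n\<close> numbers the approximating points and
  \<open>i\<close> the terms of a representative. A distance is a limit over \<open>i\<close>, so
  for each \<open>n\<close> only late terms have to be estimated.\<close>

lemma closed_subspace_limit:
  fixes S :: "nat \<Rightarrow> nat \<Rightarrow> cfun"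
  assumes S: "\<And>n. cauchy_in U (S n)" "\<And>n. cls U (S n) \<in> W" and X: "cauchy_in U X"
    and le: "\<And>e. e > 0 \<Longrightarrow> \<exists>M. \<forall>n\<ge>M. \<exists>N. \<forall>i\<ge>N. nrm (\<lambda>Z. S n i Z - X i Z) \<le> e"
  shows "cls U X \<in> W"
proof -
  have "(\<lambda>n. cdist U (cls U (S n)) (cls U X)) \<longlonglongrightarrow> 0"
  proof (rule LIMSEQ_I)
    fix r :: real assume r: "r > 0"
    then obtain M where M: "\<forall>n\<ge>M. \<exists>N. \<forall>i\<ge>N. nrm (\<lambda>Z. S n i Z - X i Z) \<le> r / 2"
      using le[of "r / 2"] by auto
    have "norm (cdist U (cls U (S n)) (cls U X) - 0) < r" if n: "n \<ge> M" for n
    proof -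
      obtain N where "\<forall>i\<ge>N. nrm (\<lambda>Z. S n i Z - X i Z) \<le> r / 2" using M n by blast
      then have "cdist U (cls U (S n)) (cls U X) \<le> r / 2"
        by (intro cdist_cls_le[OF S(1) X, of N]) auto
      then show ?thesis using cdist_cls_nonneg[OF S(1)[of n] X] r by simp
    qed
    then show "\<exists>M. \<forall>n\<ge>M. norm (cdist U (cls U (S n)) (cls U X) - 0) < r" by blast
  qed
  then show ?thesis by (rule closed_subspace_closed[OF W S(2) cls_in_completion[OF X]])
qed

end

end

section \<open>Column degrees\<close>

text \<open>The weight of a monomial for the action of diagonal matrices on the columns.\<close>

definition col :: "monom \<Rightarrow> nat \<Rightarrow> nat" where
  "col a j = (\<Sum>v\<in>keys a. if snd v = j then lookup a v else 0)"

lemma col_le_mdeg: "col a j \<le> mdeg a"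
  unfolding col_def mdeg_def by (rule sum_mono) auto

lemma col_eq_0D: "col a j = 0 \<Longrightarrow> v \<in> keys a \<Longrightarrow> snd v \<noteq> j"
proof
  assume "col a j = 0" and v: "v \<in> keys a" and "snd v = j"
  then have "\<forall>w\<in>keys a. (if snd w = j then lookup a w else 0) = 0" by (simp add: col_def)
  from bspec[OF this v] show False using v \<open>snd v = j\<close> by (simp add: in_keys_iff)
qed

lemma mon_mult_diagonal:
  assumes d: "diagonal d"
  shows "mon a (Z \<bullet>\<bullet> d) = (\<Prod>v\<in>keys a. d (snd v) (snd v) ^ lookup a v) * mon a Z"
  by (simp add: mon_def mult_diagonal[OF d] power_mult_distrib prod.distrib mult.commute)

lemma prod_col:
  assumes "finite J" "keys a \<subseteq> R \<times> J"
  shows "(\<Prod>v\<in>keys a. z (snd v) ^ lookup a v) = (\<Prod>j\<in>J. (z j :: complex) ^ col a j)"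
proof -
  have "(\<Prod>j\<in>J. z j ^ col a j) = (\<Prod>j\<in>J. \<Prod>v\<in>keys a. if snd v = j then z j ^ lookup a v else 1)"
    unfolding col_def power_sum by (intro prod.cong refl) auto
  also have "\<dots> = (\<Prod>v\<in>keys a. \<Prod>j\<in>J. if snd v = j then z j ^ lookup a v else 1)"
    by (rule prod.swap)
  also have "\<dots> = (\<Prod>v\<in>keys a. z (snd v) ^ lookup a v)"
    using assms by (intro prod.cong refl) (auto simp: prod.delta')
  finally show ?thesis by simp
qed

definition onecol :: "nat \<Rightarrow> complex \<Rightarrow> arr" where
  "onecol j t = diag (\<lambda>i. if i = j then t else 1)"

lemma diagonal_onecol [simp]: "diagonal (onecol j t)"
  by (simp add: onecol_def)

lemma mon_onecol: "mon a (Z \<bullet>\<bullet> onecol j t) = t ^ col a j * mon a Z"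
proof -
  have "(\<Prod>v\<in>keys a. (if snd v = j then t else 1) ^ lookup a v) = t ^ col a j"
    unfolding col_def power_sum by (intro prod.cong refl) auto
  then show ?thesis by (simp add: mon_mult_diagonal) (simp add: onecol_def)
qed

lemma R_act_onecol:
  assumes h: "h \<in> polys"
  shows "R_act (onecol j t) h = (\<lambda>Z. \<Sum>a\<in>msupp h. (pcoeff h a * t ^ col a j) * mon a Z)"
proof
  fix Z
  show "R_act (onecol j t) h Z = (\<Sum>a\<in>msupp h. (pcoeff h a * t ^ col a j) * mon a Z)"
    unfolding R_act_def using fun_cong[OF polys_expand[OF h finite_msupp order.refl], of "Z \<bullet>\<bullet> onecol j t"]
    by (simp add: mon_onecol mult.assoc)
qed

lemma pcoeff_R_act_onecol:
  assumes h: "h \<in> polys"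
  shows "R_act (onecol j t) h \<in> polys" "pcoeff (R_act (onecol j t) h) a = t ^ col a j * pcoeff h a"
  unfolding R_act_onecol[OF h] by (simp_all add: mon_sum_polys) (simp add: msupp_def)

text \<open>Orthogonality of the characters of the cyclic group of order \<open>N\<close>. For
  exponents below \<open>N\<close>, different means different modulo \<open>N\<close>, and the
  geometric sum with ratio \<open>w\<close> vanishes since \<open>w ^ N = 1\<close> and
  \<open>w\<close> is not 1.\<close>

lemma sum_root_unity_powers:
  fixes N p q :: nat
  defines "\<zeta> \<equiv> cis (2 * pi / of_nat N)"
  assumes "p < N" "q < N"
  shows "(\<Sum>s<N. inverse ((\<zeta> ^ s) ^ q) * (\<zeta> ^ s) ^ p) = (if p = q then of_nat N else 0)"
proof -
  have nz: "\<zeta> \<noteq> 0" by (simp add: \<zeta>_def)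
  have "N > 0" using assms(2) by simp
  then have "of_nat N * (2 * pi / of_nat N) = 2 * pi" by simp
  then have one: "\<zeta> ^ N = 1" unfolding \<zeta>_def Complex.DeMoivre by (simp only: cis_2pi)
  define w where "w = inverse (\<zeta> ^ q) * \<zeta> ^ p"
  have "(\<Sum>s<N. inverse ((\<zeta> ^ s) ^ q) * (\<zeta> ^ s) ^ p) = (\<Sum>s<N. w ^ s)"
    by (simp add: w_def power_mult_distrib power_inverse power_mult[symmetric] mult.commute)
  also have "\<dots> = (if p = q then of_nat N else 0)"
  proof (cases "p = q")
    case True
    then show ?thesis using nz by (simp add: w_def)
  next
    case False
    have "\<zeta> ^ p \<noteq> \<zeta> ^ q"
    proof
      assume "\<zeta> ^ p = \<zeta> ^ q"
      then have "cis (2 * pi * real p / real N) = cis (2 * pi * real q / real N)"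
        by (simp add: \<zeta>_def Complex.DeMoivre mult_ac)
      then show False
        using bij_betw_imp_inj_on[OF Complex.bij_betw_roots_unity[of N]] assms False
        by (auto simp: inj_on_def)
    qed
    then have "w \<noteq> 1" using nz by (auto simp: w_def field_simps)
    moreover have "w ^ N = 1"
      using one by (simp add: w_def power_mult_distrib power_inverse power_mult[symmetric] mult.commute)
        (simp add: mult.commute[of _ N] power_mult)
    moreover have "w ^ N - 1 = (w - 1) * (\<Sum>s<N. w ^ s)" by (rule power_diff_1_eq)
    ultimately show ?thesis using False by simp
  qed
  finally show ?thesis .
qed

section \<open>The contragredient representations\<close>

locale contragredient =
  fixes l :: nat and m :: "nat \<Rightarrow> nat" and f :: cfun and G :: "nat \<Rightarrow> arr set"
  assumes G: "G = unitary \<or> G = GL" and f: "is_f_max l m f"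
begin

abbreviation V where "V \<equiv> V_check G f"
abbreviation U where "U \<equiv> union_space l V"
abbreviation S where "S k \<equiv> {..<l} \<times> {..<k}"

definition d where "d = (\<Sum>i<l. m i)"
text \<open>The column degrees of \<open>f\<close>, continued by 0 to all columns.\<close>

definition M where "M j = (if j < l then m j else 0)"

lemma G_GL: "g \<in> G k \<Longrightarrow> g \<in> GL k"
  using G unitary_subset_GL by auto

lemma G_mono: "k \<le> K \<Longrightarrow> g \<in> G k \<Longrightarrow> g \<in> G K"
  using G unitary_mono[of k K] GL_mono[of k K] by auto

lemma G_one [simp]: "arr_one \<in> G k"
  using G by auto

lemma G_mult: "g \<in> G k \<Longrightarrow> h \<in> G k \<Longrightarrow> g \<bullet>\<bullet> h \<in> G k"
  using G mult_unitary mult_GL(1) by auto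

lemma G_adjoint: "g \<in> G k \<Longrightarrow> arr_adjoint g \<in> G k"
  using G adjoint_unitary adjoint_GL(1) by auto

lemma G_onecol: "j < k \<Longrightarrow> cmod t = 1 \<Longrightarrow> onecol j t \<in> G k"
  using G diag_unitary[of "\<lambda>i. if i = j then t else 1" k] unitary_subset_GL[of k]
  by (auto simp: onecol_def)

lemma f_polys_on: "f \<in> polys_on (S l)" and f_equiv: "left_equivariant l m f" and f_nz: "f \<noteq> (\<lambda>Z. 0)"
  using f by (auto simp: is_f_max_def V_space_def poly_funs_eq left_equivariant_def)

lemma f_polys [simp]: "f \<in> polys"
  using f_polys_on by (rule polys_on_polys)

lemma f_diagonal:
  assumes "l \<le> k" "g \<in> GL k" "diagonal g"
  shows "R_act g f = (\<lambda>Z. (\<Prod>j<l. g j j ^ m j) * f Z)"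
  using f assms by (auto simp: is_f_max_def)

lemma f_upper:
  assumes "l \<le> k" "g \<in> GL k" "upper_triangular g" "unit_diagonal g" shows "R_act g f = f"
  using f assms by (auto simp: is_f_max_def)

text \<open>This is \<open>V_space l m k\<close>, used as an ambient space of \<open>V k\<close>:
  membership can be tested by variables and equivariance, without writing a function as a
  combination of translates of \<open>f\<close>.\<close>

definition equiv_polys :: "nat \<Rightarrow> cfun set" where
  "equiv_polys k = {h \<in> polys_on (S k). left_equivariant l m h}"

lemma equiv_polys_homog: "h \<in> equiv_polys k \<Longrightarrow> h \<in> homog d (S k)"
  unfolding d_def equiv_polys_def by (intro left_equivariant_homog) auto

lemma equiv_polys_R_check: "g \<in> G k \<Longrightarrow> h \<in> equiv_polys k \<Longrightarrow> R_check g h \<in> equiv_polys k"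
  unfolding equiv_polys_def R_check_eq using check_block[OF G_GL]
  by (auto intro: R_act_polys_on left_equivariant_R_act)

lemma equiv_polys_sum: "(\<And>i. i \<in> I \<Longrightarrow> h i \<in> equiv_polys k) \<Longrightarrow> (\<lambda>Z. \<Sum>i\<in>I. h i Z) \<in> equiv_polys k"
  by (auto simp: equiv_polys_def intro: polys_on_sum left_equivariant_sum)

lemma equiv_polys_scale: "h \<in> equiv_polys k \<Longrightarrow> (\<lambda>Z. c * h Z) \<in> equiv_polys k"
  by (auto simp: equiv_polys_def intro: polys_on_scale left_equivariant_scale)

lemma equiv_polys_add: "h \<in> equiv_polys k \<Longrightarrow> h' \<in> equiv_polys k \<Longrightarrow> (\<lambda>Z. h Z + h' Z) \<in> equiv_polys k"
  by (auto simp: equiv_polys_def intro: polys_on_add left_equivariant_add)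

lemma equiv_polys_mono: "k \<le> K \<Longrightarrow> equiv_polys k \<subseteq> equiv_polys K"
proof -
  assume "k \<le> K"
  then have "S k \<subseteq> S K" by auto
  from polys_on_mono[OF this] show ?thesis by (auto simp: equiv_polys_def)
qed

lemma f_equiv_polys: "l \<le> k \<Longrightarrow> f \<in> equiv_polys k"
  using equiv_polys_mono[of l k] f_polys_on f_equiv by (auto simp: equiv_polys_def)

section \<open>The spans of the orbits and their union\<close>

lemma V_E:
  assumes "h \<in> V k"
  obtains A c where "finite A" "A \<subseteq> G k" "h = (\<lambda>w. \<Sum>g\<in>A. c g * R_check g f w)"
  using assms by (auto simp: V_check_def)

lemma V_equiv_polys: "l \<le> k \<Longrightarrow> V k \<subseteq> equiv_polys k"
  by (auto elim!: V_E intro!: equiv_polys_sum equiv_polys_scale equiv_polys_R_check f_equiv_polys)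

lemma V_mono: "k \<le> K \<Longrightarrow> h \<in> V k \<Longrightarrow> h \<in> V K"
  using G_mono[of k K] by (auto simp: V_check_def)

lemma R_check_f_V: "g \<in> G k \<Longrightarrow> R_check g f \<in> V k"
  unfolding V_check_def by (intro CollectI exI[of _ "{g}"] exI[of _ "\<lambda>_. 1"]) auto

lemma V_subspace: "subspace_poly (V k)"
  unfolding subspace_poly_def
proof (intro conjI ballI allI)
  show "(\<lambda>Z. 0) \<in> V k" unfolding V_check_def by (intro CollectI exI[of _ "{}"]) auto
next
  fix h h' assume h: "h \<in> V k" and h': "h' \<in> V k"
  obtain A c where A: "finite A" "A \<subseteq> G k" "h = (\<lambda>w. \<Sum>g\<in>A. c g * R_check g f w)"
    using h by (rule V_E)
  obtain B e where B: "finite B" "B \<subseteq> G k" "h' = (\<lambda>w. \<Sum>g\<in>B. e g * R_check g f w)"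
    using h' by (rule V_E)
  \<comment> \<open>A sum over a set lists each group element once, so coefficients at common
    elements have to be added.\<close>
  let ?c = "\<lambda>g. (if g \<in> A then c g else 0) + (if g \<in> B then e g else 0)"
  have "(\<Sum>g\<in>A. c g * R_check g f w) = (\<Sum>g\<in>A \<union> B. (if g \<in> A then c g else 0) * R_check g f w)"
    "(\<Sum>g\<in>B. e g * R_check g f w) = (\<Sum>g\<in>A \<union> B. (if g \<in> B then e g else 0) * R_check g f w)" for w
    using A(1) B(1) by (intro sum.mono_neutral_cong_left; auto)+
  then have "(\<lambda>Z. h Z + h' Z) = (\<lambda>w. \<Sum>g\<in>A \<union> B. ?c g * R_check g f w)"
    unfolding A(3) B(3) by (simp add: sum.distrib distrib_right)
  then show "(\<lambda>Z. h Z + h' Z) \<in> V k"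
    unfolding V_check_def using A B by (intro CollectI exI[of _ "A \<union> B"] exI[of _ ?c]) auto
next
  fix c h assume "h \<in> V k"
  then obtain A e where A: "finite A" "A \<subseteq> G k" "h = (\<lambda>w. \<Sum>g\<in>A. e g * R_check g f w)"
    by (rule V_E)
  then show "(\<lambda>Z. c * h Z) \<in> V k"
    unfolding V_check_def
    by (intro CollectI exI[of _ A] exI[of _ "\<lambda>g. c * e g"]) (auto simp: sum_distrib_left mult.assoc)
qed

lemma V_scale: "h \<in> V k \<Longrightarrow> (\<lambda>Z. c * h Z) \<in> V k"
  using V_subspace[of k] by (simp add: subspace_poly_def)

lemma V_sum: "(\<And>i. i \<in> I \<Longrightarrow> h i \<in> V k) \<Longrightarrow> (\<lambda>Z. \<Sum>i\<in>I. h i Z) \<in> V k"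
  using V_subspace[of k] by (induction I rule: infinite_finite_induct) (auto simp: subspace_poly_def)

lemma R_check_V:
  assumes g: "g \<in> G k" and h: "h \<in> V k" shows "R_check g h \<in> V k"
proof -
  obtain A c where A: "finite A" "A \<subseteq> G k" "h = (\<lambda>w. \<Sum>a\<in>A. c a * R_check a f w)"
    using h by (rule V_E)
  have "R_check g h = (\<lambda>w. \<Sum>a\<in>A. c a * R_check g (R_check a f) w)"
    unfolding A(3) by (simp add: R_check_def)
  also have "\<dots> = (\<lambda>w. \<Sum>a\<in>A. c a * R_check (g \<bullet>\<bullet> a) f w)"
  proof (intro ext sum.cong refl)
    fix w a assume "a \<in> A"
    then have "a \<in> GL k" using A(2) G_GL by blast
    then show "c a * R_check g (R_check a f) w = c a * R_check (g \<bullet>\<bullet> a) f w"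
      by (simp only: R_check_mult[OF G_GL[OF g]])
  qed
  also have "\<dots> \<in> V k"
    using A(2) by (intro V_sum V_scale R_check_f_V G_mult g) auto
  finally show ?thesis .
qed

lemma f_U: "f \<in> U"
  using R_check_f_V[OF G_one, of l] by (auto simp: union_space_def R_check_def)

text \<open>The level may be taken above any bound \<open>k0\<close>, which provides a common level
  for two functions or for a function and a group element.\<close>

lemma U_V:
  assumes "h \<in> U" obtains k where "l \<le> k" "k0 \<le> k" "h \<in> V k"
proof -
  obtain k where "l \<le> k" "h \<in> V k" using assms by (auto simp: union_space_def)
  then show ?thesis using V_mono[of k "max k k0" h] that[of "max k k0"] by auto
qed

lemma V_U: "l \<le> k \<Longrightarrow> h \<in> V k \<Longrightarrow> h \<in> U"
  by (auto simp: union_space_def)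

sublocale poly_space U
proof
  have z: "(\<lambda>Z. 0) \<in> U" using V_subspace[of l] by (intro V_U[of l]) (auto simp: subspace_poly_def)
  have a: "(\<lambda>Z. h Z + h' Z) \<in> U" if h: "h \<in> U" "h' \<in> U" for h h'
  proof -
    obtain k where k: "l \<le> k" "h \<in> V k" using U_V[OF h(1)] by blast
    obtain k' where k': "l \<le> k'" "k \<le> k'" "h' \<in> V k'" using U_V[OF h(2)] by blast
    show ?thesis using V_subspace[of k'] V_mono[OF k'(2) k(2)] k'(3)
      by (intro V_U[OF k'(1)]) (auto simp: subspace_poly_def)
  qed
  have s: "(\<lambda>Z. c * h Z) \<in> U" if h: "h \<in> U" for c h
  proof -
    obtain k where k: "l \<le> k" "h \<in> V k" using U_V[OF h] by blast
    show ?thesis using V_subspace[of k] k(2) by (intro V_U[OF k(1)]) (auto simp: subspace_poly_def)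
  qed
  show "subspace_poly U" using z a s by (auto simp: subspace_poly_def)
  show "U \<subseteq> polys"
  proof
    fix h assume "h \<in> U"
    then obtain k where k: "l \<le> k" "h \<in> V k" using U_V by blast
    then show "h \<in> polys" using V_equiv_polys[OF k(1)] by (auto simp: equiv_polys_def polys_on_def)
  qed
qed

lemma limit_groupE:
  assumes "g \<in> limit_group G" obtains k where "k0 \<le> k" "g \<in> G k"
proof -
  obtain k where "g \<in> G k" using assms by (auto simp: limit_group_def)
  then show ?thesis using G_mono[of k "max k k0" g] that[of "max k k0"] by auto
qed

lemma limit_groupI: "g \<in> G k \<Longrightarrow> g \<in> limit_group G"
  by (auto simp: limit_group_def)

text \<open>All of \<open>U\<close> has the one degree \<open>d\<close>, and the block size of
  \<open>g\<close> is fixed, so the estimate for matrix substitutions gives one constant for all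
  numbers of columns.\<close>

lemma bounded_R_check:
  assumes "g \<in> limit_group G" obtains C where "bounded_on (R_check g) C"
proof -
  obtain k0 where k0: "g \<in> G k0" using limit_groupE[OF assms] by blast
  have M: "check g \<in> block k0" by (rule check_block[OF G_GL[OF k0]])
  define B where "B = (1 + (\<Sum>j<k0. \<Sum>q<k0. (cmod (check g j q))\<^sup>2)) ^ d"
  have B: "B \<ge> 0" unfolding B_def by (intro zero_le_power add_nonneg_nonneg sum_nonneg) auto
  have "R_check g h \<in> U \<and> nrm (R_check g h) \<le> sqrt B * nrm h" if h: "h \<in> U" for h
  proof
    obtain K where K: "l \<le> K" "k0 \<le> K" "h \<in> V K" using U_V[OF h] by blast
    show U: "R_check g h \<in> U" using R_check_V[OF G_mono[OF K(2) k0] K(3)] K(1) by (rule V_U[rotated])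
    have "(nrm (R_check g h))\<^sup>2 \<le> B * (nrm h)\<^sup>2"
      unfolding R_check_eq B_def using V_equiv_polys[OF K(1)] K(3)
      by (intro nrm_R_act_le[OF M K(2), of "{..<l}"] equiv_polys_homog) auto
    also have "\<dots> = (sqrt B * nrm h)\<^sup>2" using B by (simp add: power_mult_distrib)
    finally have "(nrm (R_check g h))\<^sup>2 \<le> (sqrt B * nrm h)\<^sup>2" .
    then show "nrm (R_check g h) \<le> sqrt B * nrm h"
      by (rule power2_le_imp_le) (use B h in simp)
  qed
  then have "bounded_on (R_check g) (sqrt B)"
    using B by (auto simp: bounded_on_def R_check_def)
  then show ?thesis using that by blast
qed

lemma limit_action_cls:
  assumes g: "g \<in> limit_group G" and X: "cauchy_in U X"
  shows "limit_action l V R_check g (cls U X) = cls U (\<lambda>i. R_check g (X i))"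
    and "cauchy_in U (\<lambda>i. R_check g (X i))"
proof -
  obtain C where C: "bounded_on (R_check g) C" using bounded_R_check[OF g] .
  show "limit_action l V R_check g (cls U X) = cls U (\<lambda>i. R_check g (X i))"
    unfolding limit_action_def by (rule lift_cls[OF C X])
  show "cauchy_in U (\<lambda>i. R_check g (X i))" by (rule cauchy_map[OF C X])
qed

lemma R_check_one: "R_check arr_one h = h"
  by (simp add: R_check_def)

lemma inductive_system: "inductive_system G l V R_check"
  unfolding inductive_system_def
proof (intro allI impI conjI ballI)
  fix k assume k: "l \<le> k"
  show "subspace_poly (V k)" by (rule V_subspace)
  show "V k \<subseteq> poly_funs l k" using V_equiv_polys[OF k] by (auto simp: equiv_polys_def poly_funs_eq)
  show "V k \<subseteq> V (Suc k)" using V_mono[of k "Suc k"] by auto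
  fix g assume g: "g \<in> G k"
  fix h assume h: "h \<in> V k"
  show "R_check g h \<in> V k" by (rule R_check_V[OF g h])
  show "R_check g (\<lambda>Z. h Z + h' Z) = (\<lambda>Z. R_check g h Z + R_check g h' Z)" for h'
    by (simp add: R_check_def)
  show "R_check g (\<lambda>Z. c * h Z) = (\<lambda>Z. c * R_check g h Z)" for c
    by (simp add: R_check_def)
  show "R_check (g \<bullet>\<bullet> g') h = R_check g (R_check g' h)" if "g' \<in> G k" for g'
    by (rule R_check_mult[OF G_GL[OF g] G_GL[OF that]])
qed (rule R_check_one)

lemma is_limit_representation: "is_limit_representation G l V R_check"
  unfolding is_limit_representation_def
proof (intro conjI ballI allI impI)
  fix g assume g: "g \<in> limit_group G"
  obtain C where C: "bounded_on (R_check g) C" using bounded_R_check[OF g] .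
  show "bounded_operator U (limit_action l V R_check g)"
    using bounded_operator_lift[OF C] unfolding limit_action_def[abs_def] .
next
  fix x assume "x \<in> limit_space l V"
  then show "limit_action l V R_check arr_one x = x"
    using repr_completion(2)[of x] unfolding limit_action_def limit_space_def by (simp add: R_check_one)
next
  fix g h x assume g: "g \<in> limit_group G" and h: "h \<in> limit_group G" and "x \<in> limit_space l V"
  then obtain X where X: "cauchy_in U X" "x = cls U X"
    using completionE unfolding limit_space_def by blast
  obtain k where k: "g \<in> G k" using limit_groupE[OF g] by blast
  obtain K where K: "k \<le> K" "h \<in> G K" using limit_groupE[OF h] by blast
  have gK: "g \<in> G K" by (rule G_mono[OF K(1) k])
  have gh: "g \<bullet>\<bullet> h \<in> limit_group G" by (rule limit_groupI[OF G_mult[OF gK K(2)]])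
  show "limit_action l V R_check (g \<bullet>\<bullet> h) x = limit_action l V R_check g (limit_action l V R_check h x)"
    unfolding X(2) limit_action_cls(1)[OF h X(1)] limit_action_cls(1)[OF g limit_action_cls(2)[OF h X(1)]]
      limit_action_cls(1)[OF gh X(1)] R_check_mult[OF G_GL[OF gK] G_GL[OF K(2)]] ..
next
  fix k g h assume "l \<le> k" "g \<in> G k" "h \<in> V k"
  then show "limit_action l V R_check g (embed U h) = embed U (R_check g h)"
    unfolding embed_def by (intro limit_action_cls(1) limit_groupI cauchy_const V_U)
qed

subsection \<open>Cyclicity of the lowest weight vector\<close>

context
  fixes W assumes W: "closed_invariant_subspace G l V R_check W"
begin

lemma W_closed: "closed_subspace U W"
  using W by (simp add: closed_invariant_subspace_def)

lemma W_invariant: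
  assumes "g \<in> limit_group G" "cauchy_in U X" "cls U X \<in> W"
  shows "cls U (\<lambda>i. R_check g (X i)) \<in> W"
proof -
  have "limit_action l V R_check g (cls U X) \<in> W"
    using W assms(1,3) unfolding closed_invariant_subspace_def by blast
  then show ?thesis by (simp only: limit_action_cls(1)[OF assms(1,2)])
qed

text \<open>Each \<open>V k\<close> is by construction spanned by translates of \<open>f\<close>,
  and the union of these spaces is dense.\<close>

lemma W_cyclic:
  assumes "embed U f \<in> W" shows "W = limit_space l V"
  unfolding limit_space_def
proof (rule closed_subspace_dense[OF W_closed])
  fix h assume "h \<in> U"
  then obtain k where k: "l \<le> k" "h \<in> V k" using U_V by blast
  obtain A c where A: "finite A" "A \<subseteq> G k" "h = (\<lambda>w. \<Sum>g\<in>A. c g * R_check g f w)"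
    using k(2) by (rule V_E)
  have "cls U (\<lambda>i Z. \<Sum>g\<in>A. c g * R_check g f Z) \<in> W"
  proof (rule closed_subspace_sum[OF W_closed])
    fix g assume "g \<in> A"
    then have g: "g \<in> limit_group G" using A(2) limit_groupI by blast
    have c: "cauchy_in U (\<lambda>i. R_check g f)" by (rule limit_action_cls(2)[OF g cauchy_const[OF f_U]])
    show "cauchy_in U (\<lambda>i Z. c g * R_check g f Z) \<and> cls U (\<lambda>i Z. c g * R_check g f Z) \<in> W"
      using closed_subspace_scale[OF W_closed c] cauchy_scale[OF c]
        W_invariant[OF g cauchy_const[OF f_U]] assms by (simp add: embed_def)
  qed
  then show "embed U h \<in> W" by (simp add: embed_def A(3))
qed

end

text \<open>Passing to \<open>check\<close> inverts the weight of \<open>f\<close> and exchanges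
  upper and lower unipotent matrices; the highest weight vector for \<open>R_act\<close> is thus a
  lowest weight vector for \<open>R_check\<close>.\<close>

lemma has_lowest_signature: "has_lowest_signature G l V R_check (\<lambda>j. - int (m j))"
  unfolding has_lowest_signature_def
proof (intro bexI[OF _ f_U] conjI allI impI exI[of _ l] ballI)
  show "f \<noteq> (\<lambda>Z. 0)" by (rule f_nz)
  show "W = limit_space l V" if "closed_invariant_subspace G l V R_check W \<and> embed U f \<in> W" for W
    using that W_cyclic by blast
next
  fix k g assume k: "l \<le> k" and g: "g \<in> G k" "diagonal g"
  have "R_check g f = (\<lambda>Z. (\<Prod>j<l. check g j j ^ m j) * f Z)"
    unfolding R_check_eq using f_diagonal[OF k check_GL[OF G_GL[OF g(1)]]] check_diagonal[OF G_GL[OF g(1)] g(2)] by simp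
  then show "R_check g f = (\<lambda>Z. (\<Prod>j<l. g j j powi - int (m j)) * f Z)"
    by (simp add: check_diagonal[OF G_GL[OF g(1)] g(2)] power_int_minus power_inverse)
next
  fix k u assume k: "l \<le> k" and u: "u \<in> GL k" "lower_triangular u \<and> unit_diagonal u"
  then show "R_check u f = f"
    unfolding R_check_eq using check_lower_unipotent[OF u(1)] by (intro f_upper[OF k check_GL[OF u(1)]]) auto
qed

subsection \<open>Projection to the lowest weight space\<close>

text \<open>
  \<open>E j\<close> is the average of the action of the \<open>(d + 1)\<close>-st roots of unity in column \<open>j\<close> against the
  inverse of the weight of \<open>f\<close>; on functions of degree \<open>d\<close> it selects the monomials of the right
  degree in this column.
\<close>

definition unit_root :: "nat \<Rightarrow> complex" where
  "unit_root s = cis (2 * pi / of_nat (Suc d)) ^ s"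

definition E :: "nat \<Rightarrow> cfun \<Rightarrow> cfun" where
  "E j h = (\<lambda>Z. \<Sum>s<Suc d. (inverse (unit_root s ^ M j) / of_nat (Suc d)) * R_check (onecol j (inverse (unit_root s))) h Z)"

text \<open>The prescribed degree is 0 in columns from \<open>l\<close> on, so the later factors
  remove the monomials that involve those columns. All columns of a function in \<open>V k\<close>
  are treated as soon as \<open>n \<ge> k\<close>.\<close>

fun P :: "nat \<Rightarrow> cfun \<Rightarrow> cfun" where
  "P 0 h = h"
| "P (Suc n) h = E n (P n h)"

lemma cmod_unit_root [simp]: "cmod (unit_root s) = 1"
  by (simp add: unit_root_def norm_power)

lemma unit_root_nz [simp]: "unit_root s \<noteq> 0"
  by (simp add: unit_root_def)

lemma onecol_G: "onecol j (inverse (unit_root s)) \<in> G (Suc j)"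
  by (rule G_onecol) (simp_all add: norm_inverse)

lemma check_onecol: "t \<noteq> 0 \<Longrightarrow> check (onecol j t) = onecol j (inverse t)"
  unfolding onecol_def by (subst diag_GL(2)[of _ "Suc j"]) (auto simp: diag_def fun_eq_iff)

text \<open>The inverse put into the argument of \<open>onecol\<close> in \<open>E\<close> is undone
  by the inverse in \<open>check\<close>.\<close>

lemma R_check_onecol: "R_check (onecol j (inverse (unit_root s))) h = R_act (onecol j (unit_root s)) h"
  by (simp add: R_check_eq check_onecol)

lemma M_le: "M j \<le> d"
  unfolding M_def d_def by (auto intro: member_le_sum)

text \<open>A column degree is at most the total degree \<open>d\<close>, and so is
  \<open>M j\<close>; hence \<open>Suc d\<close> roots of unity suffice to separate the two.\<close>

lemma pcoeff_E:
  assumes h: "h \<in> polys" "\<And>a. pcoeff h a \<noteq> 0 \<Longrightarrow> mdeg a = d"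
  shows "E j h \<in> polys" "pcoeff (E j h) a = (if col a j = M j then pcoeff h a else 0)"
proof -
  let ?r = "\<lambda>s. inverse (unit_root s ^ M j) / of_nat (Suc d)"
  show "E j h \<in> polys" unfolding E_def R_check_onecol
    by (intro polys_sum polys_scale pcoeff_R_act_onecol h)
  have "pcoeff (E j h) a = (\<Sum>s<Suc d. ?r s * (unit_root s ^ col a j * pcoeff h a))"
    unfolding E_def R_check_onecol using h(1)
    by (subst pcoeff_sum) (simp_all only: pcoeff_scale pcoeff_R_act_onecol polys_scale)
  also have "\<dots> = (\<Sum>s<Suc d. inverse (unit_root s ^ M j) * unit_root s ^ col a j) * pcoeff h a / of_nat (Suc d)"
    unfolding sum_distrib_right sum_divide_distrib by (intro sum.cong refl) simp
  also have "\<dots> = (if col a j = M j then pcoeff h a else 0)"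
  proof (cases "pcoeff h a = 0")
    case False
    then have "col a j < Suc d" using h(2)[OF False] col_le_mdeg[of a j] by simp
    then show ?thesis unfolding unit_root_def
      by (subst sum_root_unity_powers) (use M_le[of j] in \<open>auto simp del: of_nat_Suc\<close>)
  qed simp
  finally show "pcoeff (E j h) a = (if col a j = M j then pcoeff h a else 0)" .
qed

lemma pcoeff_P:
  assumes h: "h \<in> polys" "\<And>a. pcoeff h a \<noteq> 0 \<Longrightarrow> mdeg a = d"
  shows "P n h \<in> polys \<and> (\<forall>a. pcoeff (P n h) a = (if \<forall>j<n. col a j = M j then pcoeff h a else 0))"
proof (induction n)
  case 0
  then show ?case using h by simp
next
  case (Suc n)
  then have "P n h \<in> polys" "\<And>a. pcoeff (P n h) a \<noteq> 0 \<Longrightarrow> mdeg a = d"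
    using h(2) by (auto split: if_splits)
  from pcoeff_E[OF this, of n] Suc show ?case by (auto simp: less_Suc_eq)
qed

lemma U_deg: "h \<in> U \<Longrightarrow> pcoeff h a \<noteq> 0 \<Longrightarrow> mdeg a = d"
proof -
  assume "h \<in> U"
  then obtain k where "l \<le> k" "h \<in> V k" using U_V by blast
  then show "pcoeff h a \<noteq> 0 \<Longrightarrow> mdeg a = d" using V_equiv_polys[of k] equiv_polys_homog by (auto simp: homog_def)
qed

lemma P_polys [simp]: "h \<in> U \<Longrightarrow> P n h \<in> polys"
  and pcoeff_P_U: "h \<in> U \<Longrightarrow> pcoeff (P n h) a = (if \<forall>j<n. col a j = M j then pcoeff h a else 0)"
  using pcoeff_P[of h n] U_deg by auto

lemma E_U: "h \<in> U \<Longrightarrow> E j h \<in> U"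
proof -
  assume "h \<in> U"
  then obtain k where k: "l \<le> k" "Suc j \<le> k" "h \<in> V k" using U_V by blast
  show ?thesis unfolding E_def
    by (intro sum_U scale_U V_U[OF k(1)] R_check_V[OF G_mono[OF k(2) onecol_G] k(3)])
qed

lemma P_U: "h \<in> U \<Longrightarrow> P n h \<in> U"
  by (induction n) (auto intro: E_U)

text \<open>The projection only deletes coefficients, so it cannot increase the weighted l2 norm.
  That the bound is the same for all \<open>n\<close> is essential when \<open>n\<close> grows with
  the terms of a Cauchy sequence.\<close>

lemma bounded_P: "bounded_on (P n) 1"
  unfolding bounded_on_def
proof (intro conjI ballI allI)
  fix h assume h: "h \<in> U"
  show "P n h \<in> U" by (rule P_U[OF h])
  have s: "msupp (P n h) \<subseteq> msupp h" using pcoeff_P_U[OF h] by (auto simp: msupp_def split: if_splits)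
  have "nrm (P n h) = L2_set (\<lambda>a. sqrt (mfact a) * cmod (pcoeff (P n h) a)) (msupp h)"
    using h s by (intro nrm_L2) auto
  also have "\<dots> \<le> L2_set (\<lambda>a. sqrt (mfact a) * cmod (pcoeff h a)) (msupp h)"
    using mfact_pos by (intro L2_set_mono) (auto simp: pcoeff_P_U[OF h] less_imp_le)
  also have "\<dots> = nrm h" using h by (intro nrm_L2[symmetric]) auto
  finally show "nrm (P n h) \<le> 1 * nrm h" by simp
  show "P n (\<lambda>Z. h Z + h' Z) = (\<lambda>Z. P n h Z + P n h' Z)" if "h' \<in> U" for h'
    using h that by (intro polys_eqI) (auto simp: pcoeff_P_U pcoeff_add)
  show "P n (\<lambda>Z. c * h Z) = (\<lambda>Z. c * P n h Z)" for c
    using h by (intro polys_eqI) (auto simp: pcoeff_P_U pcoeff_scale)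
qed simp

text \<open>The weight is tested at the single entry 2, whose powers are distinct. The block is
  taken large enough to contain column \<open>j\<close>; for \<open>j \<ge> l\<close> the weight
  does not involve this entry and the column degree is 0.\<close>

lemma pcoeff_f: "pcoeff f a \<noteq> 0 \<Longrightarrow> col a j = M j"
proof -
  assume a: "pcoeff f a \<noteq> 0"
  have "onecol j 2 \<in> GL (max l (Suc j))" unfolding onecol_def by (rule diag_GL) auto
  then have "R_act (onecol j 2) f = (\<lambda>Z. (\<Prod>j'<l. onecol j 2 j' j' ^ m j') * f Z)"
    by (intro f_diagonal[of "max l (Suc j)"]) auto
  also have "(\<Prod>j'<l. onecol j 2 j' j' ^ m j') = (\<Prod>j'<l. if j' = j then 2 ^ m j else 1)"
    by (intro prod.cong) (auto simp: onecol_def)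
  also have "\<dots> = 2 ^ M j" by (simp add: M_def)
  finally have "pcoeff (\<lambda>Z. 2 ^ M j * f Z) a = 2 ^ col a j * pcoeff f a"
    using pcoeff_R_act_onecol(2)[OF f_polys, of j 2 a] by simp
  then have "(2::complex) ^ M j = 2 ^ col a j" using a by (simp add: pcoeff_scale)
  then have "of_nat (2 ^ M j) = (of_nat (2 ^ col a j) :: complex)" by simp
  then show ?thesis unfolding of_nat_eq_iff by (simp add: power_inject_exp)
qed

text \<open>The deleted monomials do not occur in \<open>f\<close> and so contribute nothing to the
  inner product.\<close>

lemma inner_P:
  assumes h: "h \<in> U" shows "inner_poly (P n h) f = inner_poly h f"
proof -
  have s: "msupp (P n h) \<subseteq> msupp h" using pcoeff_P_U[OF h] by (auto simp: msupp_def split: if_splits)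
  have "pcoeff (P n h) a * cnj (pcoeff f a) = pcoeff h a * cnj (pcoeff f a)" for a
    using pcoeff_f[of a] by (cases "pcoeff f a = 0") (simp_all add: pcoeff_P_U[OF h])
  then show ?thesis
    using inner_poly_superset[OF P_polys[OF h] f_polys finite_msupp s]
      inner_poly_superset[OF in_polys[OF h] f_polys finite_msupp order.refl] by (simp only:)
qed

lemma equiv_polys_weight:
  assumes h: "h \<in> equiv_polys l" and c: "\<And>a j. pcoeff h a \<noteq> 0 \<Longrightarrow> j < l \<Longrightarrow> col a j = m j" and g: "diagonal g"
  shows "h (Z \<bullet>\<bullet> g) = (\<Prod>j<l. g j j ^ m j) * h Z"
proof -
  have hp: "h \<in> polys_on (S l)" using h by (simp add: equiv_polys_def)
  have e: "h Z = (\<Sum>a\<in>msupp h. pcoeff h a * mon a Z)" for Z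
    using fun_cong[OF polys_on_expand(1)[OF hp]] .
  have "h (Z \<bullet>\<bullet> g) = (\<Sum>a\<in>msupp h. pcoeff h a * ((\<Prod>j<l. g j j ^ m j) * mon a Z))"
    unfolding e[of "Z \<bullet>\<bullet> g"]
  proof (intro sum.cong refl)
    fix a assume a: "a \<in> msupp h"
    have "(\<Prod>v\<in>keys a. g (snd v) (snd v) ^ lookup a v) = (\<Prod>j<l. g j j ^ col a j)"
      using polys_on_expand(2)[OF hp a] by (intro prod_col[of _ _ "{..<l}"]) auto
    also have "\<dots> = (\<Prod>j<l. g j j ^ m j)"
      using c a by (intro prod.cong) (auto simp: msupp_def)
    finally show "pcoeff h a * mon a (Z \<bullet>\<bullet> g) = pcoeff h a * ((\<Prod>j<l. g j j ^ m j) * mon a Z)"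
      by (simp add: mon_mult_diagonal[OF g])
  qed
  also have "\<dots> = (\<Prod>j<l. g j j ^ m j) * h Z"
    by (simp add: e[of Z] sum_distrib_left mult_ac)
  finally show ?thesis .
qed

text \<open>The vanishing criterion from Gaussian elimination in terms of column degrees, the form
  in which the projections deliver their result.\<close>

lemma weight_unique:
  assumes h: "h \<in> equiv_polys l" "\<And>a j. pcoeff h a \<noteq> 0 \<Longrightarrow> j < l \<Longrightarrow> col a j = m j" "h arr_one = 0"
  shows "h = (\<lambda>Z. 0)"
  using h equiv_polys_weight[OF h(1,2)] by (intro left_equivariant_eq_0) (auto simp: equiv_polys_def)

text \<open>Otherwise \<open>f\<close> itself would vanish by the uniqueness criterion. So multiples
  of \<open>f\<close> can be recognised by their value at the identity.\<close>

lemma f_one: "f arr_one \<noteq> 0"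
  using weight_unique[OF f_equiv_polys[OF order.refl]] pcoeff_f f_nz by (auto simp: M_def)

lemma nrm_f_pos: "nrm f > 0"
  using nrm_nonneg[OF f_polys] nrm_eq_0[OF f_polys] f_nz by linarith

text \<open>For \<open>n \<ge> k\<close> every column of \<open>h\<close> has its degree prescribed.
  Degree 0 beyond column \<open>l\<close> leaves a function of \<open>l\<close> columns, where the
  weight space is one-dimensional; the scalar is found by pairing with \<open>f\<close>.\<close>

lemma P_V:
  assumes k: "l \<le> k" "k \<le> n" and h: "h \<in> V k"
  shows "P n h = (\<lambda>Z. inner_poly h f / of_real ((nrm f)\<^sup>2) * f Z)"
proof -
  have U: "h \<in> U" by (rule V_U[OF k(1) h])
  have E_equiv_polys: "E j h' \<in> equiv_polys K" if "h' \<in> equiv_polys K" "Suc j \<le> K" for j h' K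
    unfolding E_def by (intro equiv_polys_sum equiv_polys_scale equiv_polys_R_check[OF G_mono[OF that(2) onecol_G] that(1)])
  \<comment> \<open>The factor \<open>E j\<close> uses a matrix of block size \<open>Suc j\<close>,
    so the first \<open>n\<close> factors stay within \<open>n\<close> columns.\<close>
  have "P n' h \<in> equiv_polys n" if "n' \<le> n" for n'
    using that
  proof (induction n')
    case 0
    then show ?case using V_equiv_polys[OF k(1)] equiv_polys_mono[OF k(2)] h by auto
  qed (auto intro: E_equiv_polys)
  then have gn: "P n h \<in> equiv_polys n" by simp
  have kV: "h \<in> polys_on (S k)" using V_equiv_polys[OF k(1)] h by (auto simp: equiv_polys_def)
  have c: "col a j = M j" if "pcoeff (P n h) a \<noteq> 0" "j < n" for a j
    using that by (auto simp: pcoeff_P_U[OF U] split: if_splits)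
  \<comment> \<open>A variable in a column from \<open>l\<close> on would give this column a
    positive degree, contrary to the value 0 of \<open>M\<close>.\<close>
  have "keys a \<subseteq> S l" if a: "pcoeff (P n h) a \<noteq> 0" for a
  proof
    fix v assume v: "v \<in> keys a"
    have "keys a \<subseteq> S n" using gn a by (auto simp: equiv_polys_def polys_on_def)
    then have vn: "fst v < l" "snd v < n" using v by auto
    then have "snd v < l" using c[OF a vn(2)] col_eq_0D[OF _ v, of "snd v"] by (auto simp: M_def split: if_splits)
    then show "v \<in> S l" using vn by (cases v) auto
  qed
  then have gl: "P n h \<in> equiv_polys l" using gn by (auto simp: equiv_polys_def polys_on_def)
  \<comment> \<open>The scalar is chosen so that the difference vanishes at the identity
    matrix.\<close>
  define c0 where "c0 = P n h arr_one / f arr_one"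
  let ?h = "\<lambda>Z. P n h Z + (- c0) * f Z"
  have "?h = (\<lambda>Z. 0)"
  proof (rule weight_unique)
    show "?h \<in> equiv_polys l"
      by (intro equiv_polys_add gl equiv_polys_scale f_equiv_polys order.refl)
    show "?h arr_one = 0" using f_one by (simp add: c0_def)
    fix a j assume a: "pcoeff ?h a \<noteq> 0" and j: "j < l"
    have "pcoeff ?h a = pcoeff (P n h) a + (- c0) * pcoeff f a"
      using U polys_scale[OF f_polys, of "- c0"] by (simp only: pcoeff_add P_polys pcoeff_scale f_polys)
    then have "pcoeff (P n h) a \<noteq> 0 \<or> pcoeff f a \<noteq> 0" using a by auto
    then show "col a j = m j" using c[of a j] pcoeff_f[of a j] j k by (auto simp: M_def)
  qed
  then have Ph: "P n h = (\<lambda>Z. c0 * f Z)" by (simp add: fun_eq_iff)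
  \<comment> \<open>The projection does not change the inner product with \<open>f\<close>, so
    \<open>c0\<close> can be expressed by \<open>h\<close> itself.\<close>
  have "c0 * of_real ((nrm f)\<^sup>2) = inner_poly h f"
    using inner_P[OF U, of n] unfolding Ph by (simp add: inner_poly_scale_left inner_poly_self del: of_real_power)
  then have "c0 = inner_poly h f / of_real ((nrm f)\<^sup>2)" using nrm_f_pos by (auto simp: field_simps)
  then show ?thesis using Ph by simp
qed

subsection \<open>Irreducibility\<close>

text \<open>Adjointness of matrix substitutions holds for a fixed number of columns, so
  \<open>h\<close>, \<open>f\<close> and \<open>g\<close> are first brought to a common
  level.\<close>

lemma inner_R_check_adjoint:
  assumes g: "g \<in> G k" and h: "h \<in> U"
  shows "inner_poly (R_check (arr_adjoint g) h) f = inner_poly h (R_check g f)"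
proof -
  obtain K where K: "l \<le> K" "k \<le> K" "h \<in> V K" using U_V[OF h] by blast
  have gK: "g \<in> GL K" by (rule G_GL[OF G_mono[OF K(2) g]])
  have "h \<in> homog d (S K)" "f \<in> homog d (S K)"
    using equiv_polys_homog V_equiv_polys[OF K(1)] K(3) f_equiv_polys[OF K(1)] by auto
  from inner_poly_R_act[OF check_block[OF adjoint_GL(1)[OF gK]] finite_lessThan this]
  show ?thesis by (simp add: R_check_eq adjoint_check_adjoint[OF gK])
qed

context
  fixes W assumes W: "closed_invariant_subspace G l V R_check W"
begin

text \<open>The average over a cyclic group is a finite combination of translates, so invariance and
  the linear structure of \<open>W\<close> suffice.\<close>

lemma W_E:
  assumes X: "cauchy_in U X" "cls U X \<in> W"
  shows "cauchy_in U (\<lambda>i. E j (X i)) \<and> cls U (\<lambda>i. E j (X i)) \<in> W"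
proof -
  let ?g = "\<lambda>s. onecol j (inverse (unit_root s))" and ?c = "\<lambda>s. inverse (unit_root s ^ M j) / of_nat (Suc d)"
  have g: "?g s \<in> limit_group G" for s by (rule limit_groupI[OF onecol_G])
  have c: "cauchy_in U (\<lambda>i Z. ?c s * R_check (?g s) (X i) Z)" for s
    by (intro cauchy_scale limit_action_cls(2)[OF g X(1)])
  have w: "cls U (\<lambda>i Z. ?c s * R_check (?g s) (X i) Z) \<in> W" for s
    by (intro closed_subspace_scale[OF W_closed[OF W]] limit_action_cls(2)[OF g X(1)] W_invariant[OF W g X])
  show ?thesis unfolding E_def
    by (intro conjI cauchy_sum[OF c] closed_subspace_sum[OF W_closed[OF W]]) (rule c, rule w)
qed

lemma W_P:
  assumes X: "cauchy_in U X" "cls U X \<in> W"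
  shows "cauchy_in U (\<lambda>i. P n (X i)) \<and> cls U (\<lambda>i. P n (X i)) \<in> W"
proof (induction n)
  case (Suc n)
  then show ?case using W_E[of "\<lambda>i. P n (X i)" n] by simp
qed (use X in simp)

text \<open>The projections of \<open>Y\<close> converge to the multiple of \<open>f\<close> with coefficient \<open>\<langle>Y, f\<rangle> / \<langle>f, f\<rangle>\<close>.\<close>

lemma f_in_W:
  assumes Y: "cauchy_in U Y" "cls U Y \<in> W" and nz: "\<not> (\<lambda>i. inner_poly (Y i) f) \<longlonglongrightarrow> 0"
  shows "embed U f \<in> W"
proof -
  note YU = cauchy_U[OF Y(1)]
  let ?N = "complex_of_real ((nrm f)\<^sup>2)"
  \<comment> \<open>The coefficient of \<open>f\<close> in the projection of the term
    \<open>Y i\<close>, as given by \<open>P_V\<close>. The Cauchy-Schwarz inequality makes these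
    numbers a Cauchy sequence.\<close>
  define a where "a i = inner_poly (Y i) f / ?N" for i
  have aa: "cmod (a i - a j) \<le> nrm (\<lambda>Z. Y i Z - Y j Z) / nrm f" for i j
  proof -
    have "a i - a j = inner_poly (\<lambda>Z. Y i Z - Y j Z) f / ?N"
      using YU by (simp add: a_def inner_poly_diff_left diff_divide_distrib)
    then have "cmod (a i - a j) = cmod (inner_poly (\<lambda>Z. Y i Z - Y j Z) f) / (nrm f)\<^sup>2"
      by (simp add: norm_divide norm_power del: of_real_power)
    also have "\<dots> \<le> nrm (\<lambda>Z. Y i Z - Y j Z) * nrm f / (nrm f)\<^sup>2"
      using YU by (intro divide_right_mono inner_poly_Cauchy_Schwarz) auto
    also have "\<dots> = nrm (\<lambda>Z. Y i Z - Y j Z) / nrm f" by (simp add: power2_eq_square)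
    finally show ?thesis .
  qed
  have "Cauchy a"
  proof (rule metric_CauchyI)
    fix e :: real assume "e > 0"
    then obtain N where N: "\<forall>i\<ge>N. \<forall>j\<ge>N. nrm (\<lambda>Z. Y i Z - Y j Z) < e * nrm f"
      using cauchyD[OF Y(1), of "e * nrm f"] nrm_f_pos by auto
    have "dist (a i) (a j) < e" if "i \<ge> N" "j \<ge> N" for i j
    proof -
      have "nrm (\<lambda>Z. Y i Z - Y j Z) < e * nrm f" using N that by blast
      then have "nrm (\<lambda>Z. Y i Z - Y j Z) / nrm f < e" using nrm_f_pos by (simp add: pos_divide_less_eq)
      then show ?thesis using aa[of i j] unfolding dist_norm by linarith
    qed
    then show "\<exists>N. \<forall>i\<ge>N. \<forall>j\<ge>N. dist (a i) (a j) < e" by blast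
  qed
  then obtain c where c: "a \<longlonglongrightarrow> c" using Cauchy_convergent convergent_def by blast
  have "c \<noteq> 0"
  proof
    assume "c = 0"
    then have "(\<lambda>i. a i * ?N) \<longlonglongrightarrow> 0" using tendsto_mult_left_zero[of a] c by blast
    moreover have "a i * ?N = inner_poly (Y i) f" for i using nrm_f_pos by (simp add: a_def)
    ultimately show False using nz by simp
  qed
  \<comment> \<open>Each term lies at some finite level \<open>\<kappa> i\<close>, in general
    growing with \<open>i\<close>. The projection \<open>P (\<kappa> n)\<close> takes the n-th term
    exactly to \<open>a n\<close> times \<open>f\<close>.\<close>
  have "\<exists>k\<ge>l. Y i \<in> V k" for i using U_V[OF YU[of i]] by blast
  then obtain \<kappa> where \<kappa>: "\<And>i. l \<le> \<kappa> i" "\<And>i. Y i \<in> V (\<kappa> i)" by metis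
  have cc: "cauchy_in U (\<lambda>i Z. c * f Z)" by (intro cauchy_const scale_U f_U)
  have "cls U (\<lambda>i Z. c * f Z) \<in> W"
  proof (rule closed_subspace_limit[OF W_closed[OF W], of "\<lambda>n i. P (\<kappa> n) (Y i)"])
    show "cauchy_in U (\<lambda>i. P (\<kappa> n) (Y i))" "cls U (\<lambda>i. P (\<kappa> n) (Y i)) \<in> W" for n
      using W_P[OF Y] by auto
    fix e :: real assume e: "e > 0"
    obtain N where N: "\<forall>i\<ge>N. \<forall>j\<ge>N. nrm (\<lambda>Z. Y i Z - Y j Z) < e / 2"
      using cauchyD[OF Y(1), of "e / 2"] e by auto
    obtain N' where N': "\<forall>n\<ge>N'. cmod (a n - c) < e / 2 / nrm f"
      using LIMSEQ_D[OF c, of "e / 2 / nrm f"] e nrm_f_pos by auto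
    \<comment> \<open>The image of the n-th term stands in between: the contraction property
      compares it with the image of \<open>Y i\<close>, and the convergence of \<open>a\<close>
      compares it with the limit.\<close>
    have "nrm (\<lambda>Z. P (\<kappa> n) (Y i) Z - c * f Z) \<le> e" if n: "n \<ge> max N N'" and i: "i \<ge> N" for n i
    proof -
      let ?P = "P (\<kappa> n)"
      have Pn: "?P (Y n) = (\<lambda>Z. a n * f Z)"
        unfolding a_def by (rule P_V[OF \<kappa>(1) order.refl \<kappa>(2)])
      have "nrm (\<lambda>Z. ?P (Y i) Z - c * f Z) \<le>
        nrm (\<lambda>Z. ?P (Y i) Z - ?P (Y n) Z) + nrm (\<lambda>Z. ?P (Y n) Z - c * f Z)"
        using YU by (intro nrm_triangle_diff) auto
      also have "nrm (\<lambda>Z. ?P (Y i) Z - ?P (Y n) Z) \<le> 1 * nrm (\<lambda>Z. Y i Z - Y n Z)"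
        by (rule bounded_on_diff_le[OF bounded_P YU YU])
      also have "\<dots> \<le> e / 2" using N n i by (simp add: less_imp_le)
      also have "nrm (\<lambda>Z. ?P (Y n) Z - c * f Z) = cmod (a n - c) * nrm f"
        unfolding Pn using nrm_scale[OF f_polys, of "a n - c"] by (simp add: algebra_simps)
      also have "\<dots> \<le> e / 2 / nrm f * nrm f"
        using N' n nrm_f_pos by (intro mult_right_mono) (auto simp: less_imp_le)
      also have "\<dots> = e / 2" using nrm_f_pos by simp
      finally show ?thesis by simp
    qed
    then show "\<exists>M. \<forall>n\<ge>M. \<exists>N. \<forall>i\<ge>N. nrm (\<lambda>Z. P (\<kappa> n) (Y i) Z - c * f Z) \<le> e" by blast
  qed (rule cc)
  from closed_subspace_scale[OF W_closed[OF W] cc this, of "inverse c"]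
  show ?thesis using \<open>c \<noteq> 0\<close> by (simp add: embed_def mult.assoc[symmetric])
qed

text \<open>A nonzero \<open>x\<close> in \<open>W\<close> is not orthogonal to a late term
  \<open>h\<close> of a representative. As \<open>h\<close> is a finite combination of translates of
  \<open>f\<close>, one translate already has a nonzero pairing with \<open>x\<close>, and an
  adjoint moves the group element over to \<open>x\<close>.\<close>

lemma W_irreducible: "W = {czero U} \<or> W = limit_space l V"
proof (cases "W = {czero U}")
  case False
  have z: "czero U \<in> W" "W \<subseteq> completion U"
    using W_closed[OF W] unfolding closed_subspace_def by blast+
  then obtain x where x: "x \<in> W" "x \<noteq> czero U" using False by blast
  then obtain X where X: "cauchy_in U X" "x = cls U X" using z(2) completionE by blast
  note XU = cauchy_U[OF X(1)]
  define L where "L = cnorm x"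
  have L: "(\<lambda>i. nrm (X i)) \<longlonglongrightarrow> L" using cnorm_cls[OF X(1)] X(2) by (simp add: L_def)
  have "\<not> null_seq X"
    using x(2) cls_eq_iff[OF X(1) cauchy_const[OF zero_U]] by (simp add: X(2) czero_def embed_def)
  then have "L \<noteq> 0" using L by (auto simp: null_seq_def)
  moreover have "L \<ge> 0" using XU by (intro LIMSEQ_le_const[OF L]) auto
  ultimately have Lp: "L > 0" by simp
  obtain N where N: "\<forall>i\<ge>N. \<forall>j\<ge>N. nrm (\<lambda>Z. X i Z - X j Z) < L / 4"
    using cauchyD[OF X(1), of "L / 4"] Lp by auto
  obtain N' where N': "\<forall>i\<ge>N'. \<bar>nrm (X i) - L\<bar> < L / 2"
    using LIMSEQ_D[OF L, of "L / 2"] Lp by auto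
  define J where "J = max N N'"
  define h where "h = X J"
  have h: "h \<in> U" using XU by (simp add: h_def)
  have "\<bar>nrm h - L\<bar> < L / 2" using N' unfolding h_def J_def by simp
  then have hn: "nrm h > L / 2" unfolding abs_less_iff by simp
  \<comment> \<open>By the choice of \<open>J\<close> the term \<open>h\<close> has norm above
    \<open>L / 2\<close> and later terms differ from it by less than \<open>L / 4\<close>; so the
    pairing is at least the norm of \<open>h\<close> times its excess over
    \<open>L / 4\<close>.\<close>
  have low: "cmod (inner_poly (X i) h) \<ge> L / 2 * (L / 4)" if "i \<ge> J" for i
  proof -
    have "inner_poly (X i) h = of_real ((nrm h)\<^sup>2) + inner_poly (\<lambda>Z. X i Z - h Z) h"
      using XU h by (simp add: inner_poly_diff_left inner_poly_self del: of_real_power)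
    then have "cmod (inner_poly (X i) h) \<ge> (nrm h)\<^sup>2 - cmod (inner_poly (\<lambda>Z. X i Z - h Z) h)"
      using norm_triangle_ineq2[of "of_real ((nrm h)\<^sup>2)" "- inner_poly (\<lambda>Z. X i Z - h Z) h"]
      by (simp del: of_real_power)
    moreover have "cmod (inner_poly (\<lambda>Z. X i Z - h Z) h) \<le> nrm (\<lambda>Z. X i Z - h Z) * nrm h"
      using XU h by (intro inner_poly_Cauchy_Schwarz) auto
    moreover have "nrm (\<lambda>Z. X i Z - h Z) * nrm h \<le> L / 4 * nrm h"
      using N that hn Lp by (intro mult_right_mono) (auto simp: h_def J_def less_imp_le)
    moreover have "L / 2 * (L / 4) \<le> nrm h * (nrm h - L / 4)"
      using hn Lp by (intro mult_mono) auto
    ultimately show ?thesis by (simp add: power2_eq_square algebra_simps)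
  qed
  obtain k where k: "l \<le> k" "h \<in> V k" using U_V[OF h] by blast
  obtain A c where A: "finite A" "A \<subseteq> G k" "h = (\<lambda>w. \<Sum>g\<in>A. c g * R_check g f w)"
    using k(2) by (rule V_E)
  have RU: "R_check g f \<in> U" if "g \<in> A" for g
    using that A(2) R_check_f_V V_U[OF k(1)] by blast
  \<comment> \<open>If all pairings with the translates tended to 0, so would their finite
    combination, the pairing with \<open>h\<close>.\<close>
  have "\<exists>g\<in>A. \<not> (\<lambda>i. inner_poly (X i) (R_check g f)) \<longlonglongrightarrow> 0"
  proof (rule ccontr)
    assume "\<not> ?thesis"
    then have "(\<lambda>i. \<Sum>g\<in>A. cnj (c g) * inner_poly (X i) (R_check g f)) \<longlonglongrightarrow> 0"
      by (intro tendsto_null_sum tendsto_mult_right_zero) auto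
    moreover have "(\<Sum>g\<in>A. cnj (c g) * inner_poly (X i) (R_check g f)) = inner_poly (X i) h" for i
      unfolding A(3) using XU RU by (simp add: inner_poly_sum_right inner_poly_scale_right)
    ultimately have "(\<lambda>i. inner_poly (X i) h) \<longlonglongrightarrow> 0" by simp
    then obtain K where K: "\<forall>i\<ge>K. cmod (inner_poly (X i) h) < L / 2 * (L / 4)"
      using LIMSEQ_D[of _ 0 "L / 2 * (L / 4)"] Lp by auto
    show False using low[of "max K J"] K by (meson linorder_not_le max.cobounded1 max.cobounded2)
  qed
  then obtain g where g: "g \<in> A" "\<not> (\<lambda>i. inner_poly (X i) (R_check g f)) \<longlonglongrightarrow> 0" by blast
  have gG: "g \<in> G k" using g A by blast
  have ag: "arr_adjoint g \<in> limit_group G" by (rule limit_groupI[OF G_adjoint[OF gG]])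
  \<comment> \<open>The adjoint of \<open>g\<close> belongs to the group in both cases, so the
    translate of \<open>x\<close> by it stays in \<open>W\<close>, and its pairing with
    \<open>f\<close> is that of \<open>x\<close> with the translate of \<open>f\<close>.\<close>
  have "embed U f \<in> W"
  proof (rule f_in_W)
    show "cauchy_in U (\<lambda>i. R_check (arr_adjoint g) (X i))" by (rule limit_action_cls(2)[OF ag X(1)])
    show "cls U (\<lambda>i. R_check (arr_adjoint g) (X i)) \<in> W"
      using x(1) X(2) by (intro W_invariant[OF W ag X(1)]) simp
    show "\<not> (\<lambda>i. inner_poly (R_check (arr_adjoint g) (X i)) f) \<longlonglongrightarrow> 0"
      using g(2) by (simp add: inner_R_check_adjoint[OF gG XU])
  qed
  then show ?thesis using W_cyclic[OF W] by simp
qed simp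

end

lemma limit_irreducible: "limit_irreducible G l V R_check"
  using W_irreducible by (simp add: limit_irreducible_def)

end

theorem theoremV1:
  fixes l :: nat and m :: "nat \<Rightarrow> nat" and f_max :: cfun and G :: "nat \<Rightarrow> arr set"
  assumes "1 \<le> l"
    and "\<And>i j. i \<le> j \<Longrightarrow> j < l \<Longrightarrow> m j \<le> m i"
    and "G = unitary \<or> G = GL"
    and "is_f_max l m f_max"
  shows "inductive_system G l (V_check G f_max) R_check \<and>
         is_limit_representation G l (V_check G f_max) R_check \<and>
         limit_irreducible G l (V_check G f_max) R_check \<and>
         has_lowest_signature G l (V_check G f_max) R_check (\<lambda>j. - int (m j))"
proof -
  have "contragredient l m f_max G" using assms(3,4) by (rule contragredient.intro)
  note c = contragredient.inductive_system[OF this] contragredient.is_limit_representation[OF this]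
    contragredient.limit_irreducible[OF this] contragredient.has_lowest_signature[OF this]
  from c show ?thesis by (intro conjI)
qed

end
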